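(* Let $G_0$ be one of the groups $\mathrm{SL}(2,\mathbb R)$, $\mathrm{SL}(2,\mathbb C)$, or $\mathrm{SO}_e(n,1)$ with $n\ge 2$. Let $\mathfrak g_0=\mathfrak k_0\oplus\mathfrak s_0$ be a Cartan decomposition of its Lie algebra and $K_0$ the corresponding maximal compact subgroup (the analytic subgroup with Lie algebra $\mathfrak k_0$). Let $G=G_0\times G_0\times G_0$, $H=\{(g,g,g):g\in G_0\}$, $K=K_0\times K_0\times K_0$. Let $\mathfrak a_1,\mathfrak a_2,\mathfrak a_3\subset\mathfrak s_0$ be maximal abelian subspaces, $\mathfrak a=\mathfrak a_1\times\mathfrak a_2\times\mathfrak a_3$ and $A=\exp\mathfrak a=\exp\mathfrak a_1\times\exp\mathfrak a_2\times\exp\mathfrak a_3$. Then $G=KAH$ if and only if the subspace $\mathfrak a_1+\mathfrak a_2+\mathfrak a_3$ of $\mathfrak g_0$ has dimension two. In particular, there exists an abelian subspace $\mathfrak a$ of $\mathfrak s=\mathfrak s_0\times\mathfrak s_0\times\mathfrak s_0$ with $G=K\exp(\mathfrak a)H$.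
   Context: $\mathrm{SO}_e(n,1)$ denotes the identity component of $\mathrm{SO}(n,1)$. For these groups the maximal abelian subspaces of $\mathfrak s_0$ are one-dimensional. $KAH$ denotes $\{kah: k\in K,a\in A,h\in H\}$. *)

theory Defs
  imports "HOL-Analysis.Analysis"
begin

text \<open>All groups are realised as groups of complex n x n matrices (real groups as
  matrices with real entries); Lie algebras are real subspaces of such matrices.\<close>

type_synonym 'n cmat = "complex^'n^'n"

fun matpow :: "'n::finite cmat \<Rightarrow> nat \<Rightarrow> 'n cmat" where
  "matpow X 0 = mat 1"
| "matpow X (Suc k) = X ** matpow X k"

definition mexp :: "'n::finite cmat \<Rightarrow> 'n cmat" where
  "mexp X = (\<Sum>k. (1 / fact k) *\<^sub>R matpow X k)"

definition bra :: "'n::finite cmat \<Rightarrow> 'n cmat \<Rightarrow> 'n cmat" where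
  "bra X Y = X ** Y - Y ** X"

definition lie_algebra :: "'n::finite cmat set \<Rightarrow> 'n cmat set" where
  "lie_algebra G = {X. \<forall>t::real. mexp (t *\<^sub>R X) \<in> G}"

definition trace_on :: "'n::finite cmat set \<Rightarrow> ('n cmat \<Rightarrow> 'n cmat) \<Rightarrow> real" where
  "trace_on V f = (let B = (SOME B. B \<subseteq> V \<and> independent B \<and> span B = V)
                   in \<Sum>b\<in>B. representation B (f b) b)"

definition killing :: "'n::finite cmat set \<Rightarrow> 'n cmat \<Rightarrow> 'n cmat \<Rightarrow> real" where
  "killing g X Y = trace_on g (\<lambda>Z. bra X (bra Y Z))"

definition cartan_involution :: "'n::finite cmat set \<Rightarrow> ('n cmat \<Rightarrow> 'n cmat) \<Rightarrow> bool" where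
  "cartan_involution g \<theta> \<longleftrightarrow>
     (\<forall>X\<in>g. \<theta> X \<in> g) \<and>
     (\<forall>X\<in>g. \<forall>Y\<in>g. \<forall>a b::real. \<theta> (a *\<^sub>R X + b *\<^sub>R Y) = a *\<^sub>R \<theta> X + b *\<^sub>R \<theta> Y) \<and>
     (\<forall>X\<in>g. \<forall>Y\<in>g. \<theta> (bra X Y) = bra (\<theta> X) (\<theta> Y)) \<and>
     (\<forall>X\<in>g. \<theta> (\<theta> X) = X) \<and>
     (\<forall>X\<in>g. X \<noteq> 0 \<longrightarrow> killing g X (\<theta> X) < 0)"

definition cartan_k :: "'n::finite cmat set \<Rightarrow> ('n cmat \<Rightarrow> 'n cmat) \<Rightarrow> 'n cmat set" where
  "cartan_k g \<theta> = {X\<in>g. \<theta> X = X}"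

definition cartan_s :: "'n::finite cmat set \<Rightarrow> ('n cmat \<Rightarrow> 'n cmat) \<Rightarrow> 'n cmat set" where
  "cartan_s g \<theta> = {X\<in>g. \<theta> X = - X}"

definition analytic_subgroup :: "'n::finite cmat set \<Rightarrow> 'n cmat set" where
  "analytic_subgroup k = \<Inter>{S. mat 1 \<in> S \<and> mexp ` k \<subseteq> S \<and>
       (\<forall>a\<in>S. \<forall>b\<in>S. a ** b \<in> S) \<and> (\<forall>a\<in>S. matrix_inv a \<in> S)}"

definition abelian_subspace :: "'n::finite cmat set \<Rightarrow> 'n cmat set \<Rightarrow> bool" where
  "abelian_subspace s a \<longleftrightarrow> subspace a \<and> a \<subseteq> s \<and> (\<forall>X\<in>a. \<forall>Y\<in>a. bra X Y = 0)"

definition maximal_abelian_subspace :: "'n::finite cmat set \<Rightarrow> 'n cmat set \<Rightarrow> bool" where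
  "maximal_abelian_subspace s a \<longleftrightarrow> abelian_subspace s a \<and>
     (\<forall>b. abelian_subspace s b \<and> a \<subseteq> b \<longrightarrow> b = a)"

definition real_mat :: "'n::finite cmat \<Rightarrow> bool" where
  "real_mat g \<longleftrightarrow> (\<forall>i j. g $ i $ j \<in> \<real>)"

definition SL_R :: "'n::finite cmat set" where
  "SL_R = {g. real_mat g \<and> det g = 1}"

definition SL_C :: "'n::finite cmat set" where
  "SL_C = {g. det g = 1}"

definition lorentz_form :: "'n::finite \<Rightarrow> 'n cmat" where
  "lorentz_form i0 = (\<chi> i j. if i = j then (if i = i0 then -1 else 1) else 0)"

definition SO_n1 :: "'n::finite \<Rightarrow> 'n cmat set" where
  "SO_n1 i0 = {g. real_mat g \<and> transpose g ** lorentz_form i0 ** g = lorentz_form i0 \<and> det g = 1}"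

definition SOe_n1 :: "'n::finite \<Rightarrow> 'n cmat set" where
  "SOe_n1 i0 = connected_component_set (SO_n1 i0) (mat 1)"

end

theory Submission
  imports Defs
begin

text \<open>Each of the three groups acts on a Lorentzian vector space \<open>V\<close> (Hermitian or real symmetric
  2 by 2 matrices with minus twice the determinant, or Minkowski space), and its Lie algebra is all
  of \<open>\<ss>\<oo>(V)\<close>. The compact group attached to a Cartan involution has a bounded orbit on the forward
  hyperboloid, so it fixes a point \<open>w\<close>; a comparison of Killing forms then shows that \<open>\<kk>\<close> is the
  stabilizer of \<open>w\<close> and \<open>\<ss>\<close> consists of the infinitesimal boosts at \<open>w\<close>. Hence maximal abelian
  subspaces of \<open>\<ss>\<close> are lines, \<open>exp \<aa>\<close> moves \<open>w\<close> along a geodesic, and \<open>G = KAH\<close> says that every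
  triple of points of the hyperboloid can be moved by one group element so that the points lie on
  the three given geodesics through \<open>w\<close>.

  If the geodesics span a space of dimension one (three), this fails for non-collinear points
  (three distinct collinear points). If they span a plane, slide the side \<open>z1 z2\<close> of the triangle
  along the first two geodesics until it has turned by a half rotation about \<open>w\<close>: the signed
  distance of \<open>z3\<close> from the third geodesic changes sign, hence vanishes somewhere.\<close>

section \<open>The matrix exponential\<close>

text \<open>Nothing about the involution is given beyond its axioms, so neither compactness of the
  group attached to \<kk> nor the position of \<kk> is known at the start. What definiteness of the
  Killing form yields is an inner product on the Lie algebra that this group preserves under
  \<open>Ad\<close>, and infinitesimal boosts convert a bound for \<open>Ad\<close> into a bound for
  an orbit in \<open>V\<close>. The group is seen only through its action on \<open>V\<close>, which
  leaves two gaps. Elements acting trivially must be shown to lie in every stabilizer's analytic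
  subgroup; for SL(2) this means writing -1 as the exponential of an element that fixes a prescribed
  point. And the group contains no reflections. Two orthonormal frames can therefore be matched
  freely only if a spare orthogonal direction allows a half turn; for n = 2 there is none, and the
  orientations have to agree. For this reason the sliding construction is carried out for both signs
  of the frame of normals, and the sign is chosen only when the target frame is known. The absence
  of reflections also has a good side: it is what makes a point stabilizer equal to the subgroup
  generated by exponentials.\<close>

lemma bilinear_matrix_mult: "bilinear ((**) :: 'n::finite cmat \<Rightarrow> 'n cmat \<Rightarrow> 'n cmat)"
  unfolding bilinear_def linear_iff
  by (auto simp: matrix_matrix_mult_def vec_eq_iff algebra_simps sum.distrib scaleR_sum_right
      simp del: scaleR_conv_of_real)

lemma bounded_bilinear_matrix_mult:
  "bounded_bilinear ((**) :: 'n::finite cmat \<Rightarrow> 'n cmat \<Rightarrow> 'n cmat)"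
  using bilinear_matrix_mult bilinear_conv_bounded_bilinear by blast

lemmas cmat_mult_simps =
  bounded_bilinear.add_left[OF bounded_bilinear_matrix_mult]
  bounded_bilinear.add_right[OF bounded_bilinear_matrix_mult]
  bounded_bilinear.diff_left[OF bounded_bilinear_matrix_mult]
  bounded_bilinear.diff_right[OF bounded_bilinear_matrix_mult]
  bounded_bilinear.minus_left[OF bounded_bilinear_matrix_mult]
  bounded_bilinear.minus_right[OF bounded_bilinear_matrix_mult]
  bounded_bilinear.scaleR_left[OF bounded_bilinear_matrix_mult]
  bounded_bilinear.scaleR_right[OF bounded_bilinear_matrix_mult]
  bounded_bilinear.zero_left[OF bounded_bilinear_matrix_mult]
  bounded_bilinear.zero_right[OF bounded_bilinear_matrix_mult]

lemma matpow_scaleR: "matpow (t *\<^sub>R X) k = t ^ k *\<^sub>R matpow X k"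
  by (induction k) (simp_all add: cmat_mult_simps)

lemma matpow_commute: "matpow X k ** X = X ** matpow X k"
  by (induction k) (simp_all add: matrix_mul_assoc[symmetric])

text \<open>The norm is the Euclidean one, for which a product is bounded up to a constant
  \<open>K\<close>. Induction gives the bound \<open>(K * norm X) ^ k\<close>, so a real exponential
  series dominates.\<close>

lemma summable_mexp: "summable (\<lambda>k. (1 / fact k) *\<^sub>R matpow (X::'n::finite cmat) k)"
proof -
  have "\<exists>K>0. \<forall>(a :: 'n cmat) (b :: 'n cmat). norm (a ** b) \<le> norm a * norm b * K"
    by (rule bounded_bilinear.pos_bounded[OF bounded_bilinear_matrix_mult])
  then obtain K where K: "K > 0" "\<And>(a :: 'n cmat) (b :: 'n cmat). norm (a ** b) \<le> norm a * norm b * K"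
    by (elim exE conjE) (rule that, auto)
  have bd: "norm (matpow X k) \<le> norm (mat 1 :: 'n cmat) * (K * norm X) ^ k" for k
  proof (induction k)
    case (Suc k)
    have "norm (matpow X (Suc k)) \<le> norm X * norm (matpow X k) * K" using K(2) by simp
    also have "\<dots> \<le> norm X * (norm (mat 1 :: 'n cmat) * (K * norm X) ^ k) * K"
      using Suc K(1) by (intro mult_right_mono mult_left_mono) auto
    finally show ?case by (simp add: mult_ac)
  qed simp
  have "summable (\<lambda>k. norm (mat 1 :: 'n cmat) * (inverse (fact k) * (K * norm X) ^ k))"
    by (intro summable_mult summable_exp)
  then show ?thesis
  proof (rule summable_comparison_test'[where N=0])
    fix k :: nat
    have "norm ((1 / fact k) *\<^sub>R matpow X k) = (1 / fact k) * norm (matpow X k)" by simp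
    also have "\<dots> \<le> (1 / fact k) * (norm (mat 1 :: 'n cmat) * (K * norm X) ^ k)"
      by (intro mult_left_mono bd) simp
    finally show "norm ((1 / fact k) *\<^sub>R matpow X k) \<le> norm (mat 1 :: 'n cmat) * (inverse (fact k) * (K * norm X) ^ k)"
      by (simp add: field_simps)
  qed
qed

lemma bounded_linear_suminf_mexp:
  assumes "bounded_linear f"
  shows "f (mexp X) = (\<Sum>k. f ((1 / fact k) *\<^sub>R matpow X k))"
        "summable (\<lambda>k. f ((1 / fact k) *\<^sub>R matpow X k))"
  unfolding mexp_def
  using bounded_linear.suminf[OF assms summable_mexp] bounded_linear.summable[OF assms summable_mexp] by auto

lemma bounded_linear_entry: "bounded_linear (\<lambda>A::'n::finite cmat. A $ i $ j)"
  by (rule bounded_linear_compose[OF bounded_linear_vec_nth bounded_linear_vec_nth])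

lemma has_vector_derivative_vec:
  fixes f :: "real \<Rightarrow> 'a::real_normed_vector ^ 'm"
  assumes "\<And>i. ((\<lambda>t. f t $ i) has_vector_derivative (f' $ i)) F"
  shows "(f has_vector_derivative f') F"
proof -
  have "((\<lambda>y. ((f y - f (Lim F (\<lambda>x. x))) - (y - Lim F (\<lambda>x. x)) *\<^sub>R f') /\<^sub>R norm (y - Lim F (\<lambda>x. x))) \<longlongrightarrow> 0) F"
    using assms unfolding has_vector_derivative_def has_derivative_def
    by (intro vec_tendstoI) auto
  then show ?thesis
    unfolding has_vector_derivative_def has_derivative_def
    by (auto intro: bounded_linear_scaleR_left)
qed

text \<open>Each entry is a complex power series in the parameter, so it can be differentiated term
  by term and then restricted to real \<open>t\<close>; the shift of coefficients reproduces
  multiplication by \<open>X\<close>.\<close>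

lemma mexp_has_vector_derivative:
  "((\<lambda>t. mexp (t *\<^sub>R X)) has_vector_derivative (X ** mexp (t *\<^sub>R X))) (at t)" for X :: "'n::finite cmat"
proof (intro has_vector_derivative_vec)
  fix i j
  define c where "c i j k = (1 / fact k) *\<^sub>R (matpow X k $ i $ j)" for i j k
  have e: "mexp (s *\<^sub>R X) $ i $ j = (\<Sum>k. c i j k * of_real s ^ k)" for i j and s :: real
    by (subst bounded_linear_suminf_mexp(1)[OF bounded_linear_entry])
      (simp add: matpow_scaleR c_def, simp add: scaleR_conv_of_real mult_ac)
  \<comment> \<open>Convergence at the real point \<open>norm z + 1\<close>, where the series is an
    entry of \<open>mexp\<close>, gives convergence at every complex \<open>z\<close> inside that
    radius.\<close>
  have s: "summable (\<lambda>k. c i j k * z ^ k)" for i j z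
  proof (rule powser_inside)
    show "summable (\<lambda>k. c i j k * of_real (norm z + 1) ^ k)"
      using bounded_linear_suminf_mexp(2)[OF bounded_linear_entry[of i j], of "(norm z + 1) *\<^sub>R X"]
      by (simp add: matpow_scaleR c_def, simp add: scaleR_conv_of_real mult_ac)
    show "norm z < norm (of_real (norm z + 1) :: complex)"
      by (simp del: of_real_add)
  qed
  have d: "((\<lambda>z. \<Sum>k. c i j k * z ^ k) has_field_derivative (\<Sum>k. diffs (c i j) k * of_real t ^ k)) (at (of_real t))"
    by (intro termdiffs_strong_converges_everywhere s)
  have "diffs (c i j) k * of_real t ^ k = (\<Sum>l\<in>UNIV. X $ i $ l * (c l j k * of_real t ^ k))" for k
  proof -
    have "diffs (c i j) k = (1 / fact k) *\<^sub>R (matpow X (Suc k) $ i $ j)"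
    proof -
      have "of_nat (Suc k) * (1 / fact (Suc k)) = (1 / fact k :: real)"
        by (simp add: divide_simps del: of_nat_Suc)
      then show ?thesis
        unfolding diffs_def c_def
        by (metis (no_types) of_real_of_nat_eq scaleR_conv_of_real scaleR_scaleR)
    qed
    also have "\<dots> = (\<Sum>l\<in>UNIV. X $ i $ l * c l j k)"
      by (simp add: matrix_matrix_mult_def c_def scaleR_sum_right)
    finally show ?thesis by (simp add: sum_distrib_right sum_distrib_left mult_ac)
  qed
  then have "(\<Sum>k. diffs (c i j) k * of_real t ^ k) = (\<Sum>k. \<Sum>l\<in>UNIV. X $ i $ l * (c l j k * of_real t ^ k))"
    by simp
  also have "\<dots> = (\<Sum>l\<in>UNIV. \<Sum>k. X $ i $ l * (c l j k * of_real t ^ k))"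
    by (rule suminf_sum) (intro summable_mult s)
  also have "\<dots> = (\<Sum>l\<in>UNIV. X $ i $ l * (\<Sum>k. c l j k * of_real t ^ k))"
    by (simp only: suminf_mult[OF s])
  also have "\<dots> = (X ** mexp (t *\<^sub>R X)) $ i $ j"
    by (simp add: matrix_matrix_mult_def e)
  finally have "(\<Sum>k. diffs (c i j) k * of_real t ^ k) = (X ** mexp (t *\<^sub>R X)) $ i $ j" .
  with has_vector_derivative_real_field[OF d]
  show "((\<lambda>t. mexp (t *\<^sub>R X) $ i $ j) has_vector_derivative (X ** mexp (t *\<^sub>R X)) $ i $ j) (at t)"
    by (simp only: e)
qed

lemma mexp_0 [simp]: "mexp 0 = (mat 1 :: 'n::finite cmat)"
proof -
  have "(\<Sum>k. (1 / fact k) *\<^sub>R matpow (0::'n cmat) k) = (\<Sum>k\<in>{0}. (1 / fact k) *\<^sub>R matpow (0::'n cmat) k)"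
    by (rule suminf_finite) (auto simp: cmat_mult_simps gr0_conv_Suc)
  then show ?thesis by (simp add: mexp_def)
qed

lemma mexp_commute: "mexp X ** X = X ** mexp X" for X :: "'n::finite cmat"
proof -
  have 1: "mexp X ** X = (\<Sum>k. ((1 / fact k) *\<^sub>R matpow X k) ** X)"
    by (rule bounded_linear_suminf_mexp) (rule bounded_bilinear.bounded_linear_left[OF bounded_bilinear_matrix_mult])
  have 2: "X ** mexp X = (\<Sum>k. X ** ((1 / fact k) *\<^sub>R matpow X k))"
    by (rule bounded_linear_suminf_mexp) (rule bounded_bilinear.bounded_linear_right[OF bounded_bilinear_matrix_mult])
  show ?thesis unfolding 1 2 by (simp add: cmat_mult_simps matpow_commute)
qed

lemma mexp_commute_scaleR: "mexp (t *\<^sub>R X) ** X = X ** mexp (t *\<^sub>R X)" for X :: "'n::finite cmat"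
proof (cases "t = 0")
  case False
  then show ?thesis using mexp_commute[of "t *\<^sub>R X"] by (simp add: cmat_mult_simps)
qed simp

lemma const_if_vector_derivative_0:
  fixes f :: "real \<Rightarrow> 'a::real_normed_vector"
  assumes "\<And>t. (f has_vector_derivative 0) (at t)"
  shows "f t = f 0"
proof -
  have "\<exists>c. \<forall>x\<in>UNIV. f x = c"
    by (rule has_derivative_zero_constant) (use assms in \<open>auto simp: has_vector_derivative_def\<close>)
  then obtain c where "\<forall>x\<in>UNIV. f x = c" ..
  then show ?thesis by simp
qed

lemma mexp_neg_has_vector_derivative:
  "((\<lambda>t. mexp (- (t *\<^sub>R X))) has_vector_derivative (- (X ** mexp (- (t *\<^sub>R X))))) (at t)" for X :: "'n::finite cmat"
  using mexp_has_vector_derivative[of "-X" t] by (simp add: cmat_mult_simps)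

text \<open>Multiplying a solution by the inverse flow gives a curve with derivative zero. Applied
  to the exponential itself this identifies its inverse; the corollary below evaluates exponentials
  by exhibiting a solution.\<close>

lemma mexp_ode_unique:
  fixes \<gamma> :: "real \<Rightarrow> 'n::finite cmat"
  assumes "\<And>t. (\<gamma> has_vector_derivative X ** \<gamma> t) (at t)"
  shows "mexp (- (t *\<^sub>R X)) ** \<gamma> t = \<gamma> 0"
proof -
  have "((\<lambda>t. mexp (- (t *\<^sub>R X)) ** \<gamma> t) has_vector_derivative 0) (at t)" for t
  proof -
    have "((\<lambda>t. mexp (- (t *\<^sub>R X)) ** \<gamma> t) has_vector_derivative
       (mexp (- (t *\<^sub>R X)) ** (X ** \<gamma> t) + (- (X ** mexp (- (t *\<^sub>R X)))) ** \<gamma> t)) (at t)"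
      by (rule bounded_bilinear.has_vector_derivative[OF bounded_bilinear_matrix_mult
            mexp_neg_has_vector_derivative assms])
    moreover have "mexp (- (t *\<^sub>R X)) ** X = X ** mexp (- (t *\<^sub>R X))"
      using mexp_commute_scaleR[of "-t" X] by simp
    ultimately show ?thesis by (simp add: cmat_mult_simps matrix_mul_assoc)
  qed
  from const_if_vector_derivative_0[OF this] show ?thesis by simp
qed

lemma mexp_minus_mult [simp]: "mexp (- X) ** mexp X = mat 1" for X :: "'n::finite cmat"
  using mexp_ode_unique[OF mexp_has_vector_derivative, of 1 X] by simp

lemma mexp_mult_minus [simp]: "mexp X ** mexp (- X) = mat 1" for X :: "'n::finite cmat"
  using mexp_minus_mult[of "-X"] by simp

text \<open>\<open>matrix_inv\<close> selects some two-sided inverse; for square matrices a right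
  inverse is already two-sided, hence it is the one selected.\<close>

lemma matrix_inv_eqI:
  fixes A B :: "'n::finite cmat"
  assumes "A ** B = mat 1" shows "matrix_inv A = B"
proof -
  have BA: "B ** A = mat 1" using assms matrix_left_right_inverse[of A B] by simp
  then have "\<exists>A'. A ** A' = mat 1 \<and> A' ** A = mat 1" using assms by blast
  then have "A ** matrix_inv A = mat 1" unfolding matrix_inv_def by (rule someI2_ex) simp
  then have "B ** (A ** matrix_inv A) = B" by simp
  then show ?thesis by (simp add: matrix_mul_assoc BA)
qed

lemma matrix_inv_mexp: "matrix_inv (mexp X) = mexp (- X)" for X :: "'n::finite cmat"
  by (rule matrix_inv_eqI) simp

lemma mexp_ode_unique':
  fixes \<gamma> :: "real \<Rightarrow> 'n::finite cmat"
  assumes "\<And>t. (\<gamma> has_vector_derivative X ** \<gamma> t) (at t)"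
  shows "\<gamma> t = mexp (t *\<^sub>R X) ** \<gamma> 0"
proof -
  have "mexp (t *\<^sub>R X) ** (mexp (- (t *\<^sub>R X)) ** \<gamma> t) = mexp (t *\<^sub>R X) ** \<gamma> 0"
    using mexp_ode_unique[OF assms] by simp
  then show ?thesis by (simp add: matrix_mul_assoc)
qed

section \<open>Traces and the Killing form\<close>

text \<open>A Cartan involution is constrained only on the Lie algebra and arbitrary elsewhere, so
  linearity is required on a set.\<close>

definition lin_on :: "'a::real_vector set \<Rightarrow> ('a \<Rightarrow> 'b::real_vector) \<Rightarrow> bool" where
  "lin_on S f \<longleftrightarrow> (\<forall>x\<in>S. \<forall>y\<in>S. \<forall>a b. f (a *\<^sub>R x + b *\<^sub>R y) = a *\<^sub>R f x + b *\<^sub>R f y)"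

text \<open>The values on a basis of \<open>S\<close> determine the extension. The bound on its
  range is what later turns the identity of a subspace into a projection onto it.\<close>

lemma lin_on_extend:
  fixes f :: "'a::euclidean_space \<Rightarrow> 'b::real_vector"
  assumes S: "subspace S" and f: "lin_on S f"
  obtains F where "linear F" "\<forall>x\<in>S. F x = f x" "range F \<subseteq> span (f ` S)"
proof -
  obtain B where B: "B \<subseteq> S" "independent B" "S \<subseteq> span B" by (rule basis_exists[of S])
  obtain F where F: "linear F" "\<forall>x\<in>B. F x = f x" "range F = span (f ` B)"
    using linear_independent_extend_subspace[OF B(2), of f] by (elim exE conjE) (rule that)
  have "x \<in> S \<and> F x = f x" if "x \<in> span B" for x
    using that
  proof (induction rule: span_induct_alt)
    case base
    have "f (0 *\<^sub>R 0 + 0 *\<^sub>R 0) = 0 *\<^sub>R f 0 + 0 *\<^sub>R f 0"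
      using f S subspace_0 unfolding lin_on_def by blast
    then have "f 0 = 0" by simp
    then show ?case using S F(1) by (simp add: subspace_0 linear_0)
  next
    case (step c x y)
    then have "x \<in> S" using B by auto
    moreover have "f (c *\<^sub>R x + 1 *\<^sub>R y) = c *\<^sub>R f x + 1 *\<^sub>R f y"
      using f step \<open>x \<in> S\<close> unfolding lin_on_def by blast
    ultimately show ?case using S F step
      by (simp add: subspace_add subspace_scale linear_add linear_scale)
  qed
  moreover have "span (f ` B) \<subseteq> span (f ` S)" using B(1) by (intro span_mono) auto
  ultimately show ?thesis using that[of F] F B by blast
qed

text \<open>Names the basis hidden in the choice operator of \<open>trace_on\<close>, so that traces
  of different maps are compared in one basis.\<close>

lemma trace_on_eq:
  fixes V :: "'n::finite cmat set"
  assumes "subspace V"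
  obtains B where "B \<subseteq> V" "independent B" "span B = V" "finite B"
    "\<forall>f. trace_on V f = (\<Sum>b\<in>B. representation B (f b) b)"
proof -
  define B where "B = (SOME B. B \<subseteq> V \<and> independent B \<and> span B = V)"
  have "\<exists>B. B \<subseteq> V \<and> independent B \<and> span B = V"
  proof -
    obtain B where "B \<subseteq> V" "independent B" "V \<subseteq> span B" by (rule basis_exists[of V])
    then show ?thesis using span_subspace[OF _ _ assms] by blast
  qed
  then have B: "B \<subseteq> V \<and> independent B \<and> span B = V" unfolding B_def by (rule someI_ex)
  then have "finite B" using independent_imp_finite by blast
  with B show ?thesis by (intro that[of B]) (auto simp: trace_on_def B_def Let_def)
qed

lemma trace_on_cong:
  assumes "subspace V" "\<And>x. x \<in> V \<Longrightarrow> f x = g x"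
  shows "trace_on V f = trace_on V g"
proof -
  obtain B where B: "B \<subseteq> V" "\<forall>f. trace_on V f = (\<Sum>b\<in>B. representation B (f b) b)"
    by (rule trace_on_eq[OF assms(1)])
  then show ?thesis using assms(2) by (auto simp: subset_iff intro!: sum.cong)
qed

lemma trace_on_linear:
  assumes "subspace V" "\<And>x. x \<in> V \<Longrightarrow> f x \<in> V" "\<And>x. x \<in> V \<Longrightarrow> g x \<in> V"
  shows "trace_on V (\<lambda>x. a *\<^sub>R f x + b *\<^sub>R g x) = a * trace_on V f + b * trace_on V g"
proof -
  obtain B where B: "B \<subseteq> V" "independent B" "span B = V" "finite B"
    "\<forall>f. trace_on V f = (\<Sum>b\<in>B. representation B (f b) b)"
    by (rule trace_on_eq[OF assms(1)])
  have "representation B (a *\<^sub>R f x + b *\<^sub>R g x) x = a * representation B (f x) x + b * representation B (g x) x"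
    if "x \<in> B" for x
    using that B(1-3) assms by (subst representation_add) (auto simp: representation_scale subspace_scale subset_iff)
  then show ?thesis by (simp add: B(5) sum.distrib sum_distrib_left)
qed

text \<open>Matrix coefficients in the chosen basis turn both traces into the same double sum.
  Symmetry, invariance and automorphism invariance of the Killing form all rest on this.\<close>

lemma trace_on_comm:
  fixes V :: "'n::finite cmat set"
  assumes V: "subspace V" and f: "lin_on V f" "\<And>x. x \<in> V \<Longrightarrow> f x \<in> V"
    and g: "lin_on V g" "\<And>x. x \<in> V \<Longrightarrow> g x \<in> V"
  shows "trace_on V (\<lambda>x. f (g x)) = trace_on V (\<lambda>x. g (f x))"
proof -
  obtain B where B: "B \<subseteq> V" "independent B" "span B = V" "finite B"
    "\<forall>f. trace_on V f = (\<Sum>b\<in>B. representation B (f b) b)"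
    by (rule trace_on_eq[OF V])
  have main: "representation B (f (g b)) c = (\<Sum>b'\<in>B. representation B (g b) b' * representation B (f b') c)"
    if f: "lin_on V f" "\<And>x. x \<in> V \<Longrightarrow> f x \<in> V" and g: "\<And>x. x \<in> V \<Longrightarrow> g x \<in> V" and b: "b \<in> B" for f g b c
  proof -
    obtain F where F: "linear F" "\<forall>x\<in>V. F x = f x"
      by (rule lin_on_extend[OF V f(1)])
    have gb: "g b \<in> V" using g b B by auto
    have "f (g b) = F (\<Sum>b'\<in>B. representation B (g b) b' *\<^sub>R b')"
      using F gb B by (simp add: sum_representation_eq)
    also have "\<dots> = (\<Sum>b'\<in>B. representation B (g b) b' *\<^sub>R f b')"
      using F B(1) by (simp add: linear_sum linear_scale subset_iff)
    finally have "f (g b) = (\<Sum>b'\<in>B. representation B (g b) b' *\<^sub>R f b')" .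
    moreover have "f b' \<in> span B" if "b' \<in> B" for b' using that B f by auto
    ultimately show ?thesis
      using B(2,3) V by (simp add: representation_sum representation_scale subspace_scale)
  qed
  have "trace_on V (\<lambda>x. f (g x)) = (\<Sum>b\<in>B. \<Sum>b'\<in>B. representation B (g b) b' * representation B (f b') b)"
    using main[of f g, OF f g(2)] by (simp add: B(5))
  also have "\<dots> = (\<Sum>b'\<in>B. \<Sum>b\<in>B. representation B (f b') b * representation B (g b) b')"
    by (subst sum.swap) (simp add: mult.commute)
  also have "\<dots> = trace_on V (\<lambda>x. g (f x))"
    using main[of g f, OF g f(2)] by (simp add: B(5))
  finally show ?thesis .
qed

lemma bra_simps:
  "bra (X + X') Y = bra X Y + bra X' Y" "bra X (Y + Y') = bra X Y + bra X Y'"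
  "bra (a *\<^sub>R X) Y = a *\<^sub>R bra X Y" "bra X (a *\<^sub>R Y) = a *\<^sub>R bra X Y"
  "bra 0 Y = 0" "bra X 0 = 0" "bra (- X) Y = - bra X Y" "bra X (- Y) = - bra X Y"
  "bra (X - X') Y = bra X Y - bra X' Y" "bra X (Y - Y') = bra X Y - bra X Y'"
  by (simp_all add: bra_def cmat_mult_simps algebra_simps)

lemma bra_jacobi: "bra (bra X Y) Z = bra X (bra Y Z) - bra Y (bra X Z)"
  by (simp add: bra_def cmat_mult_simps matrix_mul_assoc algebra_simps)

locale matrix_lie_algebra =
  fixes \<gg> :: "'n::finite cmat set"
  assumes subspace_g: "subspace \<gg>"
    and bra_closed: "X \<in> \<gg> \<Longrightarrow> Y \<in> \<gg> \<Longrightarrow> bra X Y \<in> \<gg>"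
begin

lemma lin_on_bra: "lin_on \<gg> (bra X)" "lin_on \<gg> (\<lambda>Z. bra X (bra Y Z))"
  by (simp_all add: lin_on_def bra_simps)

lemma killing_sym: "X \<in> \<gg> \<Longrightarrow> Y \<in> \<gg> \<Longrightarrow> killing \<gg> X Y = killing \<gg> Y X"
  unfolding killing_def
  by (rule trace_on_comm[OF subspace_g]) (auto simp: bra_closed lin_on_bra)

lemma killing_linear_left:
  assumes "X \<in> \<gg>" "X' \<in> \<gg>" "Y \<in> \<gg>"
  shows "killing \<gg> (a *\<^sub>R X + b *\<^sub>R X') Y = a * killing \<gg> X Y + b * killing \<gg> X' Y"
  unfolding killing_def bra_simps
  by (rule trace_on_linear[OF subspace_g]) (use assms in \<open>auto simp: bra_closed\<close>)

lemma killing_linear_right: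
  assumes "X \<in> \<gg>" "Y \<in> \<gg>" "Y' \<in> \<gg>"
  shows "killing \<gg> X (a *\<^sub>R Y + b *\<^sub>R Y') = a * killing \<gg> X Y + b * killing \<gg> X Y'"
  unfolding killing_def bra_simps
  by (rule trace_on_linear[OF subspace_g]) (use assms in \<open>auto simp: bra_closed\<close>)

text \<open>By the Jacobi identity the adjoint maps of \<open>bra Z X\<close> and
  \<open>bra Z Y\<close> are commutators. Of the four resulting traces two agree literally and two
  by cyclicity.\<close>

lemma killing_invariant:
  assumes "X \<in> \<gg>" "Y \<in> \<gg>" "Z \<in> \<gg>"
  shows "killing \<gg> (bra Z X) Y = - killing \<gg> X (bra Z Y)"
proof -
  note c = assms bra_closed
  have 1: "killing \<gg> (bra Z X) Y = trace_on \<gg> (\<lambda>W. 1 *\<^sub>R bra Z (bra X (bra Y W)) + (-1) *\<^sub>R bra X (bra Z (bra Y W)))"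
    unfolding killing_def by (simp add: bra_jacobi)
  have 2: "killing \<gg> X (bra Z Y) = trace_on \<gg> (\<lambda>W. 1 *\<^sub>R bra X (bra Z (bra Y W)) + (-1) *\<^sub>R bra X (bra Y (bra Z W)))"
    unfolding killing_def by (simp add: bra_jacobi bra_simps)
  have 3: "trace_on \<gg> (\<lambda>W. bra Z (bra X (bra Y W))) = trace_on \<gg> (\<lambda>W. bra X (bra Y (bra Z W)))"
    by (rule trace_on_comm[OF subspace_g]) (auto simp: c lin_on_bra)
  show ?thesis
    unfolding 1 2 by (subst (1 2) trace_on_linear[OF subspace_g]) (auto simp: c 3)
qed

text \<open>Since \<open>\<phi>\<close> is its own inverse, the left side is the trace of a
  conjugate by \<open>\<phi>\<close>. This serves both for the Cartan involution and for conjugation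
  by a geodesic symmetry.\<close>

lemma killing_automorphism:
  assumes \<phi>: "lin_on \<gg> \<phi>" "\<And>X. X \<in> \<gg> \<Longrightarrow> \<phi> X \<in> \<gg>" "\<And>X. X \<in> \<gg> \<Longrightarrow> \<phi> (\<phi> X) = X"
    "\<And>X Y. X \<in> \<gg> \<Longrightarrow> Y \<in> \<gg> \<Longrightarrow> \<phi> (bra X Y) = bra (\<phi> X) (\<phi> Y)"
    and XY: "X \<in> \<gg>" "Y \<in> \<gg>"
  shows "killing \<gg> (\<phi> X) (\<phi> Y) = killing \<gg> X Y"
proof -
  have "killing \<gg> (\<phi> X) (\<phi> Y) = trace_on \<gg> (\<lambda>W. \<phi> (bra X (bra Y (\<phi> W))))"
    unfolding killing_def
    by (rule trace_on_cong[OF subspace_g]) (use \<phi> XY bra_closed in auto)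
  also have "\<dots> = trace_on \<gg> (\<lambda>W. bra X (bra Y (\<phi> (\<phi> W))))"
  proof (rule trace_on_comm[OF subspace_g \<phi>(1,2)])
    show "lin_on \<gg> (\<lambda>W. bra X (bra Y (\<phi> W)))"
      using \<phi>(1) by (simp add: lin_on_def bra_simps)
  qed (use \<phi> XY bra_closed in auto)
  also have "\<dots> = killing \<gg> X Y"
    unfolding killing_def by (rule trace_on_cong[OF subspace_g]) (use \<phi> in auto)
  finally show ?thesis .
qed

text \<open>A central element lies in the radical of the Killing form; definiteness will then force
  it to vanish.\<close>

lemma killing_0: "(\<And>Y. Y \<in> \<gg> \<Longrightarrow> bra X Y = 0) \<Longrightarrow> Z \<in> \<gg> \<Longrightarrow> killing \<gg> X Z = 0"
proof -
  assume a: "\<And>Y. Y \<in> \<gg> \<Longrightarrow> bra X Y = 0" "Z \<in> \<gg>"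
  have "killing \<gg> X Z = trace_on \<gg> (\<lambda>W. 0 *\<^sub>R W + 0 *\<^sub>R W)"
    unfolding killing_def by (rule trace_on_cong[OF subspace_g]) (use a bra_closed in auto)
  also have "\<dots> = 0" by (subst trace_on_linear[OF subspace_g]) auto
  finally show ?thesis .
qed

end

text \<open>Compactness of the unit sphere of \<open>S\<close>. Together with the upper bound it
  compares a form with the norm, so that maps preserving the form are uniformly bounded in
  norm.\<close>

lemma bilinear_form_lower_bound:
  fixes T :: "'a::euclidean_space \<Rightarrow> 'a \<Rightarrow> real"
  assumes T: "bounded_bilinear T" and S: "subspace S" and pos: "\<And>x. x \<in> S \<Longrightarrow> x \<noteq> 0 \<Longrightarrow> T x x > 0"
  obtains c where "c > 0" "\<And>x. x \<in> S \<Longrightarrow> c * (norm x)\<^sup>2 \<le> T x x"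
proof (cases "S \<subseteq> {0}")
  case True
  then have "x \<in> S \<Longrightarrow> x = 0" for x by auto
  then show ?thesis
    using that[of 1] bounded_bilinear.zero_left[OF T] by fastforce
next
  case False
  then obtain y where y: "y \<in> S" "y \<noteq> 0" by blast
  let ?K = "S \<inter> sphere 0 1"
  have "compact ?K" using closed_subspace[OF S] by (simp add: closed_Int_compact)
  moreover have "y /\<^sub>R norm y \<in> ?K" using y S by (simp add: subspace_scale)
  moreover have "continuous_on ?K (\<lambda>x. T x x)"
    by (intro bounded_bilinear.continuous_on[OF T] continuous_intros)
  ultimately obtain m where m: "m \<in> ?K" "\<And>x. x \<in> ?K \<Longrightarrow> T m m \<le> T x x"
    using continuous_attains_inf[of ?K "\<lambda>x. T x x"] by blast
  have "T m m > 0" using m(1) pos[of m] by force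
  moreover have "T m m * (norm x)\<^sup>2 \<le> T x x" if x: "x \<in> S" for x
  proof (cases "x = 0")
    case False
    then have "x /\<^sub>R norm x \<in> ?K" using x S by (simp add: subspace_scale)
    then have "T m m \<le> T (x /\<^sub>R norm x) (x /\<^sub>R norm x)" by (rule m)
    also have "\<dots> = T x x / (norm x)\<^sup>2"
      by (simp add: bounded_bilinear.scaleR_left[OF T] bounded_bilinear.scaleR_right[OF T]
          power2_eq_square divide_simps)
    finally show ?thesis using False by (simp add: field_simps)
  qed (simp add: bounded_bilinear.zero_left[OF T])
  ultimately show ?thesis using that by blast
qed

lemma bilinear_form_upper_bound:
  fixes T :: "'a::real_normed_vector \<Rightarrow> 'a \<Rightarrow> real"
  assumes T: "bounded_bilinear T"
  obtains C where "C > 0" "\<And>x. T x x \<le> C * (norm x)\<^sup>2"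
proof -
  obtain K where "K > 0" and K: "\<forall>a b. norm (T a b) \<le> norm a * norm b * K"
    using bounded_bilinear.pos_bounded[OF T] by blast
  moreover have "T x x \<le> K * (norm x)\<^sup>2" for x
    using K[rule_format, of x x] by (simp add: power2_eq_square mult.commute abs_le_iff)
  ultimately show ?thesis using that by blast
qed

section \<open>Lorentzian vector spaces\<close>

text \<open>\<open>V\<close> is a subspace so that Hermitian matrices inside all complex matrices
  fit. \<open>b0\<close> will be the timelike unit vector, and as \<open>dim V\<close> is n + 1, the
  dimension bound says \<open>n \<ge> 2\<close>.\<close>

locale lorentz_space =
  fixes V :: "'v::euclidean_space set" and b0 :: 'v
  assumes subspace_V: "subspace V"
    and b0: "b0 \<in> V" "norm b0 = 1"
    and dim_V: "3 \<le> dim V"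
begin

text \<open>The Euclidean product with its sign reversed along \<open>b0\<close>: a Lorentz form for
  which the ambient norm and its compactness arguments stay at hand.\<close>

definition q :: "'v \<Rightarrow> 'v \<Rightarrow> real" where
  "q x y = x \<bullet> y - 2 * (x \<bullet> b0) * (y \<bullet> b0)"

lemma b0_b0 [simp]: "b0 \<bullet> b0 = 1"
  using b0(2) by (simp add: norm_eq_1)

lemma q_simps:
  "q (x + y) z = q x z + q y z" "q z (x + y) = q z x + q z y"
  "q (x - y) z = q x z - q y z" "q z (x - y) = q z x - q z y"
  "q (a *\<^sub>R x) z = a * q x z" "q z (a *\<^sub>R x) = a * q z x"
  "q (- x) z = - q x z" "q z (- x) = - q z x" "q 0 z = 0" "q z 0 = 0"
  by (simp_all add: q_def inner_simps algebra_simps)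

lemma q_sym: "q x y = q y x"
  by (simp add: q_def inner_commute)

lemma bounded_bilinear_q: "bounded_bilinear q"
proof -
  have "bilinear q" unfolding bilinear_def linear_iff by (simp add: q_simps)
  then show ?thesis using bilinear_conv_bounded_bilinear by blast
qed

lemma q_split: "q x y = (x - (x \<bullet> b0) *\<^sub>R b0) \<bullet> (y - (y \<bullet> b0) *\<^sub>R b0) - (x \<bullet> b0) * (y \<bullet> b0)"
  by (simp add: q_def inner_simps algebra_simps inner_commute[of b0 y])

definition H :: "'v set" where
  "H = {x \<in> V. q x x = -1 \<and> x \<bullet> b0 > 0}"

lemma b0_H: "b0 \<in> H"
  using b0 by (simp add: H_def q_def)

text \<open>Cauchy-Schwarz for the spatial parts: that of a timelike \<open>z\<close> is strictly
  shorter than its time part, so it cannot be orthogonal to a nonzero \<open>x\<close> with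
  \<open>q x x \<le> 0\<close>.\<close>

lemma q_pos_orthogonal:
  assumes t: "q z z < 0" and o: "q x z = 0" and x: "x \<noteq> 0"
  shows "q x x > 0"
proof (rule ccontr)
  define a h x' z' where "a = x \<bullet> b0" "h = z \<bullet> b0" "x' = x - a *\<^sub>R b0" "z' = z - h *\<^sub>R b0"
  assume "\<not> 0 < q x x"
  then have 1: "(norm x')\<^sup>2 \<le> a\<^sup>2"
    unfolding q_split[of x x] a_h_x'_z'_def[symmetric] by (simp add: dot_square_norm flip: power2_eq_square)
  have 2: "(norm z')\<^sup>2 < h\<^sup>2" using t
    unfolding q_split[of z z] a_h_x'_z'_def[symmetric] by (simp add: dot_square_norm flip: power2_eq_square)
  have 3: "x' \<bullet> z' = a * h" using o
    unfolding q_split[of x z] a_h_x'_z'_def[symmetric] by simp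
  have 4: "norm x' \<le> \<bar>a\<bar>" using 1 by (simp add: abs_le_square_iff[symmetric])
  have 5: "norm z' < \<bar>h\<bar>" by (rule power2_less_imp_less) (use 2 in auto)
  have 6: "\<bar>a\<bar> * \<bar>h\<bar> \<le> norm x' * norm z'" using Cauchy_Schwarz_ineq2[of x' z'] 3 by (simp add: abs_mult)
  show False
  proof (cases "a = 0")
    case True
    then have "x' = 0" using 4 by simp
    then show False using x True a_h_x'_z'_def by simp
  next
    case False
    have "norm x' * norm z' \<le> \<bar>a\<bar> * norm z'" by (intro mult_right_mono 4) simp
    also have "\<dots> < \<bar>a\<bar> * \<bar>h\<bar>" using False 5 by simp
    finally show False using 6 by simp
  qed
qed

lemma q_H_neg:
  assumes "p \<in> H" "z \<in> H" shows "q p z < 0"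
proof -
  define a h x' z' where "a = p \<bullet> b0" "h = z \<bullet> b0" "x' = p - a *\<^sub>R b0" "z' = z - h *\<^sub>R b0"
  have ah: "a > 0" "h > 0" using assms by (auto simp: H_def a_h_x'_z'_def)
  have "q p p = -1" "q z z = -1" using assms by (auto simp: H_def)
  then have 1: "(norm x')\<^sup>2 < a\<^sup>2" "(norm z')\<^sup>2 < h\<^sup>2"
    unfolding q_split[of p p] q_split[of z z] a_h_x'_z'_def[symmetric]
    by (simp_all add: dot_square_norm flip: power2_eq_square)
  then have "norm x' < a" "norm z' < h" using ah by (auto intro: power2_less_imp_less)
  then have "norm x' * norm z' < a * h" using ah by (intro mult_strict_mono) auto
  then have "x' \<bullet> z' < a * h" using norm_cauchy_schwarz[of x' z'] by linarith
  then show ?thesis unfolding q_split[of p z] a_h_x'_z'_def[symmetric] by simp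
qed

lemma q_H_le:
  assumes "p \<in> H" "z \<in> H" shows "q p z \<le> -1" "q p z = -1 \<Longrightarrow> p = z"
proof -
  \<comment> \<open>The part of \<open>p\<close> orthogonal to \<open>z\<close>; being spacelike or
    zero, it yields the reversed Cauchy-Schwarz inequality.\<close>
  define x where "x = p + q p z *\<^sub>R z"
  have zz: "q z z = -1" "q p p = -1" using assms by (auto simp: H_def)
  have "q x z = 0" by (simp add: x_def q_simps zz)
  moreover have e: "q x x = (q p z)\<^sup>2 - 1"
    by (simp add: x_def q_simps zz q_sym[of z p] power2_eq_square algebra_simps)
  ultimately have "x \<noteq> 0 \<Longrightarrow> (q p z)\<^sup>2 > 1" using q_pos_orthogonal[of z x] zz by simp
  moreover have "x = 0 \<Longrightarrow> (q p z)\<^sup>2 = 1" using e by (simp add: q_simps)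
  ultimately have "1 \<le> (q p z)\<^sup>2" by linarith
  then have "1 \<le> \<bar>q p z\<bar>" using abs_le_square_iff[of 1 "q p z"] by simp
  then show "q p z \<le> -1" using q_H_neg[OF assms] by linarith
  show "p = z" if "q p z = -1"
  proof -
    have "x = 0" using \<open>x \<noteq> 0 \<Longrightarrow> (q p z)\<^sup>2 > 1\<close> that by auto
    then show ?thesis using that by (simp add: x_def)
  qed
qed

text \<open>A timelike vector points to one of two sheets; a negative product with a forward point
  \<open>z\<close> excludes the backward one.\<close>

lemma H_normalize:
  assumes "x \<in> V" "q x x < 0" "z \<in> H" "q x z < 0"
  shows "(1 / sqrt (- q x x)) *\<^sub>R x \<in> H"
proof -
  define y where "y = (1 / sqrt (- q x x)) *\<^sub>R x"
  have s: "sqrt (- q x x) > 0" using assms by simp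
  have yV: "y \<in> V" using assms subspace_V by (simp add: y_def subspace_scale)
  have yy: "q y y = -1" using assms s by (simp add: y_def q_simps field_simps)
  have yz: "q y z < 0" using assms s by (simp add: y_def q_simps divide_neg_pos)
  have "y \<bullet> b0 > 0"
  proof (rule ccontr)
    assume n: "\<not> y \<bullet> b0 > 0"
    show False
    proof (cases "y \<bullet> b0 = 0")
      case True
      then show False using yy inner_ge_zero[of y] by (simp add: q_def)
    next
      case False
      then have "- y \<in> H" using n yV yy subspace_V by (simp add: H_def q_simps subspace_neg)
      then show False using q_H_neg[of "-y" z] assms yz by (simp add: q_simps)
    qed
  qed
  then show ?thesis using yV yy by (simp add: H_def y_def)
qed

lemma exists_q_orthogonal:
  assumes F: "subspace F" "F \<subseteq> V" "F \<noteq> V" and z: "z \<in> F" "q z z < 0"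
  obtains x where "x \<in> V" "q x x = 1" "\<forall>y\<in>F. q x y = 0"
proof -
  have "span F \<subset> span V" using F subspace_V by (metis span_eq_iff psubsetI)
  then obtain w where w: "w \<noteq> 0" "w \<in> span V" "\<And>y. y \<in> span F \<Longrightarrow> orthogonal w y"
    using orthogonal_to_subspace_exists_gen by blast
  have wV: "w \<in> V" using w subspace_V by (metis span_eq_iff)
  \<comment> \<open>Reversing the \<open>b0\<close> component turns Euclidean orthogonality to
    \<open>F\<close> into \<open>q\<close>-orthogonality.\<close>
  define x where "x = w - (2 * (w \<bullet> b0)) *\<^sub>R b0"
  have "w = x - (2 * (x \<bullet> b0)) *\<^sub>R b0" by (simp add: x_def inner_simps algebra_simps)
  then have "x \<noteq> 0" using w(1) by auto
  have xV: "x \<in> V" using wV b0 subspace_V by (simp add: x_def subspace_diff subspace_scale)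
  have ortho: "q x y = 0" if "y \<in> F" for y
  proof -
    have "q x y = w \<bullet> y" by (simp add: q_def x_def inner_simps algebra_simps inner_commute)
    then show ?thesis using w(3)[of y] that by (simp add: orthogonal_def span_base)
  qed
  have xx: "q x x > 0" using q_pos_orthogonal[of z x] z ortho \<open>x \<noteq> 0\<close> by simp
  show ?thesis
  proof (rule that[of "(1 / sqrt (q x x)) *\<^sub>R x"])
    show "(1 / sqrt (q x x)) *\<^sub>R x \<in> V" using xV subspace_V by (simp add: subspace_scale)
    show "q ((1 / sqrt (q x x)) *\<^sub>R x) ((1 / sqrt (q x x)) *\<^sub>R x) = 1" using xx by (simp add: q_simps)
    show "\<forall>y\<in>F. q ((1 / sqrt (q x x)) *\<^sub>R x) y = 0" using ortho by (simp add: q_simps)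
  qed
qed

text \<open>Two vectors cannot span \<open>V\<close> because \<open>dim V \<ge> 3\<close>.\<close>

lemma exists_q_orthogonal2:
  assumes "z \<in> V" "y \<in> V" "q z z < 0"
  obtains x where "x \<in> V" "q x x = 1" "q x z = 0" "q x y = 0"
proof -
  have "dim (span {z, y}) \<le> card {z, y}" by (simp add: dim_le_card')
  also have "\<dots> \<le> 2" by (simp add: card_insert_if)
  finally have "span {z, y} \<noteq> V" using dim_V by auto
  moreover have "span {z, y} \<subseteq> V" using assms subspace_V by (simp add: span_minimal)
  ultimately obtain x where "x \<in> V" "q x x = 1" "\<forall>w\<in>span {z, y}. q x w = 0"
    using exists_q_orthogonal[of "span {z, y}" z] assms by (metis insertI1 span_base subspace_span)
  then show ?thesis using that[of x] by (simp add: span_base)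
qed

text \<open>Minus the form, restricted to the compact convex hull of the orbit, attains its maximum at
  exactly one point; this replaces averaging over the group.\<close>

lemma H_fixed_point:
  assumes R: "\<And>r. r \<in> R \<Longrightarrow> linear r" "\<And>r x. r \<in> R \<Longrightarrow> x \<in> V \<Longrightarrow> q (r x) (r x) = q x x"
    and Orb: "Orb \<subseteq> H" "Orb \<noteq> {}" "bounded Orb" "\<And>r. r \<in> R \<Longrightarrow> r ` Orb \<subseteq> Orb"
  obtains z where "z \<in> H" "\<forall>r\<in>R. r z = z"
proof -
  define C where "C = closure (convex hull Orb)"
  have cC: "convex C" unfolding C_def by (intro convex_closure convex_convex_hull)
  have compC: "compact C" unfolding C_def using Orb(3) by (simp add: bounded_convex_hull)
  have OC: "Orb \<subseteq> C" unfolding C_def by (rule order_trans[OF hull_subset closure_subset])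
  have Cmin: "C \<subseteq> S" if "closed S" "convex S" "Orb \<subseteq> S" for S
    unfolding C_def using that by (intro closure_minimal hull_minimal)
  have CV: "C \<subseteq> V"
    by (rule Cmin) (use Orb(1) subspace_V in \<open>auto simp: H_def closed_subspace subspace_imp_convex\<close>)
  have half: "closed {y. q x y \<le> -1}" "convex {y. q x y \<le> -1}" for x
  proof -
    have "continuous_on UNIV (q x)"
      by (intro linear_continuous_on bounded_bilinear.bounded_linear_right[OF bounded_bilinear_q])
    then show "closed {y. q x y \<le> -1}" by (intro closed_Collect_le) auto
    show "convex {y. q x y \<le> -1}"
    proof (rule convexI)
      fix y y' and u v :: real
      assume a: "y \<in> {y. q x y \<le> -1}" "y' \<in> {y. q x y \<le> -1}" "0 \<le> u" "0 \<le> v" "u + v = 1"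
      then have "u * q x y + v * q x y' \<le> u * (-1) + v * (-1)"
        by (intro add_mono mult_left_mono) auto
      then show "u *\<^sub>R y + v *\<^sub>R y' \<in> {y. q x y \<le> -1}" using a(5) by (simp add: q_simps)
    qed
  qed
  have 1: "q x y \<le> -1" if "x \<in> Orb" "y \<in> C" for x y
  proof -
    have "C \<subseteq> {y. q x y \<le> -1}"
      by (rule Cmin) (use half Orb(1) that in \<open>auto intro!: q_H_le(1)\<close>)
    then show ?thesis using that by auto
  qed
  have 2: "q x y \<le> -1" if "x \<in> C" "y \<in> C" for x y
  proof -
    have "C \<subseteq> {y. q x y \<le> -1}"
    proof (rule Cmin[OF half])
      show "Orb \<subseteq> {y. q x y \<le> -1}" using 1[of _ x] that(1) q_sym[of _ x] by auto
    qed
    then show ?thesis using that by auto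
  qed
  have "continuous_on C (\<lambda>x. q x x)"
    by (intro bounded_bilinear.continuous_on[OF bounded_bilinear_q] continuous_intros)
  then obtain m where m: "m \<in> C" "\<And>x. x \<in> C \<Longrightarrow> q m m \<le> q x x"
    using continuous_attains_inf[of C "\<lambda>x. q x x"] compC OC Orb(2) by blast
  \<comment> \<open>For a second minimizer \<open>y\<close>, the difference \<open>y - m\<close> is
    orthogonal to the timelike \<open>y + m\<close>, hence spacelike; this pushes the value at the
    midpoint below the minimum.\<close>
  have uniq: "y = m" if y: "y \<in> C" "q y y = q m m" for y
  proof (rule ccontr)
    assume "y \<noteq> m"
    have "q (y - m) (y + m) = 0" using y by (simp add: q_simps q_sym[of m y])
    moreover have "q (y + m) (y + m) < 0"
      using 2[of y m] 2[of m y] 2[of y y] 2[of m m] y m by (simp add: q_simps)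
    ultimately have "q (y - m) (y - m) > 0" using q_pos_orthogonal \<open>y \<noteq> m\<close> by auto
    moreover have "(1/2) *\<^sub>R y + (1/2) *\<^sub>R m \<in> C" using cC y m by (simp add: convex_def)
    then have "q m m \<le> q ((1/2) *\<^sub>R y + (1/2) *\<^sub>R m) ((1/2) *\<^sub>R y + (1/2) *\<^sub>R m)" by (rule m)
    then have "q y m \<ge> q m m" using y by (simp add: q_simps q_sym[of m y] field_simps)
    ultimately show False using y by (simp add: q_simps q_sym[of m y])
  qed
  have fix': "r m = m" if r: "r \<in> R" for r
  proof -
    have "r ` C \<subseteq> closure (r ` (convex hull Orb))"
      unfolding C_def using R(1)[OF r]
      by (intro image_closure_subset linear_continuous_on)
        (auto simp: linear_conv_bounded_linear[symmetric] closure_subset)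
    also have "r ` (convex hull Orb) = convex hull (r ` Orb)"
      using convex_hull_linear_image[OF R(1)[OF r]] by simp
    also have "closure \<dots> \<subseteq> C" unfolding C_def using Orb(4)[OF r] by (intro closure_mono hull_mono)
    finally have "r m \<in> C" using m(1) by auto
    then show ?thesis using uniq[of "r m"] R(2)[OF r, of m] m(1) CV by auto
  qed
  obtain z0 where z0: "z0 \<in> Orb" using Orb(2) by auto
  have mm: "q m m < 0" using 2[of m m] m by simp
  have "(1 / sqrt (- q m m)) *\<^sub>R m \<in> H"
    by (rule H_normalize[of m z0]) (use m CV mm z0 Orb(1) 1[of z0 m] q_sym[of m z0] in auto)
  moreover have "r ((1 / sqrt (- q m m)) *\<^sub>R m) = (1 / sqrt (- q m m)) *\<^sub>R m" if "r \<in> R" for r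
    using R(1)[OF that] fix'[OF that] by (simp add: linear_scale)
  ultimately show ?thesis using that by blast
qed

end

section \<open>Sliding a triangle along two lines\<close>

text \<open>An abstract volume form. As a variable it allows the orientation of a frame to be
  tracked before a model of \<open>V\<close> is fixed.\<close>

definition alt3 :: "('v::real_vector \<Rightarrow> 'v \<Rightarrow> 'v \<Rightarrow> real) \<Rightarrow> bool" where
  "alt3 \<omega> \<longleftrightarrow> (\<forall>x y. linear (\<omega> x y)) \<and> (\<forall>x z. linear (\<lambda>y. \<omega> x y z)) \<and> (\<forall>y z. linear (\<lambda>x. \<omega> x y z)) \<and>
     (\<forall>x y. \<omega> x x y = 0 \<and> \<omega> x y x = 0 \<and> \<omega> y x x = 0)"

lemma alt3_simps:
  assumes "alt3 \<omega>"
  shows "\<omega> x x y = 0" "\<omega> x y x = 0" "\<omega> y x x = 0"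
    "\<omega> (x + x') y z = \<omega> x y z + \<omega> x' y z" "\<omega> x (y + y') z = \<omega> x y z + \<omega> x y' z"
    "\<omega> x y (z + z') = \<omega> x y z + \<omega> x y z'"
    "\<omega> (x - x') y z = \<omega> x y z - \<omega> x' y z" "\<omega> x (y - y') z = \<omega> x y z - \<omega> x y' z"
    "\<omega> x y (z - z') = \<omega> x y z - \<omega> x y z'"
    "\<omega> (a *\<^sub>R x) y z = a * \<omega> x y z" "\<omega> x (a *\<^sub>R y) z = a * \<omega> x y z" "\<omega> x y (a *\<^sub>R z) = a * \<omega> x y z"
    "\<omega> (- x) y z = - \<omega> x y z" "\<omega> x (- y) z = - \<omega> x y z" "\<omega> x y (- z) = - \<omega> x y z"
proof -
  have l: "linear (\<omega> x y)" "linear (\<lambda>y. \<omega> x y z)" "linear (\<lambda>x. \<omega> x y z)" for x y z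
    using assms by (auto simp: alt3_def)
  show "\<omega> x x y = 0" "\<omega> x y x = 0" "\<omega> y x x = 0" using assms by (auto simp: alt3_def)
  show "\<omega> (x + x') y z = \<omega> x y z + \<omega> x' y z" "\<omega> x (y + y') z = \<omega> x y z + \<omega> x y' z"
    "\<omega> x y (z + z') = \<omega> x y z + \<omega> x y z'"
    using linear_add[OF l(1)] linear_add[OF l(2)] linear_add[OF l(3)] by auto
  show "\<omega> (x - x') y z = \<omega> x y z - \<omega> x' y z" "\<omega> x (y - y') z = \<omega> x y z - \<omega> x y' z"
    "\<omega> x y (z - z') = \<omega> x y z - \<omega> x y z'"
    using linear_diff[OF l(1)] linear_diff[OF l(2)] linear_diff[OF l(3)] by auto
  show "\<omega> (a *\<^sub>R x) y z = a * \<omega> x y z" "\<omega> x (a *\<^sub>R y) z = a * \<omega> x y z" "\<omega> x y (a *\<^sub>R z) = a * \<omega> x y z"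
    using linear_scale[OF l(1)] linear_scale[OF l(2)] linear_scale[OF l(3)] by auto
  show "\<omega> (- x) y z = - \<omega> x y z" "\<omega> x (- y) z = - \<omega> x y z" "\<omega> x y (- z) = - \<omega> x y z"
    using linear_neg[OF l(1)] linear_neg[OF l(2)] linear_neg[OF l(3)] by auto
qed

lemma alt3_skew: "alt3 \<omega> \<Longrightarrow> \<omega> x z y = - \<omega> x y z"
proof -
  assume a: "alt3 \<omega>"
  have "\<omega> x (y + z) (y + z) = \<omega> x y y + \<omega> x z y + (\<omega> x y z + \<omega> x z z)"
    by (simp only: alt3_simps(5)[OF a] alt3_simps(6)[OF a])
  then show ?thesis by (simp add: alt3_simps(3)[OF a])
qed

context lorentz_space
begin

text \<open>One Gram-Schmidt step. Admitting \<open>y = 0\<close> makes it serve for the first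
  spatial vector as well as for the second.\<close>

lemma extend_frame:
  assumes "z \<in> H" "y \<in> V" "q y z = 0" "w \<in> V" "y = 0 \<or> q y y = 1"
  obtains e h where "e \<in> V" "q e e = 1" "q e z = 0" "q e y = 0" "w = (- q w z) *\<^sub>R z + q w y *\<^sub>R y + h *\<^sub>R e" "h \<ge> 0"
proof -
  have zz: "q z z = -1" "z \<in> V" using assms by (auto simp: H_def)
  define v where "v = w + q w z *\<^sub>R z - q w y *\<^sub>R y"
  have vz: "q v z = 0" by (simp add: v_def q_simps zz assms q_sym[of y z] )
  have vy: "q v y = 0" using assms(3,5) by (auto simp: v_def q_simps q_sym[of z y])
  have vV: "v \<in> V" using assms zz subspace_V by (simp add: v_def subspace_add subspace_diff subspace_scale)
  show ?thesis
  proof (cases "v = 0")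
    \<comment> \<open>Here \<open>w\<close> already lies in the span, and any unit vector orthogonal
      to \<open>z\<close> and \<open>y\<close> does with \<open>h = 0\<close>.\<close>
    case True
    obtain e where "e \<in> V" "q e e = 1" "q e z = 0" "q e y = 0"
      by (rule exists_q_orthogonal2[of z y]) (use zz assms in auto)
    then show ?thesis using True by (intro that[of e 0]) (auto simp: v_def algebra_simps)
  next
    case False
    then have vv: "q v v > 0" using q_pos_orthogonal[of z v] vz zz by simp
    show ?thesis
    proof (rule that[of "(1 / sqrt (q v v)) *\<^sub>R v" "sqrt (q v v)"])
      show "w = (- q w z) *\<^sub>R z + q w y *\<^sub>R y + sqrt (q v v) *\<^sub>R (1 / sqrt (q v v)) *\<^sub>R v"
        using vv by (simp add: v_def)
    qed (use vv vz vy vV subspace_V in \<open>auto simp: q_simps subspace_scale\<close>)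
  qed
qed

text \<open>A line in the plane spanned by the \<open>z\<close>s is described by its unit normal. Here \<open>n1\<close>, \<open>n2\<close> are
  normals of lines through \<open>z1\<close>, \<open>z2\<close> enclosing the prescribed angle, \<open>p\<close> is their point of
  intersection, and the normal \<open>x n1 + y n2\<close> of the third line is orthogonal to \<open>z3\<close>. The sign
  \<open>\<sigma>\<close> selects the orientation of the frame \<open>(p, n1, n2)\<close>.\<close>

definition normals where
  "normals z1 z2 z3 c x y e f \<sigma> \<longleftrightarrow> (\<exists>n1 n2 p \<kappa>. n1 \<in> V \<and> n2 \<in> V \<and> p \<in> H \<and> q n1 n1 = 1 \<and> q n2 n2 = 1 \<and> q n1 n2 = c \<and>
       q p n1 = 0 \<and> q p n2 = 0 \<and> {z1, z2, z3} \<subseteq> span {p, n1, n2} \<and> q z1 n1 = 0 \<and> q z2 n2 = 0 \<and>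
       q z3 (x *\<^sub>R n1 + y *\<^sub>R n2) = 0 \<and> \<kappa> > 0 \<and> (\<forall>\<omega>. alt3 \<omega> \<longrightarrow> \<omega> p n1 n2 = \<kappa> * \<sigma> * \<omega> z1 e f))"

text \<open>Besides the sign change, the orientation of the frame must be controlled. It is the sign
  of \<open>\<Delta>\<close>, which never vanishes because \<open>c\<^sup>2 < 1\<close>; so the root
  selected by \<open>\<sigma>\<close> fixes the orientation along the whole slide.\<close>

lemma rotating_normals:
  assumes z: "z1 \<in> H" "z2 \<in> H" "z3 \<in> H" and c: "c\<^sup>2 < 1"
  obtains e f where "e \<in> V" "f \<in> V" "q e e = 1" "q f f = 1" "q z1 e = 0" "q z1 f = 0" "q e f = 0"
    "\<And>\<sigma>. \<sigma> = 1 \<or> \<sigma> = -1 \<Longrightarrow> normals z1 z2 z3 c x y e f \<sigma>"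
proof -
  have zz: "q z1 z1 = -1" "z1 \<in> V" "q z2 z2 = -1" "z2 \<in> V" "z3 \<in> V" using z by (auto simp: H_def)
  \<comment> \<open>\<open>ch\<close> and \<open>sh\<close> are the hyperbolic cosine and sine of
    the distance from \<open>z1\<close> to \<open>z2\<close>; \<open>e\<close> will be a unit
    direction of that side at \<open>z1\<close>.\<close>
  define ch where "ch = - q z2 z1"
  have ch: "ch \<ge> 1" using q_H_le(1)[OF z(2,1)] by (simp add: ch_def)
  have p0: "0 \<in> V" "q 0 z1 = 0" "(0::'v) = 0 \<or> q 0 0 = 1"
    using subspace_0[OF subspace_V] by (simp_all add: q_simps)
  obtain e sh where e': "e \<in> V" "q e e = 1" "q e z1 = 0" "q e 0 = 0"
    "z2 = (- q z2 z1) *\<^sub>R z1 + q z2 0 *\<^sub>R 0 + sh *\<^sub>R e" "0 \<le> sh"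
    by (rule extend_frame[OF z(1) p0(1,2) zz(4) p0(3)])
  have e: "e \<in> V" "q e e = 1" "q e z1 = 0" "z2 = ch *\<^sub>R z1 + sh *\<^sub>R e"
    using e' by (auto simp: ch_def)
  have sh: "ch\<^sup>2 - sh\<^sup>2 = 1"
    using zz(3) e(2) e(3) q_sym[of z1 e] unfolding e(4) by (simp add: q_simps zz power2_eq_square algebra_simps)
  \<comment> \<open>\<open>f\<close> completes the frame of a three-dimensional space containing the
    triangle, in which \<open>z3\<close> has coordinates \<alpha>, \<beta>, \<gamma>.\<close>
  obtain f \<gamma> where f: "f \<in> V" "q f f = 1" "q f z1 = 0" "q f e = 0"
    and z3: "z3 = (- q z3 z1) *\<^sub>R z1 + q z3 e *\<^sub>R e + \<gamma> *\<^sub>R f" and "0 \<le> \<gamma>"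
    by (rule extend_frame[OF z(1) e(1,3) zz(5) disjI2[OF e(2)]])
  define \<alpha> \<beta> where "\<alpha> = - q z3 z1" and "\<beta> = q z3 e"
  note fr = e(2,3) f(2-4) zz(1) q_sym[of z1 e, unfolded e(3)] q_sym[of z1 f, unfolded f(3)] q_sym[of e f, unfolded f(4)]
  have main: "normals z1 z2 z3 c x y e f \<sigma>"
    if \<sigma>: "\<sigma> = 1 \<or> \<sigma> = -1" for \<sigma>
  proof -
    \<comment> \<open>With \<open>n1 = cos \<psi> e + sin \<psi> f\<close> and \<open>n2 = C (sh z1 + ch e) + D f\<close>, the condition \<open>q n1 n2 = c\<close>
      reads \<open>ch cos \<psi> C + sin \<psi> D = c\<close>; \<open>C\<close>, \<open>D\<close> is one of its two solutions on the unit circle,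
      and both normals change sign under \<open>\<psi> \<mapsto> \<psi> + \<pi>\<close>.\<close>
    define R S C D where "R \<psi> = (ch * cos \<psi>)\<^sup>2 + (sin \<psi>)\<^sup>2"
      and "S \<psi> = sqrt (R \<psi> - c\<^sup>2)"
      and "C \<psi> = (c * (ch * cos \<psi>) - \<sigma> * S \<psi> * sin \<psi>) / R \<psi>"
      and "D \<psi> = (c * sin \<psi> + \<sigma> * S \<psi> * (ch * cos \<psi>)) / R \<psi>" for \<psi> :: real
    have R_eq: "R \<psi> = 1 + sh\<^sup>2 * (cos \<psi>)\<^sup>2" for \<psi>
      using sh sin_squared_eq[of \<psi>] by (simp add: R_def power_mult_distrib) algebra
    have R1: "R \<psi> \<ge> 1" for \<psi> by (simp add: R_eq)
    have S2: "(S \<psi>)\<^sup>2 = R \<psi> - c\<^sup>2" and S0: "S \<psi> > 0" for \<psi>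
      using R1[of \<psi>] c by (auto simp: S_def)
    have \<sigma>2: "\<sigma>\<^sup>2 = 1" using \<sigma> by auto
    \<comment> \<open>A product of two sums of two squares, with
      \<open>c\<^sup>2 + (S \<psi>)\<^sup>2 = R \<psi>\<close>.\<close>
    have CD1: "(C \<psi>)\<^sup>2 + (D \<psi>)\<^sup>2 = 1" for \<psi>
    proof -
      have "(c * (ch * cos \<psi>) - \<sigma> * S \<psi> * sin \<psi>)\<^sup>2 + (c * sin \<psi> + \<sigma> * S \<psi> * (ch * cos \<psi>))\<^sup>2
          = (c\<^sup>2 + \<sigma>\<^sup>2 * (S \<psi>)\<^sup>2) * ((ch * cos \<psi>)\<^sup>2 + (sin \<psi>)\<^sup>2)" by algebra
      also have "\<dots> = (R \<psi>)\<^sup>2" unfolding S2 \<sigma>2 R_def[symmetric] by (simp add: power2_eq_square)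
      finally show ?thesis using R1[of \<psi>] by (simp add: C_def D_def power_divide add_divide_distrib[symmetric])
    qed
    have CDc: "ch * cos \<psi> * C \<psi> + sin \<psi> * D \<psi> = c" for \<psi>
    proof -
      have "ch * cos \<psi> * (c * (ch * cos \<psi>) - \<sigma> * S \<psi> * sin \<psi>) + sin \<psi> * (c * sin \<psi> + \<sigma> * S \<psi> * (ch * cos \<psi>))
        = c * R \<psi>" unfolding R_def by algebra
      then show ?thesis using R1[of \<psi>] by (simp add: C_def D_def add_divide_distrib[symmetric])
    qed
    \<comment> \<open>The factor in \<open>\<omega> z1 n1 n2 = \<Delta> * \<omega> z1 e f\<close>
      for every volume form, so its sign is the orientation of the normals.\<close>
    define \<Delta> where "\<Delta> \<psi> = cos \<psi> * D \<psi> - sin \<psi> * C \<psi> * ch" for \<psi>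
    have \<Delta>: "\<sigma> * \<Delta> \<psi> > 0" for \<psi>
    proof -
      have e1: "\<sigma> * \<Delta> \<psi> * R \<psi> = S \<psi> * ch - \<sigma> * c * sh\<^sup>2 * sin \<psi> * cos \<psi>"
      proof -
        have "\<Delta> \<psi> * R \<psi> = cos \<psi> * (c * sin \<psi> + \<sigma> * S \<psi> * (ch * cos \<psi>)) - sin \<psi> * ch * (c * (ch * cos \<psi>) - \<sigma> * S \<psi> * sin \<psi>)"
          using R1[of \<psi>] by (simp add: \<Delta>_def C_def D_def field_simps)
        then show ?thesis using sh \<sigma>2 sin_cos_squared_add[of \<psi>] by algebra
      qed
      \<comment> \<open>The mixed term is compared with \<open>S * ch\<close> through squares;
        strictness comes from \<open>(S \<psi>)\<^sup>2 = 1 - c\<^sup>2 + sh\<^sup>2 * (cos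
        \<psi>)\<^sup>2\<close>.\<close>
      have "(\<sigma> * c * sh\<^sup>2 * sin \<psi> * cos \<psi>)\<^sup>2 = sh\<^sup>2 * (cos \<psi>)\<^sup>2 * (sh\<^sup>2 * (c\<^sup>2 * (sin \<psi>)\<^sup>2))"
        using \<sigma>2 by algebra
      also have "\<dots> \<le> sh\<^sup>2 * (cos \<psi>)\<^sup>2 * (ch\<^sup>2 * (1 * 1))"
      proof -
        have "c\<^sup>2 \<le> 1" using c by linarith
        moreover have "(sin \<psi>)\<^sup>2 \<le> 1" by (simp add: abs_square_le_1)
        moreover have "sh\<^sup>2 \<le> ch\<^sup>2" using sh by linarith
        ultimately show ?thesis by (intro mult_left_mono mult_mono) auto
      qed
      also have "\<dots> < (S \<psi>)\<^sup>2 * ch\<^sup>2"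
      proof -
        have "sh\<^sup>2 * (cos \<psi>)\<^sup>2 < (S \<psi>)\<^sup>2" using c by (simp only: S2 R_eq)
        moreover have "ch\<^sup>2 > 0" using ch by simp
        ultimately show ?thesis by simp
      qed
      finally have "(\<sigma> * c * sh\<^sup>2 * sin \<psi> * cos \<psi>)\<^sup>2 < (S \<psi> * ch)\<^sup>2" by (simp add: power_mult_distrib)
      then have "\<sigma> * c * sh\<^sup>2 * sin \<psi> * cos \<psi> < S \<psi> * ch"
        by (rule power2_less_imp_less) (use S0[of \<psi>] ch in simp)
      then have "\<sigma> * \<Delta> \<psi> * R \<psi> > 0" using e1 by simp
      then show ?thesis using R1[of \<psi>] by (simp add: zero_less_mult_iff)
    qed
    \<comment> \<open>\<open>sh z1 + ch e\<close> is the unit tangent of the side at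
      \<open>z2\<close>, which makes \<open>n2\<close> orthogonal to \<open>z2\<close> just as
      \<open>n1\<close> is to \<open>z1\<close>.\<close>
    define n1 n2 where "n1 \<psi> = cos \<psi> *\<^sub>R e + sin \<psi> *\<^sub>R f"
      and "n2 \<psi> = C \<psi> *\<^sub>R (sh *\<^sub>R z1 + ch *\<^sub>R e) + D \<psi> *\<^sub>R f" for \<psi>
    define G where "G \<psi> = x * (\<beta> * cos \<psi> + \<gamma> * sin \<psi>) + y * (C \<psi> * (\<beta> * ch - \<alpha> * sh) + \<gamma> * D \<psi>)" for \<psi>
    have Gq: "q z3 (x *\<^sub>R n1 \<psi> + y *\<^sub>R n2 \<psi>) = G \<psi>" for \<psi>
    proof -
      have "q z3 e = \<beta>" "q z3 z1 = - \<alpha>" by (simp_all add: \<alpha>_def \<beta>_def)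
      moreover have "q z3 f = \<gamma>" by (subst z3) (simp add: q_simps fr)
      ultimately show ?thesis by (simp add: n1_def n2_def q_simps G_def algebra_simps)
    qed
    have "continuous_on {0..pi} G"
    proof -
      have "R \<psi> \<noteq> 0" for \<psi> using R1[of \<psi>] by auto
      moreover have "continuous_on {0..pi} R" unfolding R_def by (intro continuous_intros)
      ultimately show ?thesis unfolding G_def C_def D_def S_def
        by (intro continuous_intros) auto
    qed
    \<comment> \<open>\<open>R\<close> and \<open>S\<close> have period \<open>pi\<close>, while
      both normals change sign.\<close>
    moreover have "G pi = - G 0" by (simp add: G_def C_def D_def S_def R_def algebra_simps)
    ultimately obtain \<psi> where \<psi>: "G \<psi> = 0"
      using IVT'[of G 0 0 pi] IVT2'[of G pi 0 0] by (cases "G 0 \<le> 0") auto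
    have 11: "q (n1 \<psi>) (n1 \<psi>) = 1"
      by (simp add: n1_def q_simps fr flip: power2_eq_square)
    have 22: "q (n2 \<psi>) (n2 \<psi>) = 1"
    proof -
      have "q (n2 \<psi>) (n2 \<psi>) = (C \<psi>)\<^sup>2 * (ch\<^sup>2 - sh\<^sup>2) + (D \<psi>)\<^sup>2"
        by (simp add: n2_def q_simps fr power2_eq_square algebra_simps)
      then show ?thesis using CD1 sh by simp
    qed
    have 12: "q (n1 \<psi>) (n2 \<psi>) = c"
      using CDc[of \<psi>] by (simp add: n1_def n2_def q_simps fr algebra_simps)
    have z1n: "q z1 (n1 \<psi>) = 0" "q z1 (n2 \<psi>) = - (C \<psi> * sh)"
      by (simp_all add: n1_def n2_def q_simps fr)
    have z2n: "q z2 (n2 \<psi>) = 0" unfolding e(4) by (simp add: n2_def q_simps fr algebra_simps)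
    \<comment> \<open>\<open>P\<close> is \<open>z1\<close> minus its projection to the plane of the
      normals, found by inverting their Gram matrix, whose determinant is
      \<open>1 - c\<^sup>2\<close>. Normalized, it is the common point of the two lines.\<close>
    define \<eta> P where "\<eta> = - (C \<psi> * sh)"
      and "P = z1 + (c * \<eta> / (1 - c\<^sup>2)) *\<^sub>R n1 \<psi> - (\<eta> / (1 - c\<^sup>2)) *\<^sub>R n2 \<psi>"
    have z1n2: "q z1 (n2 \<psi>) = \<eta>" by (simp add: z1n \<eta>_def)
    have c1: "1 - c\<^sup>2 > 0" using c by simp
    have P1: "q P (n1 \<psi>) = 0"
      by (simp add: P_def q_simps 11 12 z1n q_sym[of "n2 \<psi>" "n1 \<psi>"])
    have P2: "q P (n2 \<psi>) = 0"
      using c1 by (simp add: P_def q_simps 12 22 z1n2 divide_simps) (simp add: algebra_simps power2_eq_square)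
    have Pz: "q P z1 = - (1 + \<eta>\<^sup>2 / (1 - c\<^sup>2))"
      by (simp add: P_def q_simps z1n(1) z1n2 q_sym[of "n1 \<psi>" z1] q_sym[of "n2 \<psi>" z1] zz(1) power2_eq_square)
    have PP: "q P P = - (1 + \<eta>\<^sup>2 / (1 - c\<^sup>2))"
    proof -
      have "q P P = q P z1 + (c * \<eta> / (1 - c\<^sup>2)) * q P (n1 \<psi>) - (\<eta> / (1 - c\<^sup>2)) * q P (n2 \<psi>)"
        by (subst (2) P_def) (simp add: q_simps)
      then show ?thesis using P1 P2 Pz by simp
    qed
    have nV: "n1 \<psi> \<in> V" "n2 \<psi> \<in> V" using e f zz subspace_V
      by (auto simp: n1_def n2_def subspace_add subspace_scale)
    have PV: "P \<in> V" using nV zz subspace_V by (auto simp: P_def subspace_add subspace_diff subspace_scale)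
    have neg: "- (1 + \<eta>\<^sup>2 / (1 - c\<^sup>2)) < 0" 
    proof -
      have "\<eta>\<^sup>2 / (1 - c\<^sup>2) \<ge> 0" using c1 by (intro divide_nonneg_pos) auto
      then show ?thesis by linarith
    qed
    define l where "l = sqrt (- q P P)"
    have l0: "l > 0" using PP neg by (simp add: l_def)
    define p where "p = (1 / l) *\<^sub>R P"
    have pH: "p \<in> H" unfolding p_def l_def
      by (rule H_normalize[of P z1]) (use PV PP neg Pz z in auto)
    have P_p: "P = l *\<^sub>R p" using l0 by (simp add: p_def)
    have z1_eq: "z1 = l *\<^sub>R p - (c * \<eta> / (1 - c\<^sup>2)) *\<^sub>R n1 \<psi> + (\<eta> / (1 - c\<^sup>2)) *\<^sub>R n2 \<psi>"
      unfolding P_p[symmetric] by (simp add: P_def)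
    have z1s: "z1 \<in> span {p, n1 \<psi>, n2 \<psi>}"
      by (subst z1_eq) (intro span_add span_diff span_scale span_base; simp)
    have \<Delta>0: "\<Delta> \<psi> \<noteq> 0" using \<Delta>[of \<psi>] by auto
    \<comment> \<open>Without the \<open>z1\<close> component a two-by-two system for
      \<open>e\<close> and \<open>f\<close> remains; its determinant is \<Delta>, and solving it
      puts \<open>e\<close> and \<open>f\<close> into the span of the frame.\<close>
    define n2' where "n2' = n2 \<psi> - (C \<psi> * sh) *\<^sub>R z1"
    have n2': "n2' = (C \<psi> * ch) *\<^sub>R e + D \<psi> *\<^sub>R f" by (simp add: n2'_def n2_def algebra_simps)
    have n2's: "n2' \<in> span {p, n1 \<psi>, n2 \<psi>}"
      unfolding n2'_def by (intro span_diff span_scale z1s) (simp add: span_base)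
    have "\<Delta> \<psi> *\<^sub>R e = D \<psi> *\<^sub>R n1 \<psi> - sin \<psi> *\<^sub>R n2'"
      by (simp add: n2' n1_def \<Delta>_def algebra_simps)
    then have "e = (1 / \<Delta> \<psi>) *\<^sub>R (D \<psi> *\<^sub>R n1 \<psi> - sin \<psi> *\<^sub>R n2')"
      using \<Delta>0 by (metis divideR_right scaleR_one divide_inverse_commute mult.right_neutral inverse_eq_divide)
    then have es: "e \<in> span {p, n1 \<psi>, n2 \<psi>}"
      using n2's by (metis insertI1 insert_commute span_base span_diff span_scale)
    have "\<Delta> \<psi> *\<^sub>R f = cos \<psi> *\<^sub>R n2' - (C \<psi> * ch) *\<^sub>R n1 \<psi>"
      by (simp add: n2' n1_def \<Delta>_def algebra_simps)
    then have "f = (1 / \<Delta> \<psi>) *\<^sub>R (cos \<psi> *\<^sub>R n2' - (C \<psi> * ch) *\<^sub>R n1 \<psi>)"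
      using \<Delta>0 by (metis divideR_right scaleR_one divide_inverse_commute mult.right_neutral inverse_eq_divide)
    then have fs: "f \<in> span {p, n1 \<psi>, n2 \<psi>}"
      using n2's by (metis insertI1 insert_commute span_base span_diff span_scale)
    have z2s: "z2 \<in> span {p, n1 \<psi>, n2 \<psi>}"
      unfolding e(4) by (intro span_add span_scale z1s es)
    have z3s: "z3 \<in> span {p, n1 \<psi>, n2 \<psi>}"
      by (subst z3) (intro span_add span_scale z1s es fs)
    have \<omega>: "\<omega> p (n1 \<psi>) (n2 \<psi>) = (\<sigma> * \<Delta> \<psi> / l) * \<sigma> * \<omega> z1 e f" if "alt3 \<omega>" for \<omega>
    proof -
      note a = alt3_simps[OF that]
      have "\<omega> p (n1 \<psi>) (n2 \<psi>) = (1 / l) * \<omega> z1 (n1 \<psi>) (n2 \<psi>)"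
        unfolding p_def P_def by (simp add: a)
      also have "\<omega> z1 (n1 \<psi>) (n2 \<psi>) = \<Delta> \<psi> * \<omega> z1 e f"
        by (simp add: n1_def n2_def a alt3_skew[OF that, of z1 f e] \<Delta>_def algebra_simps)
      finally show ?thesis using \<sigma> by auto
    qed
    have ge: "\<sigma> * \<Delta> \<psi> / l > 0" using \<Delta>[of \<psi>] l0 by simp
    have "q p (n1 \<psi>) = 0" "q p (n2 \<psi>) = 0" using P1 P2 by (simp_all add: p_def q_simps)
    then show ?thesis
      unfolding normals_def using nV pH 11 22 12 z1s z2s z3s z1n z2n Gq[of \<psi>] \<psi> ge \<omega>
      by (intro exI[of _ "n1 \<psi>"] exI[of _ "n2 \<psi>"] exI[of _ p] exI[of _ "\<sigma> * \<Delta> \<psi> / l"]) auto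
  qed
  show ?thesis
    by (rule that[OF e(1) f(1) e(2) f(2) _ _ _ main]) (simp_all add: fr)
qed

end

section \<open>Placing a triangle on three lines by an isometry\<close>

context lorentz_space
begin

lemma unit_component:
  assumes "q v v = 1" "q m m = 1" "q m v = c" "s > 0" "s\<^sup>2 = 1 - c\<^sup>2"
  shows "q ((1 / s) *\<^sub>R (v - c *\<^sub>R m)) ((1 / s) *\<^sub>R (v - c *\<^sub>R m)) = 1"
proof -
  have "q (v - c *\<^sub>R m) (v - c *\<^sub>R m) = s\<^sup>2"
    using assms by (simp add: q_simps q_sym[of v m] power2_eq_square)
  then show ?thesis using assms(4) by (simp only: q_simps(5,6)) (simp add: power2_eq_square)
qed

lemma q_nondegenerate:
  assumes "x \<in> V" "\<And>v. v \<in> V \<Longrightarrow> q v x = 0" shows "x = 0"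
proof -
  \<comment> \<open>Reversing the time component of \<open>x\<close> gives a test vector with
    \<open>q v x = x \<bullet> x\<close>.\<close>
  define v where "v = x - (2 * (x \<bullet> b0)) *\<^sub>R b0"
  have "v \<in> V" using assms(1) b0 subspace_V by (simp add: v_def subspace_diff subspace_scale)
  then have "q v x = 0" by (rule assms)
  then have "x \<bullet> x = 0" by (simp add: v_def q_def inner_simps algebra_simps inner_commute[of b0 x])
  then show ?thesis by simp
qed

text \<open>On the complement of the timelike \<open>z\<close> the form is positive definite, so
  Cauchy-Schwarz is strict for unit vectors that are neither equal nor opposite.\<close>

lemma q_unit_abs_lt:
  assumes "z \<in> H" "q a z = 0" "q b z = 0" "q a a = 1" "q b b = 1" "b \<noteq> a" "b \<noteq> - a"
  shows "(q a b)\<^sup>2 < 1"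
proof (rule ccontr)
  assume n: "\<not> (q a b)\<^sup>2 < 1"
  define y where "y = b - q a b *\<^sub>R a"
  have "q y z = 0" using assms by (simp add: y_def q_simps)
  moreover have yy: "q y y = 1 - (q a b)\<^sup>2"
    using assms by (simp add: y_def q_simps q_sym[of b a] power2_eq_square algebra_simps)
  moreover have "q z z < 0" using assms by (simp add: H_def)
  ultimately have "y = 0" using n q_pos_orthogonal[of z y] by (metis diff_gt_0_iff_gt)
  then have "b = q a b *\<^sub>R a" by (simp add: y_def)
  moreover have "(q a b)\<^sup>2 = 1" using yy \<open>y = 0\<close> by (simp add: q_simps)
  then have "q a b = 1 \<or> q a b = -1" by (simp add: power2_eq_1_iff)
  ultimately show False using assms(6,7) by auto
qed

text \<open>In the plane of \<open>w\<close> and \<open>u\<close> the hyperboloid is the branch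
  \<open>a\<^sup>2 - b\<^sup>2 = 1\<close>, \<open>a > 0\<close>, with parameter
  \<open>arsinh b\<close>.\<close>

lemma H_ray:
  assumes "v \<in> H" "w \<in> H" "q u w = 0" "q u u = 1" and v: "v = a *\<^sub>R w + b *\<^sub>R u"
  shows "\<exists>t. v = cosh t *\<^sub>R w + sinh t *\<^sub>R u"
proof -
  have vw: "q v v = -1" "q w w = -1" using assms by (auto simp: H_def)
  have "q v v = - a\<^sup>2 + b\<^sup>2"
    unfolding v using assms(3,4) vw(2) by (simp add: q_simps q_sym[of w u] power2_eq_square algebra_simps)
  then have ab: "a\<^sup>2 = b\<^sup>2 + 1" using vw by simp
  have "q v w = - a" unfolding v using assms(3) vw(2) by (simp add: q_simps)
  then have "a > 0" using q_H_neg[OF assms(1,2)] by simp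
  then have "a = cosh (arsinh b)" using ab
    by (simp add: cosh_arsinh_real) (metis abs_of_pos real_sqrt_abs)
  then show ?thesis using v by (intro exI[of _ "arsinh b"]) simp
qed

text \<open>The vector in the orthogonality condition is \<open>u\<close> turned by a right angle: a
  line through \<open>w\<close> in a plane is recognized by its unit normal.\<close>

lemma H_perp_ray:
  assumes "v \<in> H" "w \<in> H" "v \<in> span {w, E1, E2}"
    and E: "q E1 w = 0" "q E2 w = 0" "q E1 E1 = 1" "q E2 E2 = 1" "q E1 E2 = 0"
    and u: "u = \<mu> *\<^sub>R E1 + \<nu> *\<^sub>R E2" "\<mu>\<^sup>2 + \<nu>\<^sup>2 = 1" and n: "q v (\<mu> *\<^sub>R E2 - \<nu> *\<^sub>R E1) = 0"
  shows "\<exists>t. v = cosh t *\<^sub>R w + sinh t *\<^sub>R u"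
proof -
  from assms(3) obtain \<alpha> a b where v: "v = \<alpha> *\<^sub>R w + a *\<^sub>R E1 + b *\<^sub>R E2"
    by (auto simp: span_insert span_singleton algebra_simps dest!: spec)
  note s = q_sym[of w E1, unfolded E(1)] q_sym[of w E2, unfolded E(2)] q_sym[of E2 E1, unfolded E(5)]
  have n': "b * \<mu> = a * \<nu>" using n unfolding v by (simp add: q_simps E s mult.commute)
  obtain t where t: "a = t * \<mu>" "b = t * \<nu>"
  proof
    show "a = (a * \<mu> + b * \<nu>) * \<mu>" "b = (a * \<mu> + b * \<nu>) * \<nu>"
      using n' u(2) by algebra+
  qed
  have "v = \<alpha> *\<^sub>R w + t *\<^sub>R u"
    unfolding v u(1) t by (simp add: algebra_simps)
  then show ?thesis
  proof (rule H_ray[rotated -1])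
    show "q u w = 0" unfolding u(1) by (simp add: q_simps E)
    show "q u u = 1" unfolding u(1) using u(2) by (simp add: q_simps E s power2_eq_square)
  qed fact+
qed

text \<open>Separates the geometry of the triangle from the supply of group elements: any isometry
  \<open>r\<close> carrying the frame \<open>(p, n1, n2)\<close> to \<open>(w, m1, m2)\<close> moves
  the triangle into position, while \<kappa> and \<sigma> record the orientation on which the
  existence of such an \<open>r\<close> in the group may depend.\<close>

definition placing where
  "placing z1 z2 z3 w u1 u2 u3 m1 m2 e f \<sigma> \<longleftrightarrow> (\<exists>n1 n2 p \<kappa>. n1 \<in> V \<and> n2 \<in> V \<and> p \<in> H \<and> q n1 n1 = 1 \<and> q n2 n2 = 1 \<and>
       q n1 n2 = q m1 m2 \<and> q n1 p = 0 \<and> q n2 p = 0 \<and> \<kappa> > 0 \<and>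
       (\<forall>\<omega>. alt3 \<omega> \<longrightarrow> \<omega> p n1 n2 = \<kappa> * \<sigma> * \<omega> z1 e f) \<and>
       (\<forall>r. linear r \<longrightarrow> (\<forall>a\<in>V. \<forall>b\<in>V. q (r a) (r b) = q a b) \<longrightarrow> r ` H \<subseteq> H \<longrightarrow> r p = w \<longrightarrow> r n1 = m1 \<longrightarrow> r n2 = m2 \<longrightarrow>
         (\<exists>t. r z1 = cosh t *\<^sub>R w + sinh t *\<^sub>R u1) \<and> (\<exists>t. r z2 = cosh t *\<^sub>R w + sinh t *\<^sub>R u2) \<and>
         (\<exists>t. r z3 = cosh t *\<^sub>R w + sinh t *\<^sub>R u3)))"

lemma triangle_placement:
  assumes z: "z1 \<in> H" "z2 \<in> H" "z3 \<in> H" and w: "w \<in> H"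
    and u: "u1 \<in> V" "u2 \<in> V" "q u1 u1 = 1" "q u2 u2 = 1" "q u3 u3 = 1" "q u1 w = 0" "q u2 w = 0"
    and c: "(q u1 u2)\<^sup>2 < 1" and u3: "u3 = x *\<^sub>R u1 + y *\<^sub>R u2"
  obtains m1 m2 e f where "m1 \<in> V" "m2 \<in> V" "q m1 w = 0" "q m2 w = 0" "q m1 m1 = 1" "q m2 m2 = 1"
    "(q m1 m2)\<^sup>2 < 1" "e \<in> V" "f \<in> V" "q e e = 1" "q f f = 1" "q z1 e = 0" "q z1 f = 0" "q e f = 0"
    "\<forall>\<sigma>. \<sigma> = 1 \<or> \<sigma> = -1 \<longrightarrow> placing z1 z2 z3 w u1 u2 u3 m1 m2 e f \<sigma>"
proof -
  define c where "c = q u1 u2"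
  define s where "s = sqrt (1 - c\<^sup>2)"
  have s: "s > 0" "s\<^sup>2 = 1 - c\<^sup>2" using c by (auto simp: s_def c_def)
  define E where "E = (1 / s) *\<^sub>R (u2 - c *\<^sub>R u1)"
  have u2: "u2 = c *\<^sub>R u1 + s *\<^sub>R E" using s by (simp add: E_def)
  have EV: "E \<in> V" using u subspace_V by (simp add: E_def subspace_diff subspace_scale)
  have Ew: "q E w = 0" using u by (simp add: E_def q_simps)
  have u1E: "q u1 E = 0" using u by (simp add: E_def q_simps c_def)
  have EE: "q E E = 1" unfolding E_def using u s by (intro unit_component) (auto simp: c_def)
  \<comment> \<open>\<open>u1\<close> and \<open>u2\<close> turned by a right angle in their plane,
    that is, normals of the first two target lines; \<open>x m1 + y m2\<close> is then the normal of
    the third.\<close>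
  define m1 m2 where "m1 = E" and "m2 = c *\<^sub>R E - s *\<^sub>R u1"
  have m12: "q m1 m2 = c" by (simp add: m1_def m2_def q_simps EE q_sym[of E u1] u1E)
  have m22: "q m2 m2 = 1"
  proof -
    have "q m2 m2 = c\<^sup>2 + s\<^sup>2" by (simp add: m2_def q_simps EE q_sym[of E u1] u1E u(3) power2_eq_square)
    then show ?thesis using s by simp
  qed
  have mV: "m1 \<in> V" "m2 \<in> V" using EV u subspace_V by (auto simp: m1_def m2_def subspace_diff subspace_scale)
  have mw: "q m1 w = 0" "q m2 w = 0" using Ew u by (auto simp: m1_def m2_def q_simps)
  have c2: "c\<^sup>2 < 1" using c by (simp add: c_def)
  obtain e f where ef: "e \<in> V" "f \<in> V" "q e e = 1" "q f f = 1" "q z1 e = 0" "q z1 f = 0" "q e f = 0"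
    and nn: "\<And>\<sigma>. \<sigma> = 1 \<or> \<sigma> = -1 \<Longrightarrow> normals z1 z2 z3 c x y e f \<sigma>"
    by (rule rotating_normals[OF z c2, of x y]) (rule that)
  have main: "placing z1 z2 z3 w u1 u2 u3 m1 m2 e f \<sigma>"
    if \<sigma>: "\<sigma> = 1 \<or> \<sigma> = -1" for \<sigma>
  proof -
    obtain n1 n2 p \<kappa> where n: "n1 \<in> V" "n2 \<in> V" "p \<in> H" "q n1 n1 = 1" "q n2 n2 = 1" "q n1 n2 = c"
       "q p n1 = 0" "q p n2 = 0" "{z1, z2, z3} \<subseteq> span {p, n1, n2}" "q z1 n1 = 0" "q z2 n2 = 0"
       "q z3 (x *\<^sub>R n1 + y *\<^sub>R n2) = 0" "\<kappa> > 0" "\<forall>\<omega>. alt3 \<omega> \<longrightarrow> \<omega> p n1 n2 = \<kappa> * \<sigma> * \<omega> z1 e f"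
      using nn[OF \<sigma>] unfolding normals_def by auto
    have "(\<exists>t. r z1 = cosh t *\<^sub>R w + sinh t *\<^sub>R u1) \<and> (\<exists>t. r z2 = cosh t *\<^sub>R w + sinh t *\<^sub>R u2) \<and>
         (\<exists>t. r z3 = cosh t *\<^sub>R w + sinh t *\<^sub>R u3)"
      if r: "linear r" "\<forall>a\<in>V. \<forall>b\<in>V. q (r a) (r b) = q a b" "r ` H \<subseteq> H" "r p = w" "r n1 = m1" "r n2 = m2" for r
    proof -
      have zV: "z1 \<in> V" "z2 \<in> V" "z3 \<in> V" using z by (auto simp: H_def)
      have "span {w, m1, m2} \<subseteq> span {w, u1, E}"
      proof (intro span_minimal subspace_span)
        have "u1 \<in> span {w, u1, E}" "E \<in> span {w, u1, E}" "w \<in> span {w, u1, E}"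
          by (simp_all add: span_base)
        then show "{w, m1, m2} \<subseteq> span {w, u1, E}"
          by (simp add: m1_def m2_def span_diff span_scale)
      qed
      moreover have "r v \<in> span {w, m1, m2}" if "v \<in> span {p, n1, n2}" for v
        using linear_span_image[OF r(1), of "{p, n1, n2}"] that r(4-6) by auto
      ultimately have sp: "r v \<in> span {w, u1, E}" if "v \<in> {z1, z2, z3}" for v
        using n(9) that by blast
      note E = u(6) Ew u(3) EE u1E
      have 1: "q (r z1) m1 = 0" using r(2) zV n(1,10) r(5) by metis
      have 2: "q (r z2) m2 = 0" using r(2) zV n(2,11) r(6) by metis
      have "q (r z3) (r (x *\<^sub>R n1 + y *\<^sub>R n2)) = 0"
        using r(2) zV n(1,2,12) subspace_V by (simp add: subspace_add subspace_scale)
      then have 3: "q (r z3) (x *\<^sub>R m1 + y *\<^sub>R m2) = 0"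
        using r by (simp add: linear_add linear_scale)
      have u3': "u3 = (x + y * c) *\<^sub>R u1 + (y * s) *\<^sub>R E" unfolding u3 by (subst u2) (simp add: algebra_simps)
      show ?thesis
      proof (intro conjI)
        show "\<exists>t. r z1 = cosh t *\<^sub>R w + sinh t *\<^sub>R u1"
          by (rule H_perp_ray[OF _ w sp E, where \<mu>=1 and \<nu>=0])
            (use r(3) z 1 in \<open>auto simp: m1_def\<close>)
        show "\<exists>t. r z2 = cosh t *\<^sub>R w + sinh t *\<^sub>R u2"
          by (rule H_perp_ray[OF _ w sp E u2])
            (use r(3) z 2 s in \<open>auto simp: m2_def\<close>)
        show "\<exists>t. r z3 = cosh t *\<^sub>R w + sinh t *\<^sub>R u3"
        proof (rule H_perp_ray[OF _ w sp E u3'])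
          have "q u3 u3 = (x + y * c)\<^sup>2 + (y * s)\<^sup>2"
            unfolding u3' by (simp add: q_simps E q_sym[of E u1] power2_eq_square)
          then show "(x + y * c)\<^sup>2 + (y * s)\<^sup>2 = 1" using u by simp
          have "(x + y * c) *\<^sub>R E - (y * s) *\<^sub>R u1 = x *\<^sub>R m1 + y *\<^sub>R m2"
            by (simp add: m1_def m2_def algebra_simps)
          then show "q (r z3) ((x + y * c) *\<^sub>R E - (y * s) *\<^sub>R u1) = 0" using 3 by simp
        qed (use r(3) z in auto)
      qed
    qed
    then show ?thesis
      unfolding placing_def using n m12 q_sym[of p n1] q_sym[of p n2]
      by (intro exI[of _ n1] exI[of _ n2] exI[of _ p] exI[of _ \<kappa>]) simp
  qed
  show ?thesis
    by (rule that[OF mV mw _ m22 _ ef]) (use main EE c2 m12 in \<open>auto simp: m1_def\<close>)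
qed

end

lemma analytic_subgroup_props:
  "mat 1 \<in> analytic_subgroup k" "X \<in> k \<Longrightarrow> mexp X \<in> analytic_subgroup k"
  "a \<in> analytic_subgroup k \<Longrightarrow> b \<in> analytic_subgroup k \<Longrightarrow> a ** b \<in> analytic_subgroup k"
  "a \<in> analytic_subgroup k \<Longrightarrow> matrix_inv a \<in> analytic_subgroup k"
  by (auto simp: analytic_subgroup_def)

lemma analytic_subgroup_minimal:
  assumes "mat 1 \<in> S" "\<And>X. X \<in> k \<Longrightarrow> mexp X \<in> S" "\<And>a b. a \<in> S \<Longrightarrow> b \<in> S \<Longrightarrow> a ** b \<in> S"
    "\<And>a. a \<in> S \<Longrightarrow> matrix_inv a \<in> S"
  shows "analytic_subgroup k \<subseteq> S"
  using assms by (auto simp: analytic_subgroup_def)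

section \<open>Groups of Lorentz transformations\<close>

text \<open>The interface shared by the three families. \<open>wedge\<close> provides the rank-two
  skew maps, which span the full orthogonal Lie algebra; \<open>rho_kernel\<close> absorbs elements
  acting trivially into any point stabilizer; \<open>no_reflection\<close> and
  \<open>orientation\<close> state that the isometries are proper, the latter in dimension 3, where
  this restricts the frames that can be matched.\<close>

locale lorentz_rep = lorentz_space V b0 + matrix_lie_algebra "lie_algebra G0"
  for V :: "'v::euclidean_space set" and b0 :: 'v and G0 :: "'n::finite cmat set" +
  fixes \<rho> :: "'n cmat \<Rightarrow> 'v \<Rightarrow> 'v" and d\<rho> :: "'n cmat \<Rightarrow> 'v \<Rightarrow> 'v"
  assumes G_one: "mat 1 \<in> G0"
    and G_mult: "g \<in> G0 \<Longrightarrow> h \<in> G0 \<Longrightarrow> g ** h \<in> G0"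
    and G_inv: "g \<in> G0 \<Longrightarrow> matrix_inv g \<in> G0"
    and G_inv_right: "g \<in> G0 \<Longrightarrow> g ** matrix_inv g = mat 1"
    and rho_linear: "g \<in> G0 \<Longrightarrow> linear (\<rho> g)"
    and rho_V: "g \<in> G0 \<Longrightarrow> x \<in> V \<Longrightarrow> \<rho> g x \<in> V"
    and rho_q: "g \<in> G0 \<Longrightarrow> x \<in> V \<Longrightarrow> y \<in> V \<Longrightarrow> q (\<rho> g x) (\<rho> g y) = q x y"
    and rho_H: "g \<in> G0 \<Longrightarrow> x \<in> H \<Longrightarrow> \<rho> g x \<in> H"
    and rho_mult: "g \<in> G0 \<Longrightarrow> h \<in> G0 \<Longrightarrow> x \<in> V \<Longrightarrow> \<rho> (g ** h) x = \<rho> g (\<rho> h x)"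
    and rho_one: "x \<in> V \<Longrightarrow> \<rho> (mat 1) x = x"
    and drho_bilinear: "bounded_bilinear d\<rho>"
    and drho_deriv: "X \<in> lie_algebra G0 \<Longrightarrow> x \<in> V \<Longrightarrow>
      ((\<lambda>t. \<rho> (mexp (t *\<^sub>R X)) x) has_vector_derivative d\<rho> X (\<rho> (mexp (t *\<^sub>R X)) x)) (at t)"
    and Ad_closed: "g \<in> G0 \<Longrightarrow> X \<in> lie_algebra G0 \<Longrightarrow> g ** X ** matrix_inv g \<in> lie_algebra G0"
    and drho_Ad: "g \<in> G0 \<Longrightarrow> X \<in> lie_algebra G0 \<Longrightarrow> x \<in> V \<Longrightarrow>
      d\<rho> (g ** X ** matrix_inv g) x = \<rho> g (d\<rho> X (\<rho> (matrix_inv g) x))"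
    and drho_bra: "X \<in> lie_algebra G0 \<Longrightarrow> Y \<in> lie_algebra G0 \<Longrightarrow> x \<in> V \<Longrightarrow>
      d\<rho> (bra X Y) x = d\<rho> X (d\<rho> Y x) - d\<rho> Y (d\<rho> X x)"
    and drho_inj: "X \<in> lie_algebra G0 \<Longrightarrow> (\<And>x. x \<in> V \<Longrightarrow> d\<rho> X x = 0) \<Longrightarrow> X = 0"
    and wedge: "u \<in> V \<Longrightarrow> v \<in> V \<Longrightarrow> \<exists>X\<in>lie_algebra G0. \<forall>x\<in>V. d\<rho> X x = q v x *\<^sub>R u - q u x *\<^sub>R v"
    and rho_kernel: "g \<in> G0 \<Longrightarrow> (\<And>x. x \<in> V \<Longrightarrow> \<rho> g x = x) \<Longrightarrow> z \<in> H \<Longrightarrow>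
      \<exists>X\<in>lie_algebra G0. d\<rho> X z = 0 \<and> g = mexp X"
    and no_reflection: "\<exists>a\<in>V. q a a = 1 \<and> \<not> (\<exists>g\<in>G0. \<forall>x\<in>V. \<rho> g x = x - (2 * q a x) *\<^sub>R a)"
    and orientation: "dim V = 3 \<Longrightarrow> \<exists>\<omega>. alt3 \<omega> \<and>
      (\<forall>g\<in>G0. \<forall>x\<in>V. \<forall>y\<in>V. \<forall>z\<in>V. \<omega> (\<rho> g x) (\<rho> g y) (\<rho> g z) = \<omega> x y z) \<and>
      (\<exists>x\<in>V. \<exists>y\<in>V. \<exists>z\<in>V. \<omega> x y z \<noteq> 0)"
begin

abbreviation "\<gg> \<equiv> lie_algebra G0"

lemma G_inv_left: "g \<in> G0 \<Longrightarrow> matrix_inv g ** g = mat 1"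
  using G_inv_right matrix_left_right_inverse[of g "matrix_inv g"] by simp

lemma H_V: "x \<in> H \<Longrightarrow> x \<in> V"
  by (simp add: H_def)

lemma H_q: "x \<in> H \<Longrightarrow> q x x = -1"
  by (simp add: H_def)

lemma rho_inv: "g \<in> G0 \<Longrightarrow> x \<in> V \<Longrightarrow> \<rho> (matrix_inv g) (\<rho> g x) = x" "g \<in> G0 \<Longrightarrow> x \<in> V \<Longrightarrow> \<rho> g (\<rho> (matrix_inv g) x) = x"
  using rho_mult[of "matrix_inv g" g x] rho_mult[of g "matrix_inv g" x]
  by (simp_all add: G_inv G_inv_left G_inv_right rho_one)

lemma exp_G: "X \<in> \<gg> \<Longrightarrow> mexp (t *\<^sub>R X) \<in> G0"
  by (simp add: lie_algebra_def)

lemma exp_G1: "X \<in> \<gg> \<Longrightarrow> mexp X \<in> G0"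
  using exp_G[of X 1] by simp

lemmas drho_simps =
  bounded_bilinear.add_left[OF drho_bilinear] bounded_bilinear.add_right[OF drho_bilinear]
  bounded_bilinear.diff_left[OF drho_bilinear] bounded_bilinear.diff_right[OF drho_bilinear]
  bounded_bilinear.minus_left[OF drho_bilinear] bounded_bilinear.minus_right[OF drho_bilinear]
  bounded_bilinear.scaleR_left[OF drho_bilinear] bounded_bilinear.scaleR_right[OF drho_bilinear]
  bounded_bilinear.zero_left[OF drho_bilinear] bounded_bilinear.zero_right[OF drho_bilinear]

lemma drho_skew:
  assumes "X \<in> \<gg>" "x \<in> V" "y \<in> V"
  shows "q (d\<rho> X x) y = - q x (d\<rho> X y)"
proof -
  have d: "((\<lambda>t. \<rho> (mexp (t *\<^sub>R X)) x) has_vector_derivative d\<rho> X x) (at 0)" if "x \<in> V" for x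
    using drho_deriv[OF assms(1) that, of 0] that by (simp add: rho_one)
  have "((\<lambda>t. q (\<rho> (mexp (t *\<^sub>R X)) x) (\<rho> (mexp (t *\<^sub>R X)) y)) has_vector_derivative
     (q (\<rho> (mexp (0 *\<^sub>R X)) x) (d\<rho> X y) + q (d\<rho> X x) (\<rho> (mexp (0 *\<^sub>R X)) y))) (at 0)"
    by (rule bounded_bilinear.has_vector_derivative[OF bounded_bilinear_q d[OF assms(2)] d[OF assms(3)]])
  moreover have "(\<lambda>t. q (\<rho> (mexp (t *\<^sub>R X)) x) (\<rho> (mexp (t *\<^sub>R X)) y)) = (\<lambda>t. q x y)"
    using rho_q exp_G assms by auto
  ultimately have "((\<lambda>t. q x y) has_vector_derivative (q x (d\<rho> X y) + q (d\<rho> X x) y)) (at 0)"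
    using assms by (simp add: rho_one)
  moreover have "((\<lambda>t. q x y) has_vector_derivative 0) (at (0::real))" by simp
  ultimately have "q x (d\<rho> X y) + q (d\<rho> X x) y = 0" by (rule vector_derivative_unique_at)
  then show ?thesis by simp
qed

lemma drho_V:
  assumes "X \<in> \<gg>" "x \<in> V" shows "d\<rho> X x \<in> V"
proof -
  have "((\<lambda>t. \<rho> (mexp (t *\<^sub>R X)) x) has_vector_derivative d\<rho> X x) (at 0)"
    using drho_deriv[OF assms, of 0] assms by (simp add: rho_one)
  then have d: "((\<lambda>t. w \<bullet> \<rho> (mexp (t *\<^sub>R X)) x) has_vector_derivative w \<bullet> d\<rho> X x) (at 0)" for w
    by (rule bounded_linear.has_vector_derivative[OF bounded_linear_inner_right])
  have "w \<bullet> d\<rho> X x = 0" if w: "w \<in> orthogonal_comp V" for w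
  proof -
    have "(\<lambda>t. w \<bullet> \<rho> (mexp (t *\<^sub>R X)) x) = (\<lambda>t. 0)"
      using w rho_V[OF exp_G[OF assms(1)] assms(2)] unfolding orthogonal_comp_def orthogonal_def
      by (auto simp: inner_commute[of w])
    then have "((\<lambda>t. 0) has_vector_derivative w \<bullet> d\<rho> X x) (at (0::real))" using d[of w] by simp
    moreover have "((\<lambda>t. 0::real) has_vector_derivative 0) (at (0::real))" by simp
    ultimately show ?thesis by (rule vector_derivative_unique_at)
  qed
  then have "d\<rho> X x \<in> orthogonal_comp (orthogonal_comp V)"
    by (auto simp: orthogonal_comp_def orthogonal_def inner_commute)
  then show ?thesis by (simp add: orthogonal_comp_self[OF subspace_V])
qed

text \<open>The product of an orbit with the curve is constant because \<open>d\<rho> X\<close> is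
  skew, and nondegeneracy then identifies the curve. Rotations and boosts are found by guessing an
  orbit and checking its differential equation.\<close>

lemma flow_unique:
  assumes X: "X \<in> \<gg>" and c: "\<And>t. c t \<in> V" "\<And>t. (c has_vector_derivative d\<rho> X (c t)) (at t)"
  shows "\<rho> (mexp (t *\<^sub>R X)) (c 0) = c t"
proof -
  have "q (\<rho> (mexp (t *\<^sub>R X)) y) (c t) = q y (c 0)" if y: "y \<in> V" for y t
  proof -
    have "((\<lambda>t. q (\<rho> (mexp (t *\<^sub>R X)) y) (c t)) has_vector_derivative
      (q (\<rho> (mexp (t *\<^sub>R X)) y) (d\<rho> X (c t)) + q (d\<rho> X (\<rho> (mexp (t *\<^sub>R X)) y)) (c t))) (at t)" for t
      by (rule bounded_bilinear.has_vector_derivative[OF bounded_bilinear_q drho_deriv[OF X y] c(2)])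
    moreover have "q (\<rho> (mexp (t *\<^sub>R X)) y) (d\<rho> X (c t)) + q (d\<rho> X (\<rho> (mexp (t *\<^sub>R X)) y)) (c t) = 0" for t
      using drho_skew[OF X rho_V[OF exp_G[OF X] y] c(1)] by simp
    ultimately have "((\<lambda>t. q (\<rho> (mexp (t *\<^sub>R X)) y) (c t)) has_vector_derivative 0) (at t)" for t by simp
    from const_if_vector_derivative_0[OF this, of t] show ?thesis using y by (simp add: rho_one)
  qed note 1 = this
  have gG: "mexp (t *\<^sub>R X) \<in> G0" by (rule exp_G[OF X])
  have "c t - \<rho> (mexp (t *\<^sub>R X)) (c 0) = 0"
  proof (rule q_nondegenerate)
    show "c t - \<rho> (mexp (t *\<^sub>R X)) (c 0) \<in> V"
      using c(1) rho_V[OF gG] subspace_V by (simp add: subspace_diff)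
    fix v assume v: "v \<in> V"
    define y where "y = \<rho> (matrix_inv (mexp (t *\<^sub>R X))) v"
    have y: "y \<in> V" "v = \<rho> (mexp (t *\<^sub>R X)) y" using v gG by (auto simp: y_def rho_V G_inv rho_inv)
    show "q v (c t - \<rho> (mexp (t *\<^sub>R X)) (c 0)) = 0"
      using 1[OF y(1), of t] rho_q[OF gG y(1) c(1)[of 0]] by (simp add: y(2) q_simps)
  qed
  then show ?thesis by simp
qed

lemma flow_fix: "X \<in> \<gg> \<Longrightarrow> x \<in> V \<Longrightarrow> d\<rho> X x = 0 \<Longrightarrow> \<rho> (mexp (t *\<^sub>R X)) x = x"
  using flow_unique[of X "\<lambda>t. x" t] by simp

definition kst :: "'v \<Rightarrow> 'n cmat set" where
  "kst z = {X \<in> \<gg>. d\<rho> X z = 0}"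

text \<open>The infinitesimal boosts at \<open>z\<close>: the wedge of \<open>z\<close> with the
  velocity \<open>d\<rho> X z\<close>, so that the velocity determines the action.\<close>

definition sst :: "'v \<Rightarrow> 'n cmat set" where
  "sst z = {X \<in> \<gg>. \<forall>x\<in>V. d\<rho> X x = q (d\<rho> X z) x *\<^sub>R z - q z x *\<^sub>R d\<rho> X z}"

lemma subspace_kst: "subspace (kst z)"
  using subspace_g unfolding kst_def subspace_def by (auto simp: drho_simps)

lemma rotation:
  assumes "z \<in> H" "a \<in> V" "b \<in> V" "q a z = 0" "q b z = 0" "q a a = 1" "q b b = 1" "q a b = 0"
  shows "\<exists>X\<in>kst z. \<rho> (mexp X) a = cos t *\<^sub>R a + sin t *\<^sub>R b \<and>
      (\<forall>x\<in>V. q x a = 0 \<longrightarrow> q x b = 0 \<longrightarrow> \<rho> (mexp X) x = x)"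
proof -
  obtain X where X: "X \<in> \<gg>" "\<forall>x\<in>V. d\<rho> X x = q a x *\<^sub>R b - q b x *\<^sub>R a"
    using wedge[OF assms(3,2)] by auto
  have "d\<rho> X z = 0" using X(2) assms H_V[of z] by (simp add: q_sym[of a z] q_sym[of b z])
  then have Xk: "t *\<^sub>R X \<in> kst z"
    using X(1) subspace_g by (simp add: kst_def drho_simps subspace_scale)
  define c where "c t = cos t *\<^sub>R a + sin t *\<^sub>R b" for t :: real
  have cV: "c t \<in> V" for t using assms subspace_V by (simp add: c_def subspace_add subspace_scale)
  have "(c has_vector_derivative d\<rho> X (c t)) (at t)" for t
  proof -
    have "d\<rho> X (c t) = (- sin t) *\<^sub>R a + cos t *\<^sub>R b"
    proof -
      have "d\<rho> X a = b" "d\<rho> X b = - a" using X(2) assms q_sym[of b a] by simp_all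
      then show ?thesis by (simp add: c_def drho_simps)
    qed
    moreover have "(c has_vector_derivative (- sin t) *\<^sub>R a + cos t *\<^sub>R b) (at t)"
      unfolding c_def has_vector_derivative_def by (auto intro!: derivative_eq_intros simp: algebra_simps)
    ultimately show ?thesis by simp
  qed
  from flow_unique[OF X(1) cV this, of t] have 1: "\<rho> (mexp (t *\<^sub>R X)) a = cos t *\<^sub>R a + sin t *\<^sub>R b"
    by (simp add: c_def)
  have 2: "\<rho> (mexp (t *\<^sub>R X)) x = x" if "x \<in> V" "q x a = 0" "q x b = 0" for x
    using that X q_sym[of a x] q_sym[of b x] by (intro flow_fix) auto
  show ?thesis using Xk 1 2 by (intro bexI[of _ "t *\<^sub>R X"]) auto
qed

lemma boost:
  assumes "X \<in> sst z" "z \<in> H"  "d\<rho> X z = u" "q u u = 1"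
  shows "\<rho> (mexp (t *\<^sub>R X)) z = cosh t *\<^sub>R z + sinh t *\<^sub>R u"
proof -
  have X: "X \<in> \<gg>" "\<forall>x\<in>V. d\<rho> X x = q u x *\<^sub>R z - q z x *\<^sub>R u" using assms by (auto simp: sst_def)
  have zV: "z \<in> V" using assms by (simp add: H_V)
  have uV: "u \<in> V" using drho_V[OF X(1) zV] assms(3) by simp
  have uz: "q u z = 0"
    using drho_skew[OF X(1) zV zV] assms(3) q_sym[of z u] by simp
  define c where "c t = cosh t *\<^sub>R z + sinh t *\<^sub>R u" for t :: real
  have cV: "c t \<in> V" for t using uV zV subspace_V by (simp add: c_def subspace_add subspace_scale)
  have "(c has_vector_derivative d\<rho> X (c t)) (at t)" for t
  proof -
    have "d\<rho> X (c t) = sinh t *\<^sub>R z + cosh t *\<^sub>R u"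
    proof -
      have "d\<rho> X u = z" using X(2) uV assms uz q_sym[of z u] by simp
      then show ?thesis using assms(3) by (simp add: c_def drho_simps)
    qed
    moreover have "(c has_vector_derivative sinh t *\<^sub>R z + cosh t *\<^sub>R u) (at t)"
      unfolding c_def has_vector_derivative_def by (auto intro!: derivative_eq_intros simp: algebra_simps)
    ultimately show ?thesis by simp
  qed
  from flow_unique[OF X(1) cV this, of t] show ?thesis by (simp add: c_def)
qed

lemma sst_exists:
  assumes "z \<in> H" "u \<in> V" "q u z = 0"
  shows "\<exists>X\<in>sst z. d\<rho> X z = u"
proof -
  obtain X where X: "X \<in> \<gg>" "\<forall>x\<in>V. d\<rho> X x = q (- z) x *\<^sub>R u - q u x *\<^sub>R (- z)"
    using wedge[OF assms(2), of "-z"] assms subspace_V H_V subspace_neg by blast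
  have "d\<rho> X z = u" using X(2) assms H_V[of z] H_q[of z] by (simp add: q_simps)
  then show ?thesis using X by (intro bexI[of _ X]) (auto simp: sst_def q_simps)
qed

text \<open>A boost along the geodesic from \<open>p\<close> to \<open>z\<close>.\<close>

lemma G_transitive:
  assumes "p \<in> H" "z \<in> H"
  shows "\<exists>g\<in>G0. \<rho> g p = z"
proof (cases "z = p")
  case True
  then show ?thesis using G_one rho_one assms H_V by (intro bexI[of _ "mat 1"]) auto
next
  case False
  obtain e h where e: "e \<in> V" "q e e = 1" "q e p = 0" "q e 0 = 0" and
    z: "z = (- q z p) *\<^sub>R p + q z 0 *\<^sub>R 0 + h *\<^sub>R e" and "0 \<le> h"
    by (rule extend_frame[of p 0 z]) (use assms H_V subspace_V in \<open>auto simp: q_simps subspace_0\<close>)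
  from z have z': "z = (- q z p) *\<^sub>R p + h *\<^sub>R e" by simp
  obtain t where t: "z = cosh t *\<^sub>R p + sinh t *\<^sub>R e"
    using H_ray[OF assms(2,1) e(3,2) z'] by blast
  obtain X where X: "X \<in> sst p" "d\<rho> X p = e" using sst_exists[OF assms(1) e(1,3)] by blast
  have "\<rho> (mexp (t *\<^sub>R X)) p = z" using boost[OF X(1) assms(1) X(2) e(2)] t by simp
  moreover have "mexp (t *\<^sub>R X) \<in> G0" using X by (intro exp_G) (simp add: sst_def)
  ultimately show ?thesis by blast
qed

text \<open>Vectors that are neither equal nor opposite are rotated in their own plane, which is
  orthogonal to \<open>F\<close>. Opposite vectors span no plane, so a further direction orthogonal
  to everything that must stay fixed is demanded; its absence is the orientation
  obstruction.\<close>

lemma rotate_to: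
  assumes z: "z \<in> H" and a: "a \<in> V" "q a z = 0" "q a a = 1" and b: "b \<in> V" "q b z = 0" "q b b = 1"
    and F: "\<And>x. x \<in> F \<Longrightarrow> x \<in> V \<and> q x a = 0 \<and> q x b = 0"
    and c: "b = - a \<Longrightarrow> \<exists>c\<in>V. q c c = 1 \<and> q c z = 0 \<and> q c a = 0 \<and> (\<forall>x\<in>F. q x c = 0)"
  shows "\<exists>X\<in>kst z. \<rho> (mexp X) a = b \<and> (\<forall>x\<in>F. \<rho> (mexp X) x = x)"
proof -
  consider "b = a" | "b = - a" | "b \<noteq> a" "b \<noteq> - a" by blast
  then show ?thesis
  proof cases
    case 1
    have "0 \<in> kst z" by (rule subspace_0[OF subspace_kst])
    then show ?thesis using 1 a F rho_one by (intro bexI[of _ 0]) auto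
  next
    case 2
    then obtain c where c: "c \<in> V" "q c c = 1" "q c z = 0" "q c a = 0" "\<forall>x\<in>F. q x c = 0" using c by blast
    have "q a c = 0" using c(4) q_sym[of a c] by simp
    from rotation[OF z a(1) c(1) a(2) c(3) a(3) c(2) this, of pi] 2 F c(5)
    show ?thesis by auto
  next
    case 3
    define k where "k = q a b"
    have k: "k\<^sup>2 < 1" unfolding k_def by (rule q_unit_abs_lt[OF z a(2) b(2) a(3) b(3) 3])
    then have "\<bar>k\<bar> < 1" by (simp add: abs_square_less_1)
    define t where "t = arccos k"
    have t: "cos t = k" "sin t = sqrt (1 - k\<^sup>2)" using \<open>\<bar>k\<bar> < 1\<close> by (auto simp: t_def sin_arccos)
    define s where "s = sqrt (1 - k\<^sup>2)"
    have s: "s > 0" "s\<^sup>2 = 1 - k\<^sup>2" using k by (auto simp: s_def)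
    define e where "e = (1 / s) *\<^sub>R (b - k *\<^sub>R a)"
    have b': "b = k *\<^sub>R a + s *\<^sub>R e" using s by (simp add: e_def)
    have eV: "e \<in> V" using a b subspace_V by (simp add: e_def subspace_diff subspace_scale)
    have ez: "q e z = 0" using a b by (simp add: e_def q_simps)
    have ae: "q a e = 0" using a by (simp add: e_def q_simps k_def)
    have ee: "q e e = 1" unfolding e_def using a b s by (intro unit_component) (auto simp: k_def)
    have Fe: "q x e = 0" if "x \<in> F" for x using F[OF that] by (simp add: e_def q_simps)
    from rotation[OF z a(1) eV a(2) ez a(3) ee ae, of t] t b' F Fe
    show ?thesis by (auto simp: s_def)
  qed
qed

end

section \<open>Orthonormal frames, volume forms and transitivity on unit vectors\<close>

lemma alt3_skew':
  assumes a: "alt3 \<omega>" shows "\<omega> y x z = - \<omega> x y z"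
proof -
  have "\<omega> (x + y) (x + y) z = \<omega> x x z + \<omega> y x z + (\<omega> x y z + \<omega> y y z)"
    by (simp only: alt3_simps(4)[OF a] alt3_simps(5)[OF a])
  then show ?thesis by (simp add: alt3_simps(1)[OF a])
qed

lemma dim_three:
  fixes X1 X2 X3 :: "'a::euclidean_space"
  assumes "X1 \<noteq> 0"
  shows "dim {X1, X2, X3} =
    1 + (if X2 \<in> span {X1} then 0 else 1) + (if X3 \<in> span {X1, X2} then 0 else 1)"
proof -
  have "{X1, X2, X3} = insert X3 {X1, X2}" "{X1, X2} = insert X2 {X1}" by auto
  then have "dim {X1, X2, X3} = (if X3 \<in> span {X1, X2} then dim {X1, X2} else dim {X1, X2} + 1)"
    "dim {X1, X2} = (if X2 \<in> span {X1} then dim {X1} else dim {X1} + 1)"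
    by (metis dim_insert)+
  moreover have "dim {X1} = 1" using assms by (simp add: dim_insert)
  ultimately show ?thesis by simp
qed

lemma span_3D:
  assumes "x \<in> span {a, b, c}"
  obtains \<alpha> \<beta> \<gamma> where "x = \<alpha> *\<^sub>R a + \<beta> *\<^sub>R b + \<gamma> *\<^sub>R c"
  using assms by (auto simp: span_insert span_singleton algebra_simps)

context lorentz_space
begin

lemma dim_frame:
  assumes "z \<in> H" "q e e = 1" "q f f = 1" "q e z = 0" "q f z = 0" "q f e = 0"
  shows "dim {z, e, f} = 3"
proof -
  have zz: "q z z = -1" using assms by (simp add: H_def)
  have "z \<noteq> 0" using zz by (auto simp: q_simps)
  moreover have "e \<notin> span {z}"
  proof
    assume "e \<in> span {z}"
    then obtain k where "e = k *\<^sub>R z" by (auto simp: span_singleton)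
    then have "q e e = k * q e z" by (simp add: q_simps)
    then show False using assms by simp
  qed
  moreover have "f \<notin> span {z, e}"
  proof
    assume "f \<in> span {z, e}"
    then obtain k l where "f = k *\<^sub>R z + l *\<^sub>R e" by (auto simp: span_insert span_singleton algebra_simps)
    then have "q f f = k * q f z + l * q f e" by (simp add: q_simps)
    then show False using assms by simp
  qed
  ultimately show ?thesis by (simp add: dim_three)
qed

lemma span_frame:
  assumes "dim V = 3" "z \<in> H" "e \<in> V" "f \<in> V" "q e e = 1" "q f f = 1" "q e z = 0" "q f z = 0" "q f e = 0"
  shows "V = span {z, e, f}"
proof -
  have "dim (span {z, e, f}) = 3" using dim_frame[OF assms(2,5-9)] by simp
  moreover have "span {z, e, f} \<subseteq> V" using assms subspace_V by (intro span_minimal) (auto simp: H_def)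
  ultimately show ?thesis using subspace_dim_equal[of "span {z, e, f}" V] subspace_V assms(1) by auto
qed

text \<open>In dimension 3 the frame spans \<open>V\<close>, so a volume form vanishing on it would
  vanish everywhere.\<close>

lemma alt3_frame_nonzero:
  assumes fr: "dim V = 3" "z \<in> H" "e \<in> V" "f \<in> V" "q e e = 1" "q f f = 1" "q e z = 0" "q f z = 0" "q f e = 0"
    and \<omega>: "alt3 \<omega>" and nz: "\<exists>x\<in>V. \<exists>y\<in>V. \<exists>t\<in>V. \<omega> x y t \<noteq> 0"
  shows "\<omega> z e f \<noteq> 0"
proof
  assume 0: "\<omega> z e f = 0"
  obtain x y t where xyt: "x \<in> V" "y \<in> V" "t \<in> V" "\<omega> x y t \<noteq> 0" using nz by blast
  note sp = span_frame[OF fr]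
  obtain x1 x2 x3 where x: "x = x1 *\<^sub>R z + x2 *\<^sub>R e + x3 *\<^sub>R f" using xyt(1) sp span_3D by blast
  obtain y1 y2 y3 where y: "y = y1 *\<^sub>R z + y2 *\<^sub>R e + y3 *\<^sub>R f" using xyt(2) sp span_3D by blast
  obtain t1 t2 t3 where t: "t = t1 *\<^sub>R z + t2 *\<^sub>R e + t3 *\<^sub>R f" using xyt(3) sp span_3D by blast
  have p: "\<omega> z f e = 0" "\<omega> e z f = 0" "\<omega> f z e = 0" "\<omega> e f z = 0" "\<omega> f e z = 0"
    using 0 alt3_skew[OF \<omega>, of z f e] alt3_skew'[OF \<omega>, of e z f] alt3_skew'[OF \<omega>, of f z e]
      alt3_skew[OF \<omega>, of e f z] alt3_skew[OF \<omega>, of f e z] by simp_all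
  have "\<omega> x y t = 0" unfolding x y t by (simp add: alt3_simps[OF \<omega>] p 0)
  then show False using xyt by simp
qed

lemma exists_H_orthogonal:
  assumes "a \<in> V" "q a a = 1"
  obtains z where "z \<in> H" "q a z = 0"
proof -
  \<comment> \<open>The part of \<open>b0\<close> orthogonal to \<open>a\<close>; removing a
    spacelike component leaves it timelike.\<close>
  define y where "y = b0 - q b0 a *\<^sub>R a"
  have b: "q b0 b0 = -1" by (simp add: q_def)
  have yy: "q y y = -1 - (q b0 a)\<^sup>2" and yb: "q y b0 = -1 - (q b0 a)\<^sup>2"
    using assms b by (simp_all add: y_def q_simps q_sym[of a b0] power2_eq_square)
  have ya: "q a y = 0" using assms by (simp add: y_def q_simps q_sym[of a b0])
  have neg: "-1 - (q b0 a)\<^sup>2 < 0" by (smt (verit) zero_le_power2)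
  have "y \<in> V" using assms b0 subspace_V by (simp add: y_def subspace_diff subspace_scale)
  then have "(1 / sqrt (- q y y)) *\<^sub>R y \<in> H"
    using b0_H neg yy yb by (intro H_normalize[of y b0]) auto
  then show ?thesis by (rule that) (use ya in \<open>simp add: q_simps\<close>)
qed

end

context lorentz_rep
begin

text \<open>Every unit spacelike vector is tangent to \<open>H\<close> at some point: first the
  points are matched, then the directions by a rotation in the stabilizer.\<close>

lemma G_transitive_unit:
  assumes a: "a \<in> V" "q a a = 1" and b: "b \<in> V" "q b b = 1"
  shows "\<exists>g\<in>G0. \<rho> g a = b"
proof -
  obtain z where z: "z \<in> H" "q a z = 0" by (rule exists_H_orthogonal[OF a])
  obtain w where w: "w \<in> H" "q b w = 0" by (rule exists_H_orthogonal[OF b])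
  obtain g where g: "g \<in> G0" "\<rho> g z = w" using G_transitive[OF z(1) w(1)] by blast
  have a': "\<rho> g a \<in> V" "q (\<rho> g a) w = 0" "q (\<rho> g a) (\<rho> g a) = 1"
    using rho_V[OF g(1) a(1)] rho_q[OF g(1) a(1) a(1)] rho_q[OF g(1) a(1) H_V[OF z(1)]] g(2) z a by auto
  have "\<exists>X\<in>kst w. \<rho> (mexp X) (\<rho> g a) = b \<and> (\<forall>x\<in>{}. \<rho> (mexp X) x = x)"
  proof (rule rotate_to[OF w(1) a' b(1) w(2) b(2)])
    obtain c where "c \<in> V" "q c c = 1" "q c w = 0" "q c (\<rho> g a) = 0"
      by (rule exists_q_orthogonal2[of w "\<rho> g a"]) (use a' H_V[OF w(1)] H_q[OF w(1)] in auto)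
    then show "\<exists>c\<in>V. q c c = 1 \<and> q c w = 0 \<and> q c (\<rho> g a) = 0 \<and> (\<forall>x\<in>{}. q x c = 0)" by blast
  qed auto
  then obtain X where X: "X \<in> kst w" "\<rho> (mexp X) (\<rho> g a) = b" by blast
  have "mexp X \<in> G0" using X by (intro exp_G1) (simp add: kst_def)
  then show ?thesis using X(2) g(1) a(1) rho_mult[of "mexp X" g a] by (intro bexI[of _ "mexp X ** g"]) (auto simp: G_mult)
qed

text \<open>Reflections in unit spacelike vectors are conjugate under the group, so excluding one
  excludes all.\<close>

lemma not_reflection:
  assumes a: "a \<in> V" "q a a = 1" and g: "g \<in> G0" "\<forall>x\<in>V. \<rho> g x = x - (2 * q a x) *\<^sub>R a"
  shows False
proof -
  obtain b where b: "b \<in> V" "q b b = 1" "\<not> (\<exists>g\<in>G0. \<forall>x\<in>V. \<rho> g x = x - (2 * q b x) *\<^sub>R b)"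
    using no_reflection by blast
  obtain h where h: "h \<in> G0" "\<rho> h b = a" using G_transitive_unit[OF b(1,2) a] by blast
  have G: "matrix_inv h ** (g ** h) \<in> G0" using h g by (simp add: G_mult G_inv)
  have "\<rho> (matrix_inv h ** (g ** h)) x = x - (2 * q b x) *\<^sub>R b" if x: "x \<in> V" for x
  proof -
    have lin: "linear (\<rho> (matrix_inv h))" using h by (simp add: rho_linear G_inv)
    have "\<rho> (matrix_inv h ** (g ** h)) x = \<rho> (matrix_inv h) (\<rho> g (\<rho> h x))"
      using x h g by (simp add: rho_mult G_mult G_inv)
    also have "\<rho> g (\<rho> h x) = \<rho> h x - (2 * q b x) *\<^sub>R \<rho> h b"
      using g(2) rho_V[OF h(1) x] rho_q[OF h(1) b(1) x] h(2) by simp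
    also have "\<rho> (matrix_inv h) \<dots> = x - (2 * q b x) *\<^sub>R b"
      using lin rho_inv(1)[OF h(1)] x b(1) by (simp add: linear_diff linear_scale)
    finally show ?thesis .
  qed
  then show False using b(3) G by blast
qed

section \<open>Point stabilizers are generated by exponentials\<close>

lemma analytic_kst_stabilizes:
  assumes "z \<in> H" shows "analytic_subgroup (kst z) \<subseteq> {g \<in> G0. \<rho> g z = z}"
proof (rule analytic_subgroup_minimal)
  note zV = H_V[OF assms]
  show "mat 1 \<in> {g \<in> G0. \<rho> g z = z}" using G_one rho_one zV by simp
  show "mexp X \<in> {g \<in> G0. \<rho> g z = z}" if "X \<in> kst z" for X
    using that flow_fix[of X z 1] zV exp_G1 by (simp add: kst_def)
  show "a ** b \<in> {g \<in> G0. \<rho> g z = z}" if "a \<in> {g \<in> G0. \<rho> g z = z}" "b \<in> {g \<in> G0. \<rho> g z = z}" for a b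
    using that zV by (simp add: G_mult rho_mult)
  show "matrix_inv a \<in> {g \<in> G0. \<rho> g z = z}" if "a \<in> {g \<in> G0. \<rho> g z = z}" for a
    using that zV rho_inv(1)[of a z] by (simp add: G_inv)
qed

text \<open>Among the products of elements of the analytic subgroup with \<open>g\<close>, take one
  with the largest fixed space. If it moved a unit vector orthogonal to that space, a rotation
  bringing the image back would enlarge the space; such a rotation is missing only if the element is
  a reflection. So it acts trivially, and the kernel consists of exponentials from the stabilizer
  algebra.\<close>

lemma stabilizer_eq:
  assumes z: "z \<in> H" shows "analytic_subgroup (kst z) = {g \<in> G0. \<rho> g z = z}"
proof
  show "analytic_subgroup (kst z) \<subseteq> {g \<in> G0. \<rho> g z = z}" by (rule analytic_kst_stabilizes[OF z])
  note zV = H_V[OF z]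
  let ?K = "analytic_subgroup (kst z)"
  show "{g \<in> G0. \<rho> g z = z} \<subseteq> ?K"
  proof
    fix g assume "g \<in> {g \<in> G0. \<rho> g z = z}"
    then have g: "g \<in> G0" "\<rho> g z = z" by auto
    define P where "P h \<longleftrightarrow> (\<exists>k\<in>?K. h = k ** g)" for h
    define Fix where "Fix h = {x \<in> V. \<rho> h x = x}" for h
    have PG: "h \<in> G0" "\<rho> h z = z" if "P h" for h
      using that g analytic_kst_stabilizes[OF z] zV unfolding P_def by (auto simp: G_mult rho_mult)
    have subF: "subspace (Fix h)" if "h \<in> G0" for h
      using rho_linear[OF that] subspace_V unfolding Fix_def subspace_def
      by (auto simp: linear_0 linear_add linear_scale)
    have "P g" unfolding P_def using analytic_subgroup_props(1) by (intro bexI[of _ "mat 1"]) auto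
    moreover have "\<forall>h. P h \<longrightarrow> dim (Fix h) < dim V + 1"
      by (auto simp: Fix_def less_Suc_eq_le intro!: dim_subset)
    ultimately obtain h where h: "P h" "\<And>h'. P h' \<Longrightarrow> dim (Fix h') \<le> dim (Fix h)"
      using ex_has_greatest_nat[of P g "\<lambda>h. dim (Fix h)" "dim V + 1"] by blast
    have "Fix h = V"
    proof (rule ccontr)
      assume ne: "Fix h \<noteq> V"
      note hG = PG[OF h(1)]
      have zF: "z \<in> Fix h" using hG zV by (simp add: Fix_def)
      obtain x where x: "x \<in> V" "q x x = 1" "\<forall>y\<in>Fix h. q x y = 0"
        by (rule exists_q_orthogonal[of "Fix h" z]) (use subF hG ne zF H_q[OF z] in \<open>auto simp: Fix_def\<close>)
      define y where "y = \<rho> h x"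
      have y: "y \<in> V" "q y z = 0" "q y y = 1" "\<forall>v\<in>Fix h. q v y = 0"
      proof -
        show yF: "\<forall>v\<in>Fix h. q v y = 0"
        proof
          fix v assume v: "v \<in> Fix h"
          then have "q v y = q (\<rho> h v) (\<rho> h x)" by (simp add: Fix_def y_def)
          also have "\<dots> = q v x" using v x hG by (intro rho_q) (auto simp: Fix_def)
          finally show "q v y = 0" using x(3) v q_sym[of v x] by simp
        qed
        show "y \<in> V" "q y y = 1" using x hG by (auto simp: y_def rho_V rho_q)
        show "q y z = 0" using yF zF q_sym[of y z] by auto
      qed
      have xF: "x \<notin> Fix h" using x(2,3) by auto
      have "\<exists>X\<in>kst z. \<rho> (mexp X) y = x \<and> (\<forall>v\<in>Fix h. \<rho> (mexp X) v = v)"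
      proof (rule rotate_to[OF z y(1-3) x(1) _ x(2)])
        show "q x z = 0" using x(3) zF by blast
        show "v \<in> V \<and> q v y = 0 \<and> q v x = 0" if "v \<in> Fix h" for v
          using that x(3) y(4) q_sym[of v x] by (auto simp: Fix_def)
        assume xy: "x = - y"
        define F' where "F' = span (insert x (Fix h))"
        have F'V: "F' \<subseteq> V" unfolding F'_def using x(1) subspace_V by (intro span_minimal) (auto simp: Fix_def)
        \<comment> \<open>If \<open>x\<close> and the fixed space filled \<open>V\<close>, then
          \<open>h\<close> would be the reflection in \<open>x\<close>. Otherwise a direction
          orthogonal to both is free for a half turn.\<close>
        have "F' \<noteq> V"
        proof
          assume FV: "F' = V"
          have "\<rho> h v = v - (2 * q x v) *\<^sub>R x" if "v \<in> V" for v
          proof -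
            have "v \<in> span (insert x (Fix h))" using that FV by (simp add: F'_def)
            then obtain k where "v - k *\<^sub>R x \<in> span (Fix h)" by (auto simp: span_insert)
            then have k: "v - k *\<^sub>R x \<in> Fix h" using subF[OF hG(1)] by (simp add: span_eq_iff[THEN iffD2])
            have "q x (v - k *\<^sub>R x) = 0" using x(3) k by blast
            then have kq: "k = q x v" using x(2) by (simp add: q_simps)
            have "\<rho> h (v - k *\<^sub>R x) = v - k *\<^sub>R x" using k by (simp add: Fix_def)
            then have "\<rho> h v = v - k *\<^sub>R x + k *\<^sub>R y"
              using rho_linear[OF hG(1)] by (simp add: linear_diff linear_scale y_def algebra_simps)
            also have "y = - x" using xy by simp
            finally show ?thesis by (simp add: kq scaleR_2[symmetric] algebra_simps flip: scaleR_scaleR)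
          qed
          then show False using not_reflection[OF x(1,2) hG(1)] by blast
        qed
        then obtain c where c: "c \<in> V" "q c c = 1" "\<forall>v\<in>F'. q c v = 0"
          using exists_q_orthogonal[of F' z] F'V zF H_q[OF z] unfolding F'_def
          by (metis insertI2 neg_less_0_iff_less span_base subspace_span zero_less_one)
        have "z \<in> F'" "x \<in> F'" "Fix h \<subseteq> F'" using zF by (auto simp: F'_def intro: span_base)
        then have "q c z = 0" "q c x = 0" "\<forall>v\<in>Fix h. q v c = 0"
          using c(3) by (blast, blast, metis q_sym subsetD)
        then show "\<exists>c\<in>V. q c c = 1 \<and> q c z = 0 \<and> q c y = 0 \<and> (\<forall>x\<in>Fix h. q x c = 0)"
          using c(1,2) xy by (intro bexI[of _ c]) (auto simp: q_simps)
      qed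
      then obtain X where X: "X \<in> kst z" "\<rho> (mexp X) y = x" "\<forall>v\<in>Fix h. \<rho> (mexp X) v = v" by blast
      have XG: "mexp X \<in> G0" using X by (intro exp_G1) (simp add: kst_def)
      have "P (mexp X ** h)"
        using h(1) analytic_subgroup_props(2)[OF X(1)] analytic_subgroup_props(3)
        unfolding P_def by (metis matrix_mul_assoc)
      then have "dim (Fix (mexp X ** h)) \<le> dim (Fix h)" by (rule h)
      moreover have "insert x (Fix h) \<subseteq> Fix (mexp X ** h)"
        using X x XG hG by (auto simp: Fix_def rho_mult y_def)
      then have "dim (insert x (Fix h)) \<le> dim (Fix (mexp X ** h))" by (rule dim_subset)
      moreover have "dim (insert x (Fix h)) = dim (Fix h) + 1"
        using xF subF[OF hG(1)] by (simp add: dim_insert span_eq_iff[THEN iffD2])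
      ultimately show False by simp
    qed
    then have "\<rho> h x = x" if "x \<in> V" for x using that by (auto simp: Fix_def)
    then obtain X where X: "X \<in> \<gg>" "d\<rho> X z = 0" "h = mexp X" using rho_kernel[of h z] PG[OF h(1)] z by blast
    then have hK: "h \<in> ?K" using analytic_subgroup_props(2)[of X] by (simp add: kst_def)
    obtain k where k: "k \<in> ?K" "h = k ** g" using h(1) unfolding P_def by blast
    then have "k \<in> G0" using analytic_kst_stabilizes[OF z] by auto
    then have "g = matrix_inv k ** h" using k(2) by (simp add: matrix_mul_assoc G_inv_left)
    then show "g \<in> ?K" using hK k(1) analytic_subgroup_props(3,4) by blast
  qed
qed

end

section \<open>Matching frames and moving triangles by group elements\<close>

context lorentz_rep
begin

definition inv_alt3 :: "('v \<Rightarrow> 'v \<Rightarrow> 'v \<Rightarrow> real) \<Rightarrow> bool" where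
  "inv_alt3 \<omega> \<longleftrightarrow> alt3 \<omega> \<and> (\<forall>g\<in>G0. \<forall>x\<in>V. \<forall>y\<in>V. \<forall>z\<in>V. \<omega> (\<rho> g x) (\<rho> g y) (\<rho> g z) = \<omega> x y z)"

lemma rho_exp_mult_V:
  "X \<in> kst z \<Longrightarrow> g \<in> G0 \<Longrightarrow> mexp X ** g \<in> G0" "X \<in> kst z \<Longrightarrow> g \<in> G0 \<Longrightarrow> x \<in> V \<Longrightarrow> \<rho> (mexp X ** g) x = \<rho> (mexp X) (\<rho> g x)"
  by (auto simp: kst_def G_mult rho_mult exp_G1)

lemma kst_fix: "X \<in> kst z \<Longrightarrow> z \<in> H \<Longrightarrow> \<rho> (mexp X) z = z"
  using flow_fix[of X z 1] by (simp add: kst_def H_V)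

text \<open>The frame is matched vector by vector: the point, then \<open>n1\<close> by a rotation
  at \<open>w\<close>, then the part of the image of \<open>n2\<close> orthogonal to
  \<open>m1\<close> by a rotation fixing \<open>m1\<close>. Only the last can fail, when that part
  must become its negative and no further direction exists; this occurs in dimension 3 alone, and
  equal orientations exclude it.\<close>

lemma frame_transitive:
  assumes p: "p \<in> H" and w: "w \<in> H"
    and n: "n1 \<in> V" "n2 \<in> V" "q n1 p = 0" "q n2 p = 0" "q n1 n1 = 1" "q n2 n2 = 1" "q n1 n2 = c"
    and m: "m1 \<in> V" "m2 \<in> V" "q m1 w = 0" "q m2 w = 0" "q m1 m1 = 1" "q m2 m2 = 1" "q m1 m2 = c"
    and c: "c\<^sup>2 < 1" and or: "dim V = 3 \<Longrightarrow> \<exists>\<omega>. inv_alt3 \<omega> \<and> \<omega> p n1 n2 * \<omega> w m1 m2 > 0"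
  shows "\<exists>g\<in>G0. \<rho> g p = w \<and> \<rho> g n1 = m1 \<and> \<rho> g n2 = m2"
proof -
  obtain g where g: "g \<in> G0" "\<rho> g p = w" using G_transitive[OF p w] by blast
  have a': "\<rho> g n1 \<in> V" "q (\<rho> g n1) w = 0" "q (\<rho> g n1) (\<rho> g n1) = 1"
    using rho_V[OF g(1) n(1)] rho_q[OF g(1) n(1) n(1)] rho_q[OF g(1) n(1) H_V[OF p]] g(2) n by auto
  have "\<exists>X\<in>kst w. \<rho> (mexp X) (\<rho> g n1) = m1 \<and> (\<forall>x\<in>{}. \<rho> (mexp X) x = x)"
  proof (rule rotate_to[OF w a' m(1,3,5)])
    obtain c where "c \<in> V" "q c c = 1" "q c w = 0" "q c (\<rho> g n1) = 0"
      by (rule exists_q_orthogonal2[of w "\<rho> g n1"]) (use a' H_V[OF w] H_q[OF w] in auto)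
    then show "\<exists>c\<in>V. q c c = 1 \<and> q c w = 0 \<and> q c (\<rho> g n1) = 0 \<and> (\<forall>x\<in>{}. q x c = 0)" by blast
  qed auto
  then obtain X where X: "X \<in> kst w" "\<rho> (mexp X) (\<rho> g n1) = m1" by blast
  define h where "h = mexp X ** g"
  have h: "h \<in> G0" "\<rho> h p = w" "\<rho> h n1 = m1"
    using X g H_V[OF p] n kst_fix[OF X(1) w] by (auto simp: h_def rho_exp_mult_V)
  define k where "k = \<rho> h n2"
  have k: "k \<in> V" "q k w = 0" "q k k = 1" "q m1 k = c"
    using rho_V[OF h(1) n(2)] rho_q[OF h(1) n(2) H_V[OF p]] rho_q[OF h(1) n(2) n(2)] rho_q[OF h(1) n(1) n(2)] h n
    by (auto simp: k_def)
  define s where "s = sqrt (1 - c\<^sup>2)"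
  have s: "s > 0" "s\<^sup>2 = 1 - c\<^sup>2" using c by (auto simp: s_def)
  define a where "a = (1 / s) *\<^sub>R (k - c *\<^sub>R m1)"
  define b where "b = (1 / s) *\<^sub>R (m2 - c *\<^sub>R m1)"
  have ka: "k = c *\<^sub>R m1 + s *\<^sub>R a" and mb: "m2 = c *\<^sub>R m1 + s *\<^sub>R b" using s by (auto simp: a_def b_def)
  have a: "a \<in> V" "q a w = 0" "q a a = 1" "q m1 a = 0"
    using unit_component[OF k(3) m(5) k(4) s] k m subspace_V by (auto simp: a_def q_simps subspace_diff subspace_scale)
  have b: "b \<in> V" "q b w = 0" "q b b = 1" "q m1 b = 0"
    using unit_component[OF m(6,5,7) s] m subspace_V by (auto simp: b_def q_simps subspace_diff subspace_scale)
  have "\<exists>Y\<in>kst w. \<rho> (mexp Y) a = b \<and> (\<forall>x\<in>{m1}. \<rho> (mexp Y) x = x)"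
  proof (rule rotate_to[OF w a(1-3) b(1-3)])
    show "x \<in> V \<and> q x a = 0 \<and> q x b = 0" if "x \<in> {m1}" for x using that a b m by auto
    assume ba: "b = - a"
    show "\<exists>c\<in>V. q c c = 1 \<and> q c w = 0 \<and> q c a = 0 \<and> (\<forall>x\<in>{m1}. q x c = 0)"
    proof (cases "dim V = 3")
      case True
      then obtain \<omega> where \<omega>: "inv_alt3 \<omega>" "\<omega> p n1 n2 * \<omega> w m1 m2 > 0" using or by blast
      then have al: "alt3 \<omega>" by (simp add: inv_alt3_def)
      have "\<omega> p n1 n2 = \<omega> w m1 k"
        using \<omega>(1) h n H_V[OF p] unfolding inv_alt3_def k_def by metis
      also have "\<dots> = s * \<omega> w m1 a" unfolding ka by (simp add: alt3_simps[OF al])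
      finally have "\<omega> p n1 n2 = s * \<omega> w m1 a" .
      moreover have "\<omega> w m1 m2 = - (s * \<omega> w m1 a)" unfolding mb ba by (simp add: alt3_simps[OF al])
      ultimately have "\<omega> p n1 n2 * \<omega> w m1 m2 = - (s * \<omega> w m1 a)\<^sup>2" by (simp add: power2_eq_square)
      then show ?thesis using \<omega>(2) zero_le_power2[of "s * \<omega> w m1 a"] by linarith
    next
      case False
      have "dim (span {w, m1, a}) \<le> card {w, m1, a}" by (simp add: dim_le_card')
      also have "\<dots> \<le> 3" by (simp add: card_insert_if)
      finally have ne: "span {w, m1, a} \<noteq> V" using False dim_V by auto
      have "span {w, m1, a} \<subseteq> V" using H_V[OF w] m a subspace_V by (simp add: span_minimal)
      then obtain c where c: "c \<in> V" "q c c = 1" "\<forall>v\<in>span {w, m1, a}. q c v = 0"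
        by (rule exists_q_orthogonal[OF subspace_span _ ne, of w]) (use H_q[OF w] in \<open>auto intro: span_base\<close>)
      then show ?thesis
        by (intro bexI[of _ c]) (auto simp: span_base q_sym[of m1 c])
    qed
  qed
  then obtain Y where Y: "Y \<in> kst w" "\<rho> (mexp Y) a = b" "\<rho> (mexp Y) m1 = m1" by auto
  have YG: "mexp Y \<in> G0" using Y by (simp add: kst_def exp_G1)
  have "\<rho> (mexp Y) k = m2"
    unfolding ka mb using Y rho_linear[OF YG] by (simp add: linear_add linear_scale)
  then show ?thesis
    using h Y n H_V[OF p] kst_fix[OF Y(1) w] rho_exp_mult_V[OF Y(1) h(1)]
    by (intro bexI[of _ "mexp Y ** h"]) (auto simp: k_def)
qed

lemma triangle_move:
  assumes z: "z1 \<in> H" "z2 \<in> H" "z3 \<in> H" and w: "w \<in> H"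
    and u: "u1 \<in> V" "u2 \<in> V" "q u1 u1 = 1" "q u2 u2 = 1" "q u3 u3 = 1" "q u1 w = 0" "q u2 w = 0"
    and c: "(q u1 u2)\<^sup>2 < 1" and u3: "u3 = x *\<^sub>R u1 + y *\<^sub>R u2"
  shows "\<exists>g\<in>G0. (\<exists>t. \<rho> g z1 = cosh t *\<^sub>R w + sinh t *\<^sub>R u1) \<and> (\<exists>t. \<rho> g z2 = cosh t *\<^sub>R w + sinh t *\<^sub>R u2) \<and>
         (\<exists>t. \<rho> g z3 = cosh t *\<^sub>R w + sinh t *\<^sub>R u3)"
proof -
  obtain m1 m2 e f where m: "m1 \<in> V" "m2 \<in> V" "q m1 w = 0" "q m2 w = 0" "q m1 m1 = 1" "q m2 m2 = 1"
    "(q m1 m2)\<^sup>2 < 1" and ef: "e \<in> V" "f \<in> V" "q e e = 1" "q f f = 1" "q z1 e = 0" "q z1 f = 0" "q e f = 0"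
    and pl: "\<forall>\<sigma>. \<sigma> = 1 \<or> \<sigma> = -1 \<longrightarrow> placing z1 z2 z3 w u1 u2 u3 m1 m2 e f \<sigma>"
    by (rule triangle_placement[OF z w u c u3])
  \<comment> \<open>\<sigma> is chosen so that the frame of normals and the target frame have the
    same orientation; outside dimension 3 either sign will do.\<close>
  have "\<exists>\<sigma>::real. (\<sigma> = 1 \<or> \<sigma> = -1) \<and> (dim V = 3 \<longrightarrow> (\<exists>\<omega>. inv_alt3 \<omega> \<and> \<sigma> * (\<omega> z1 e f * \<omega> w m1 m2) > 0))"
  proof (cases "dim V = 3")
    case True
    then obtain \<omega> where \<omega>: "inv_alt3 \<omega>" "\<exists>x\<in>V. \<exists>y\<in>V. \<exists>z\<in>V. \<omega> x y z \<noteq> 0"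
      using orientation unfolding inv_alt3_def by blast
    then have al: "alt3 \<omega>" by (simp add: inv_alt3_def)
    have 1: "\<omega> z1 e f \<noteq> 0"
      by (rule alt3_frame_nonzero[OF True z(1) _ _ _ _ _ _ _ al \<omega>(2)])
        (use ef q_sym[of z1 e] q_sym[of z1 f] q_sym[of e f] in auto)
    define k where "k = q m1 m2"
    define s where "s = sqrt (1 - k\<^sup>2)"
    have s: "s > 0" "s\<^sup>2 = 1 - k\<^sup>2" using m(7) by (auto simp: s_def k_def)
    define b where "b = (1 / s) *\<^sub>R (m2 - k *\<^sub>R m1)"
    have mb: "m2 = k *\<^sub>R m1 + s *\<^sub>R b" using s by (auto simp: b_def)
    have bb: "q b b = 1" unfolding b_def
      by (rule unit_component[OF m(6,5) _ s]) (simp add: k_def)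
    have b: "b \<in> V" "q b w = 0" "q b m1 = 0"
      using m subspace_V q_sym[of m2 m1] by (auto simp: b_def q_simps subspace_diff subspace_scale k_def)
    have "\<omega> w m1 b \<noteq> 0"
      by (rule alt3_frame_nonzero[OF True w _ _ _ _ _ _ _ al \<omega>(2)]) (use m b bb in auto)
    moreover have "\<omega> w m1 m2 = s * \<omega> w m1 b" unfolding mb by (simp add: alt3_simps[OF al])
    ultimately have "\<omega> z1 e f * \<omega> w m1 m2 \<noteq> 0" using 1 s by simp
    then consider "1 * (\<omega> z1 e f * \<omega> w m1 m2) > 0" | "(-1) * (\<omega> z1 e f * \<omega> w m1 m2) > 0" by linarith
    then show ?thesis using \<omega>(1) by cases blast+
  qed auto
  then obtain \<sigma> :: real where \<sigma>: "\<sigma> = 1 \<or> \<sigma> = -1" "dim V = 3 \<longrightarrow> (\<exists>\<omega>. inv_alt3 \<omega> \<and> \<sigma> * (\<omega> z1 e f * \<omega> w m1 m2) > 0)"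
    by blast
  obtain n1 n2 p \<kappa> where n: "n1 \<in> V" "n2 \<in> V" "p \<in> H" "q n1 n1 = 1" "q n2 n2 = 1"
       "q n1 n2 = q m1 m2" "q n1 p = 0" "q n2 p = 0" "\<kappa> > 0"
       "\<forall>\<omega>. alt3 \<omega> \<longrightarrow> \<omega> p n1 n2 = \<kappa> * \<sigma> * \<omega> z1 e f" and
    r: "\<forall>r. linear r \<longrightarrow> (\<forall>a\<in>V. \<forall>b\<in>V. q (r a) (r b) = q a b) \<longrightarrow> r ` H \<subseteq> H \<longrightarrow> r p = w \<longrightarrow> r n1 = m1 \<longrightarrow> r n2 = m2 \<longrightarrow>
         (\<exists>t. r z1 = cosh t *\<^sub>R w + sinh t *\<^sub>R u1) \<and> (\<exists>t. r z2 = cosh t *\<^sub>R w + sinh t *\<^sub>R u2) \<and>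
         (\<exists>t. r z3 = cosh t *\<^sub>R w + sinh t *\<^sub>R u3)"
    using pl[rule_format, OF \<sigma>(1)] unfolding placing_def by (elim exE conjE) (rule that)
  have "\<exists>\<omega>. inv_alt3 \<omega> \<and> \<omega> p n1 n2 * \<omega> w m1 m2 > 0" if d3: "dim V = 3"
  proof -
    obtain \<omega> where \<omega>: "inv_alt3 \<omega>" "\<sigma> * (\<omega> z1 e f * \<omega> w m1 m2) > 0" using \<sigma>(2) d3 by blast
    have "\<omega> p n1 n2 * \<omega> w m1 m2 = \<kappa> * (\<sigma> * (\<omega> z1 e f * \<omega> w m1 m2))"
    proof -
      have "\<omega> p n1 n2 = \<kappa> * \<sigma> * \<omega> z1 e f" using n(10) \<omega>(1) unfolding inv_alt3_def by blast
      then show ?thesis by simp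
    qed
    also have "\<dots> > 0" using \<omega>(2) n(9) by (rule mult_pos_pos[rotated])
    finally show ?thesis using \<omega>(1) by blast
  qed
  from frame_transitive[OF n(3) w n(1,2,7,8,4,5,6) m(1-6) refl m(7) this]
  obtain g where g: "g \<in> G0" "\<rho> g p = w" "\<rho> g n1 = m1" "\<rho> g n2 = m2" by blast
  have "\<rho> g ` H \<subseteq> H" using rho_H[OF g(1)] by blast
  moreover have "\<forall>a\<in>V. \<forall>b\<in>V. q (\<rho> g a) (\<rho> g b) = q a b" using rho_q[OF g(1)] by blast
  ultimately show ?thesis using r rho_linear[OF g(1)] g by (intro bexI[of _ g]) auto
qed

end

section \<open>Cartan involutions\<close>

lemma convex_bounded_deriv_0:
  fixes \<phi> :: "real \<Rightarrow> real"
  assumes d1: "\<And>t. (\<phi> has_real_derivative \<phi>' t) (at t)" and d2: "\<And>t. (\<phi>' has_real_derivative \<phi>'' t) (at t)"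
    and nn: "\<And>t. \<phi>'' t \<ge> 0" and bd: "\<And>t. \<phi> t \<le> M"
  shows "\<phi>' t = 0"
proof (rule ccontr)
  assume n: "\<phi>' t \<noteq> 0"
  have cv: "convex_on UNIV \<phi>"
    by (rule f''_ge0_imp_convex[OF convex_UNIV d1 d2 nn])
  have tan: "\<phi> s - \<phi> t \<ge> \<phi>' t * (s - t)" for s
    by (rule convex_on_imp_above_tangent[OF cv]) (use d1 in auto)
  \<comment> \<open>The point at which the tangent at \<open>t\<close> reaches
    \<open>M + 1\<close>.\<close>
  define s where "s = t + (M - \<phi> t + 1) / \<phi>' t"
  have "\<phi>' t * (s - t) = M - \<phi> t + 1" using n by (simp add: s_def)
  then show False using tan[of s] bd[of s] by simp
qed

lemma Ad_exp_has_vector_derivative: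
  fixes X Z :: "'n::finite cmat"
  shows "((\<lambda>t. mexp (t *\<^sub>R Z) ** X ** matrix_inv (mexp (t *\<^sub>R Z))) has_vector_derivative
     bra Z (mexp (t *\<^sub>R Z) ** X ** matrix_inv (mexp (t *\<^sub>R Z)))) (at t)"
proof -
  have 1: "((\<lambda>t. mexp (t *\<^sub>R Z) ** X) has_vector_derivative (Z ** mexp (t *\<^sub>R Z)) ** X) (at t)"
    by (rule bounded_linear.has_vector_derivative[OF
          bounded_bilinear.bounded_linear_left[OF bounded_bilinear_matrix_mult] mexp_has_vector_derivative])
  have "((\<lambda>t. (mexp (t *\<^sub>R Z) ** X) ** mexp (- (t *\<^sub>R Z))) has_vector_derivative
     ((mexp (t *\<^sub>R Z) ** X) ** (- (Z ** mexp (- (t *\<^sub>R Z)))) + (Z ** mexp (t *\<^sub>R Z)) ** X ** mexp (- (t *\<^sub>R Z)))) (at t)"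
    by (rule bounded_bilinear.has_vector_derivative[OF bounded_bilinear_matrix_mult 1 mexp_neg_has_vector_derivative])
  moreover have "Z ** mexp (- (t *\<^sub>R Z)) = mexp (- (t *\<^sub>R Z)) ** Z"
    using mexp_commute_scaleR[of "-t" Z] by simp
  ultimately show ?thesis
    by (simp add: matrix_inv_mexp bra_def cmat_mult_simps matrix_mul_assoc algebra_simps)
qed

context lorentz_rep
begin

lemma matrix_inv_mult: "a \<in> G0 \<Longrightarrow> b \<in> G0 \<Longrightarrow> matrix_inv (a ** b) = matrix_inv b ** matrix_inv a"
proof (rule matrix_inv_eqI)
  assume "a \<in> G0" "b \<in> G0"
  have "a ** b ** (matrix_inv b ** matrix_inv a) = a ** (b ** matrix_inv b) ** matrix_inv a"
    by (simp add: matrix_mul_assoc)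
  also have "\<dots> = mat 1" using \<open>a \<in> G0\<close> \<open>b \<in> G0\<close> by (simp add: G_inv_right)
  finally show "a ** b ** (matrix_inv b ** matrix_inv a) = mat 1" .
qed

lemma matrix_inv_inv: "a \<in> G0 \<Longrightarrow> matrix_inv (matrix_inv a) = a"
  by (rule matrix_inv_eqI) (simp add: G_inv_left)

lemma sst_inj: "X \<in> sst w \<Longrightarrow> d\<rho> X w = 0 \<Longrightarrow> X = 0"
  by (rule drho_inj) (auto simp: sst_def q_simps)

lemma subspace_sst: "subspace (sst w)"
proof (rule subspaceI)
  show "0 \<in> sst w" using subspace_0[OF subspace_g] by (simp add: sst_def drho_simps q_simps)
  show "X + Y \<in> sst w" if X: "X \<in> sst w" and Y: "Y \<in> sst w" for X Y
  proof -
    have "d\<rho> (X + Y) x = q (d\<rho> (X + Y) w) x *\<^sub>R w - q w x *\<^sub>R d\<rho> (X + Y) w" if "x \<in> V" for x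
    proof -
      have "d\<rho> (X + Y) x = (q (d\<rho> X w) x *\<^sub>R w - q w x *\<^sub>R d\<rho> X w) + (q (d\<rho> Y w) x *\<^sub>R w - q w x *\<^sub>R d\<rho> Y w)"
        unfolding drho_simps using X Y that unfolding sst_def by simp
      then show ?thesis by (simp add: drho_simps q_simps algebra_simps)
    qed
    then show ?thesis using X Y subspace_g by (simp add: sst_def subspace_add)
  qed
  show "c *\<^sub>R X \<in> sst w" if X: "X \<in> sst w" for X c
  proof -
    have "d\<rho> (c *\<^sub>R X) x = q (d\<rho> (c *\<^sub>R X) w) x *\<^sub>R w - q w x *\<^sub>R d\<rho> (c *\<^sub>R X) w" if "x \<in> V" for x
    proof -
      have "d\<rho> (c *\<^sub>R X) x = c *\<^sub>R (q (d\<rho> X w) x *\<^sub>R w - q w x *\<^sub>R d\<rho> X w)"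
        unfolding drho_simps using X that unfolding sst_def by simp
      then show ?thesis by (simp add: drho_simps q_simps algebra_simps)
    qed
    then show ?thesis using X subspace_g by (simp add: sst_def subspace_scale)
  qed
qed

text \<open>A boost is determined by its velocity at \<open>w\<close>, so the squared velocity is
  positive definite on \<open>sst w\<close>.\<close>

lemma sst_norm_bound:
  obtains C where "C > 0" "\<And>X. X \<in> sst w \<Longrightarrow> norm X \<le> C * norm (d\<rho> X w)"
proof -
  have bl: "bounded_linear (\<lambda>X. d\<rho> X w)" by (rule bounded_bilinear.bounded_linear_left[OF drho_bilinear])
  have "bilinear (\<lambda>X Y. d\<rho> X w \<bullet> d\<rho> Y w)"
    unfolding bilinear_def linear_iff by (simp add: drho_simps inner_simps)
  then have bb: "bounded_bilinear (\<lambda>X Y. d\<rho> X w \<bullet> d\<rho> Y w)" by (simp add: bilinear_conv_bounded_bilinear)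
  obtain c where c: "c > 0" "\<And>X. X \<in> sst w \<Longrightarrow> c * (norm X)\<^sup>2 \<le> d\<rho> X w \<bullet> d\<rho> X w"
    using bilinear_form_lower_bound[OF bb subspace_sst[of w]] sst_inj by (metis inner_gt_zero_iff)
  have "norm X \<le> (1 / sqrt c) * norm (d\<rho> X w)" if "X \<in> sst w" for X
  proof -
    have "(sqrt c * norm X)\<^sup>2 \<le> (norm (d\<rho> X w))\<^sup>2"
      using c(2)[OF that] c(1) by (simp add: power_mult_distrib dot_square_norm)
    then have "sqrt c * norm X \<le> norm (d\<rho> X w)" by (rule power2_le_imp_le) simp
    then show ?thesis using c(1) by (simp add: field_simps)
  qed
  then show ?thesis using c(1) by (intro that[of "1 / sqrt c"]) auto
qed

lemma stabilizer_norm_bound: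
  assumes w: "w \<in> H"
  obtains D where "D > 0" "\<And>g x. g \<in> G0 \<Longrightarrow> \<rho> g w = w \<Longrightarrow> x \<in> V \<Longrightarrow> norm (\<rho> g x) \<le> D * norm x"
proof -
  \<comment> \<open>Reversing the sign of \<open>q\<close> along \<open>w\<close> gives a positive
    definite form, preserved by every isometry that fixes \<open>w\<close>.\<close>
  define N where "N x y = q x y + 2 * (q x w * q y w)" for x y
  have "bilinear N"
    unfolding bilinear_def linear_iff N_def by (simp add: q_simps algebra_simps)
  then have bb: "bounded_bilinear N" by (simp add: bilinear_conv_bounded_bilinear)
  have pos: "N x x > 0" if "x \<in> V" "x \<noteq> 0" for x
  proof (cases "x + q x w *\<^sub>R w = 0")
    case True
    then have "x = (- q x w) *\<^sub>R w" by (simp add: eq_neg_iff_add_eq_0)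
    then have "q x w \<noteq> 0" using that by auto
    have "q x x = - q x w * q x w" by (subst (2) \<open>x = _\<close>) (simp only: q_simps)
    then have "N x x = (q x w)\<^sup>2" by (simp add: N_def power2_eq_square)
    then show ?thesis using \<open>q x w \<noteq> 0\<close> by simp
  next
    case False
    have "q (x + q x w *\<^sub>R w) w = 0" using H_q[OF w] by (simp add: q_simps)
    then have "q (x + q x w *\<^sub>R w) (x + q x w *\<^sub>R w) > 0"
      using q_pos_orthogonal[of w] H_q[OF w] False by simp
    then have "q x x + (q x w)\<^sup>2 > 0"
      using H_q[OF w] by (simp add: q_simps q_sym[of w x] power2_eq_square)
    moreover have "N x x = q x x + (q x w)\<^sup>2 + (q x w)\<^sup>2" by (simp add: N_def power2_eq_square)
    ultimately show ?thesis using zero_le_power2[of "q x w"] by linarith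
  qed
  obtain c where c: "c > 0" "\<And>x. x \<in> V \<Longrightarrow> c * (norm x)\<^sup>2 \<le> N x x"
    by (rule bilinear_form_lower_bound[OF bb subspace_V pos]) (assumption | rule that)+
  obtain C where C: "C > 0" "\<And>x. N x x \<le> C * (norm x)\<^sup>2"
    by (rule bilinear_form_upper_bound[OF bb]) (rule that)
  have "norm (\<rho> g x) \<le> sqrt (C / c) * norm x" if g: "g \<in> G0" "\<rho> g w = w" and x: "x \<in> V" for g x
  proof -
    have "q (\<rho> g x) w = q x w" using rho_q[OF g(1) x H_V[OF w]] g(2) by simp
    then have "N (\<rho> g x) (\<rho> g x) = N x x" using rho_q[OF g(1) x x] by (simp add: N_def)
    then have "c * (norm (\<rho> g x))\<^sup>2 \<le> C * (norm x)\<^sup>2"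
      using c(2)[OF rho_V[OF g(1) x]] C(2)[of x] by linarith
    then have "(norm (\<rho> g x))\<^sup>2 \<le> (C / c) * (norm x)\<^sup>2"
      using c(1) by (simp add: field_simps)
    also have "\<dots> = (sqrt (C / c) * norm x)\<^sup>2"
      using c(1) C(1) by (simp add: power_mult_distrib)
    finally show ?thesis by (rule power2_le_imp_le) (use c(1) C(1) in simp)
  qed
  moreover have "sqrt (C / c) > 0" using C(1) c(1) by simp
  ultimately show ?thesis using that[of "sqrt (C / c)"] by simp
qed

lemma stabilizer_Ad_bounded:
  assumes w: "w \<in> H" and Y: "Y \<in> \<gg>"
  obtains M where "\<And>g. g \<in> G0 \<Longrightarrow> \<rho> g w = w \<Longrightarrow> norm (g ** Y ** matrix_inv g) \<le> M"
proof -
  obtain B where B: "B \<subseteq> V" "independent B" "V \<subseteq> span B" by (rule basis_exists[of V])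
  have finB: "finite B" using B(2) by (rule independent_imp_finite)
  \<comment> \<open>A positive definite form on the Lie algebra that measures an element by its
    action on a basis of \<open>V\<close>, where the stabilizer of \<open>w\<close> is already known
    to act boundedly.\<close>
  define U where "U X X' = (\<Sum>b\<in>B. d\<rho> X b \<bullet> d\<rho> X' b)" for X X'
  have "bilinear U"
    unfolding bilinear_def linear_iff U_def
    by (simp add: drho_simps inner_simps sum.distrib sum_distrib_left)
  then have bb: "bounded_bilinear U" by (simp add: bilinear_conv_bounded_bilinear)
  have pos: "U X X > 0" if X: "X \<in> \<gg>" "X \<noteq> 0" for X
  proof (rule ccontr)
    assume "\<not> U X X > 0"
    moreover have "U X X \<ge> 0" by (simp add: U_def sum_nonneg)
    ultimately have "U X X = 0" by simp
    then have "\<forall>b\<in>B. d\<rho> X b = 0" using finB by (simp add: U_def sum_nonneg_eq_0_iff)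
    moreover have "linear (d\<rho> X)" using drho_bilinear bounded_bilinear.bounded_linear_right bounded_linear.linear by blast
    ultimately have "d\<rho> X x = 0" if "x \<in> span B" for x
      using that linear_eq_on[of "d\<rho> X" "\<lambda>x. 0" x B] linear_zero by auto
    then have "X = 0" using B(3) X(1) by (intro drho_inj) auto
    then show False using X by simp
  qed
  obtain c where c: "c > 0" "\<And>X. X \<in> \<gg> \<Longrightarrow> c * (norm X)\<^sup>2 \<le> U X X"
    by (rule bilinear_form_lower_bound[OF bb subspace_g pos]) (assumption | rule that)+
  obtain D where D: "D > 0" "\<And>g x. g \<in> G0 \<Longrightarrow> \<rho> g w = w \<Longrightarrow> x \<in> V \<Longrightarrow> norm (\<rho> g x) \<le> D * norm x"
    by (rule stabilizer_norm_bound[OF w]) (rule that)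
  obtain K where K: "K > 0" "\<forall>X x. norm (d\<rho> X x) \<le> norm X * norm x * K"
    using bounded_bilinear.pos_bounded[OF drho_bilinear] by blast
  define R where "R = (\<Sum>b\<in>B. (D * (norm Y * (D * norm b) * K))\<^sup>2)"
  have "norm (g ** Y ** matrix_inv g) \<le> sqrt (R / c)" if g: "g \<in> G0" "\<rho> g w = w" for g
  proof -
    have gi: "matrix_inv g \<in> G0" "\<rho> (matrix_inv g) w = w"
      using g G_inv rho_inv(1)[OF g(1) H_V[OF w]] by auto
    have "norm (d\<rho> (g ** Y ** matrix_inv g) b) \<le> D * (norm Y * (D * norm b) * K)" if b: "b \<in> B" for b
    proof -
      have bV: "b \<in> V" using b B by auto
      have "norm (d\<rho> (g ** Y ** matrix_inv g) b) = norm (\<rho> g (d\<rho> Y (\<rho> (matrix_inv g) b)))"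
        by (simp add: drho_Ad[OF g(1) Y bV])
      also have "\<dots> \<le> D * norm (d\<rho> Y (\<rho> (matrix_inv g) b))"
        by (rule D(2)[OF g drho_V[OF Y rho_V[OF gi(1) bV]]])
      also have "norm (d\<rho> Y (\<rho> (matrix_inv g) b)) \<le> norm Y * norm (\<rho> (matrix_inv g) b) * K" using K(2) by blast
      also have "\<dots> \<le> norm Y * (D * norm b) * K"
        using D(2)[OF gi bV] K(1) by (intro mult_right_mono mult_left_mono) auto
      finally show ?thesis using D(1) by simp
    qed
    then have "U (g ** Y ** matrix_inv g) (g ** Y ** matrix_inv g) \<le> R"
      unfolding U_def R_def dot_square_norm by (intro sum_mono power_mono) auto
    then have "c * (norm (g ** Y ** matrix_inv g))\<^sup>2 \<le> R" using c(2)[OF Ad_closed[OF g(1) Y]] by linarith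
    then have "(norm (g ** Y ** matrix_inv g))\<^sup>2 \<le> R / c" using c(1) by (simp add: field_simps)
    then show ?thesis by (rule real_le_rsqrt)
  qed
  then show ?thesis by (rule that)
qed

end

lemma matrix_inv_one [simp]: "matrix_inv (mat 1 :: 'n::finite cmat) = mat 1"
  by (rule matrix_inv_eqI) simp

section \<open>The inner product of a Cartan involution and the boundedness of its group\<close>

locale cartan_rep = lorentz_rep +
  fixes \<theta> :: "'b cmat \<Rightarrow> 'b cmat"
  assumes cartan: "cartan_involution (lie_algebra G0) \<theta>"
begin

lemma theta:
  "X \<in> \<gg> \<Longrightarrow> \<theta> X \<in> \<gg>" "lin_on \<gg> \<theta>" "X \<in> \<gg> \<Longrightarrow> Y \<in> \<gg> \<Longrightarrow> \<theta> (bra X Y) = bra (\<theta> X) (\<theta> Y)"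
  "X \<in> \<gg> \<Longrightarrow> \<theta> (\<theta> X) = X" "X \<in> \<gg> \<Longrightarrow> X \<noteq> 0 \<Longrightarrow> killing \<gg> X (\<theta> X) < 0"
  using cartan unfolding cartan_involution_def lin_on_def by blast+

lemma theta_add: "X \<in> \<gg> \<Longrightarrow> Y \<in> \<gg> \<Longrightarrow> \<theta> (X + Y) = \<theta> X + \<theta> Y"
  using theta(2) unfolding lin_on_def by (metis scaleR_one)

lemma theta_scale: "X \<in> \<gg> \<Longrightarrow> \<theta> (c *\<^sub>R X) = c *\<^sub>R \<theta> X"
proof -
  assume "X \<in> \<gg>"
  then have "\<theta> (c *\<^sub>R X + 0 *\<^sub>R X) = c *\<^sub>R \<theta> X + 0 *\<^sub>R \<theta> X"
    using theta(2) unfolding lin_on_def by blast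
  then show ?thesis by simp
qed

lemma killing_theta: "X \<in> \<gg> \<Longrightarrow> Y \<in> \<gg> \<Longrightarrow> killing \<gg> (\<theta> X) (\<theta> Y) = killing \<gg> X Y"
  by (rule killing_automorphism) (auto simp: theta)

definition k where "k = cartan_k \<gg> \<theta>"
definition s where "s = cartan_s \<gg> \<theta>"

lemma k_iff: "X \<in> k \<longleftrightarrow> X \<in> \<gg> \<and> \<theta> X = X" and s_iff: "X \<in> s \<longleftrightarrow> X \<in> \<gg> \<and> \<theta> X = - X"
  by (simp_all add: k_def s_def cartan_k_def cartan_s_def)

lemma k_scale: "X \<in> k \<Longrightarrow> c *\<^sub>R X \<in> k"
  using subspace_g by (simp add: k_iff theta_scale subspace_scale)

lemma killing_k_s: "X \<in> k \<Longrightarrow> Y \<in> s \<Longrightarrow> killing \<gg> X Y = 0"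
proof -
  assume "X \<in> k" "Y \<in> s"
  then have XY: "X \<in> \<gg>" "Y \<in> \<gg>" "\<theta> X = X" "\<theta> Y = - Y" by (auto simp: k_iff s_iff)
  have "killing \<gg> X ((-1) *\<^sub>R Y + 0 *\<^sub>R Y) = - killing \<gg> X Y"
    using killing_linear_right[OF XY(1,2,2), of "-1" 0] by simp
  then show ?thesis using killing_theta[OF XY(1,2)] XY(3,4) by simp
qed

lemma cartan_decomposition:
  assumes X: "X \<in> \<gg>"
  obtains Y Z where "Y \<in> k" "Z \<in> s" "X = Y + Z"
proof (rule that)
  have t: "\<theta> X \<in> \<gg>" "\<theta> (\<theta> X) = X" using theta X by auto
  have m: "- \<theta> X \<in> \<gg>" "\<theta> (- \<theta> X) = - X"
    using t subspace_g theta_scale[of "\<theta> X" "-1"] by (auto simp: subspace_neg)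
  show "(1/2) *\<^sub>R (X + \<theta> X) \<in> k"
    using X t subspace_g by (simp add: k_iff subspace_add subspace_scale theta_scale theta_add add.commute)
  have d: "X + - \<theta> X \<in> \<gg>" by (rule subspace_add[OF subspace_g X m(1)])
  have "\<theta> (X + - \<theta> X) = \<theta> X + - X" using theta_add[OF X m(1)] m(2) by simp
  then show "(1/2) *\<^sub>R (X + - \<theta> X) \<in> s"
    using d theta_scale[OF d] subspace_scale[OF subspace_g d]
    by (simp add: s_iff flip: scaleR_minus_right)
  show "X = (1/2) *\<^sub>R (X + \<theta> X) + (1/2) *\<^sub>R (X + - \<theta> X)"
    by (simp add: algebra_simps flip: scaleR_add_left)
qed

text \<open>The Killing form is only meaningful on \<open>\<gg>\<close>; composing with a linear projection onto \<open>\<gg>\<close> makes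
  the inner product \<open>- B(X, \<theta> Y)\<close> a bounded bilinear form on all matrices.\<close>

definition proj where
  "proj = (SOME F. linear F \<and> (\<forall>x\<in>\<gg>. F x = x) \<and> range F \<subseteq> \<gg>)"

lemma proj: "linear proj" "x \<in> \<gg> \<Longrightarrow> proj x = x" "proj x \<in> \<gg>"
proof -
  have "\<exists>F. linear F \<and> (\<forall>x\<in>\<gg>. F x = x) \<and> range F \<subseteq> \<gg>"
  proof -
    obtain F where "linear F" "\<forall>x\<in>\<gg>. F x = id x" "range F \<subseteq> span (id ` \<gg>)"
      by (rule lin_on_extend[OF subspace_g, of id]) (auto simp: lin_on_def)
    then show ?thesis using subspace_g by (auto simp: span_eq_iff[THEN iffD2])
  qed
  then have "linear proj \<and> (\<forall>x\<in>\<gg>. proj x = x) \<and> range proj \<subseteq> \<gg>" unfolding proj_def by (rule someI_ex)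
  then show "linear proj" "x \<in> \<gg> \<Longrightarrow> proj x = x" "proj x \<in> \<gg>" by auto
qed

definition T where "T X Y = - killing \<gg> (proj X) (\<theta> (proj Y))"

lemma T_eq: "X \<in> \<gg> \<Longrightarrow> Y \<in> \<gg> \<Longrightarrow> T X Y = - killing \<gg> X (\<theta> Y)"
  by (simp add: T_def proj)

lemma T_bilinear: "bounded_bilinear T"
proof -
  have lin: "T (a *\<^sub>R X + b *\<^sub>R X') Y = a * T X Y + b * T X' Y"
    "T Y (a *\<^sub>R X + b *\<^sub>R X') = a * T Y X + b * T Y X'" for a b X X' Y
  proof -
    have p: "proj (a *\<^sub>R X + b *\<^sub>R X') = a *\<^sub>R proj X + b *\<^sub>R proj X'"
      using proj(1) by (simp add: linear_add linear_scale)
    show "T (a *\<^sub>R X + b *\<^sub>R X') Y = a * T X Y + b * T X' Y"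
      unfolding T_def p by (subst killing_linear_left) (auto simp: proj theta)
    have "\<theta> (a *\<^sub>R proj X + b *\<^sub>R proj X') = a *\<^sub>R \<theta> (proj X) + b *\<^sub>R \<theta> (proj X')"
      using theta(2) proj(3) unfolding lin_on_def by blast
    then show "T Y (a *\<^sub>R X + b *\<^sub>R X') = a * T Y X + b * T Y X'"
      unfolding T_def p by (simp add: killing_linear_right proj theta)
  qed
  have "bilinear T"
    unfolding bilinear_def
  proof (intro conjI allI linearI)
    fix X Y Y' c
    show "T X (Y + Y') = T X Y + T X Y'" using lin(2)[of X 1 Y 1 Y'] by simp
    show "T X (c *\<^sub>R Y) = c *\<^sub>R T X Y" using lin(2)[of X c Y 0 Y] by simp
    show "T (Y + Y') X = T Y X + T Y' X" using lin(1)[of 1 Y 1 Y' X] by simp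
    show "T (c *\<^sub>R Y) X = c *\<^sub>R T Y X" using lin(1)[of c Y 0 Y X] by simp
  qed
  then show ?thesis by (simp add: bilinear_conv_bounded_bilinear)
qed

lemma T_sym: "X \<in> \<gg> \<Longrightarrow> Y \<in> \<gg> \<Longrightarrow> T X Y = T Y X"
  using killing_theta[of X "\<theta> Y"] killing_sym[of "\<theta> X" Y] by (simp add: T_eq theta)

lemma T_pos: "X \<in> \<gg> \<Longrightarrow> X \<noteq> 0 \<Longrightarrow> T X X > 0"
  using theta(5)[of X] by (simp add: T_eq)

text \<open>The \<open>T\<close>-adjoint of bracketing with \<open>Z\<close> is minus bracketing
  with \<open>\<theta> Z\<close>: skew for \<open>Z\<close> in \<open>k\<close>, symmetric for
  \<open>Z\<close> in \<open>s\<close>.\<close>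

lemma T_bra:
  assumes "X \<in> \<gg>" "Y \<in> \<gg>" "Z \<in> \<gg>"
  shows "T (bra Z X) Y = - T X (bra (\<theta> Z) Y)"
  using assms killing_invariant[of X "\<theta> Y" Z]
  by (simp add: T_eq bra_closed theta)

abbreviation "Ad g X \<equiv> g ** X ** matrix_inv g"

lemma T_Ad_derivative:
  assumes X: "X \<in> \<gg>" and Z: "Z \<in> \<gg>"
  shows "((\<lambda>t. T (Ad (mexp (t *\<^sub>R Z)) X) (Ad (mexp (t *\<^sub>R Z)) X)) has_real_derivative
     2 * T (bra Z (Ad (mexp (t *\<^sub>R Z)) X)) (Ad (mexp (t *\<^sub>R Z)) X)) (at t)"
proof -
  let ?g = "\<lambda>t. Ad (mexp (t *\<^sub>R Z)) X"
  have g: "?g t \<in> \<gg>" for t by (rule Ad_closed[OF exp_G[OF Z] X])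
  have "((\<lambda>t. T (?g t) (?g t)) has_vector_derivative (T (?g t) (bra Z (?g t)) + T (bra Z (?g t)) (?g t))) (at t)"
    by (rule bounded_bilinear.has_vector_derivative[OF T_bilinear Ad_exp_has_vector_derivative Ad_exp_has_vector_derivative])
  moreover have "T (?g t) (bra Z (?g t)) = T (bra Z (?g t)) (?g t)"
    by (rule T_sym[OF g bra_closed[OF Z g]])
  ultimately show ?thesis by (simp add: has_real_derivative_iff_has_vector_derivative)
qed

lemma T_Ad_k:
  assumes X: "X \<in> \<gg>" and Z: "Z \<in> k"
  shows "T (Ad (mexp Z) X) (Ad (mexp Z) X) = T X X"
proof -
  let ?g = "\<lambda>t. Ad (mexp (t *\<^sub>R Z)) X"
  have Z': "Z \<in> \<gg>" "\<theta> Z = Z" using Z by (auto simp: k_iff)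
  have g: "?g t \<in> \<gg>" for t by (rule Ad_closed[OF exp_G[OF Z'(1)] X])
  have "T (bra Z (?g t)) (?g t) = 0" for t
    using T_bra[OF g g Z'(1), of t t] T_sym[OF g bra_closed[OF Z'(1) g], of t t] Z'(2) by simp
  then have "((\<lambda>t. T (?g t) (?g t)) has_vector_derivative 0) (at t)" for t
    using T_Ad_derivative[OF X Z'(1), of t] by (simp add: has_real_derivative_iff_has_vector_derivative)
  from const_if_vector_derivative_0[OF this, of 1] show ?thesis by simp
qed

definition K where "K = analytic_subgroup k"

lemma K_invariant: "K \<subseteq> {g \<in> G0. \<forall>X\<in>\<gg>. T (Ad g X) (Ad g X) = T X X}"
  unfolding K_def
proof (rule analytic_subgroup_minimal)
  let ?S = "{g \<in> G0. \<forall>X\<in>\<gg>. T (Ad g X) (Ad g X) = T X X}"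
  show "mat 1 \<in> ?S" using G_one by simp
  show "mexp X \<in> ?S" if "X \<in> k" for X
    using that T_Ad_k exp_G1 by (auto simp: k_iff)
  show "a ** b \<in> ?S" if a: "a \<in> ?S" and b: "b \<in> ?S" for a b
  proof -
    have "Ad (a ** b) X = Ad a (Ad b X)" for X
      using a b by (simp add: matrix_inv_mult matrix_mul_assoc)
    moreover have "Ad b X \<in> \<gg>" if "X \<in> \<gg>" for X using b that by (simp add: Ad_closed)
    ultimately show ?thesis using a b by (simp add: G_mult)
  qed
  show "matrix_inv a \<in> ?S" if a: "a \<in> ?S" for a
  proof -
    have "T (Ad (matrix_inv a) X) (Ad (matrix_inv a) X) = T X X" if X: "X \<in> \<gg>" for X
    proof -
      have "Ad a (Ad (matrix_inv a) X) = (a ** matrix_inv a) ** X ** (a ** matrix_inv a)"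
        using a by (simp add: matrix_inv_inv matrix_mul_assoc)
      also have "\<dots> = X" using a by (simp add: G_inv_right)
      finally have "Ad a (Ad (matrix_inv a) X) = X" .
      moreover have "Ad (matrix_inv a) X \<in> \<gg>" using a X by (simp add: Ad_closed G_inv)
      ultimately show ?thesis using a by (metis (mono_tags, lifting) mem_Collect_eq)
    qed
    then show ?thesis using a by (simp add: G_inv)
  qed
qed

lemma K_G: "g \<in> K \<Longrightarrow> g \<in> G0"
  using K_invariant by auto

lemma K_Ad_bounded:
  obtains M where "M > 0" "\<And>g X. g \<in> K \<Longrightarrow> X \<in> \<gg> \<Longrightarrow> norm (Ad g X) \<le> M * norm X"
proof -
  obtain c where c: "c > 0" "\<And>x. x \<in> \<gg> \<Longrightarrow> c * (norm x)\<^sup>2 \<le> T x x"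
    by (rule bilinear_form_lower_bound[OF T_bilinear subspace_g T_pos]) (assumption | rule that)+
  obtain C where C: "C > 0" "\<And>x. T x x \<le> C * (norm x)\<^sup>2"
    by (rule bilinear_form_upper_bound[OF T_bilinear]) (rule that)
  have "norm (Ad g X) \<le> sqrt (C / c) * norm X" if g: "g \<in> K" and X: "X \<in> \<gg>" for g X
  proof -
    have "c * (norm (Ad g X))\<^sup>2 \<le> T (Ad g X) (Ad g X)" by (rule c(2)[OF Ad_closed[OF K_G[OF g] X]])
    also have "\<dots> = T X X" using K_invariant g X by auto
    also have "\<dots> \<le> C * (norm X)\<^sup>2" by (rule C)
    finally have "(norm (Ad g X))\<^sup>2 \<le> (C / c) * (norm X)\<^sup>2" using c(1) by (simp add: field_simps)
    also have "\<dots> = (sqrt (C / c) * norm X)\<^sup>2"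
      using c(1) C(1) by (simp add: power_mult_distrib)
    finally show ?thesis by (rule power2_le_imp_le) (use c(1) C(1) in simp)
  qed
  moreover have "sqrt (C / c) > 0" using C(1) c(1) by simp
  ultimately show ?thesis using that[of "sqrt (C / c)"] by simp
qed

text \<open>Let \<open>p\<close> be the image of \<open>b0\<close> under \<open>g\<close>, and
  \<open>v\<close> a unit vector orthogonal to \<open>b0\<close> and \<open>p\<close>. The boost at
  \<open>p\<close> in direction \<open>v\<close> moves \<open>b0\<close> by a multiple of
  \<open>v\<close> of size \<open>\<bar>q p b0\<bar>\<close>. It equals \<open>Ad g X\<close> for a
  boost \<open>X\<close> at \<open>b0\<close> of unit velocity, so it is bounded independently of
  \<open>g\<close>; and \<open>q p b0\<close> controls the norm of \<open>p\<close>.\<close>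

lemma K_orbit_bounded: "bounded ((\<lambda>g. \<rho> g b0) ` K)"
proof -
  obtain M where M: "M > 0" "\<And>g X. g \<in> K \<Longrightarrow> X \<in> \<gg> \<Longrightarrow> norm (Ad g X) \<le> M * norm X"
    by (rule K_Ad_bounded) (rule that)
  obtain C where C: "C > 0" "\<And>X. X \<in> sst b0 \<Longrightarrow> norm X \<le> C * norm (d\<rho> X b0)"
    by (rule sst_norm_bound[of b0]) (rule that)
  obtain D where D: "D > 0" "\<forall>X x. norm (d\<rho> X x) \<le> norm X * norm x * D"
    using bounded_bilinear.pos_bounded[OF drho_bilinear] by blast
  have nb: "norm x = 1" if "q x b0 = 0" "q x x = 1" for x
    using that by (simp add: q_def norm_eq_1)
  have main: "norm (\<rho> g b0) \<le> sqrt (2 * (M * C * D)\<^sup>2)" if g: "g \<in> K" for g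
  proof -
    define p where "p = \<rho> g b0"
    have gG: "g \<in> G0" "matrix_inv g \<in> G0" using K_G[OF g] G_inv by auto
    have p: "p \<in> H" unfolding p_def by (rule rho_H[OF gG(1) b0_H])
    obtain v where v: "v \<in> V" "q v v = 1" "q v b0 = 0" "q v p = 0"
      by (rule exists_q_orthogonal2[of b0 p]) (use H_V[OF p] b0 H_q[OF b0_H] in auto)
    define u where "u = \<rho> (matrix_inv g) v"
    have uV: "u \<in> V" unfolding u_def by (rule rho_V[OF gG(2) v(1)])
    have gu: "\<rho> g u = v" unfolding u_def by (rule rho_inv(2)[OF gG(1) v(1)])
    have ub: "q u b0 = 0" using rho_q[OF gG(1) uV b0(1)] gu v(4) by (simp add: p_def)
    have uu: "q u u = 1" using rho_q[OF gG(2) v(1) v(1)] v(2) by (simp add: u_def)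
    obtain X where X: "X \<in> sst b0" "d\<rho> X b0 = u" using sst_exists[OF b0_H uV ub] by blast
    have Xg: "X \<in> \<gg>" using X by (simp add: sst_def)
    define y where "y = \<rho> (matrix_inv g) b0"
    have yV: "y \<in> V" unfolding y_def by (rule rho_V[OF gG(2) b0(1)])
    have gy: "\<rho> g y = b0" unfolding y_def by (rule rho_inv(2)[OF gG(1) b0(1)])
    have uy: "q u y = 0" using rho_q[OF gG(1) uV yV] gu gy v(3) by simp
    have by': "q b0 y = q p b0" using rho_q[OF gG(1) b0(1) yV] gy by (simp add: p_def)
    have "d\<rho> X y = - (q p b0 *\<^sub>R u)" using X yV uy by' by (simp add: sst_def)
    then have "d\<rho> (Ad g X) b0 = - (q p b0 *\<^sub>R v)"
      using drho_Ad[OF gG(1) Xg b0(1)] rho_linear[OF gG(1)] gu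
      by (simp add: y_def linear_neg linear_scale)
    then have "\<bar>q p b0\<bar> = norm (d\<rho> (Ad g X) b0)" using nb[OF v(3,2)] by simp
    also have "\<dots> \<le> norm (Ad g X) * norm b0 * D" using D(2) by blast
    also have "\<dots> = norm (Ad g X) * D" using b0 by simp
    also have "norm (Ad g X) \<le> M * norm X" by (rule M(2)[OF g Xg])
    also have "norm X \<le> C" using C(2)[OF X(1)] X(2) nb[OF ub uu] by simp
    finally have "\<bar>q p b0\<bar> \<le> M * C * D" using M(1) D(1) by (simp add: mult_right_mono mult_left_mono)
    moreover have "q p b0 = - (p \<bullet> b0)" by (simp add: q_def)
    ultimately have "(p \<bullet> b0)\<^sup>2 \<le> (M * C * D)\<^sup>2"
      using power_mono[of "\<bar>p \<bullet> b0\<bar>" "M * C * D" 2] by simp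
    moreover have "(norm p)\<^sup>2 = -1 + 2 * (p \<bullet> b0)\<^sup>2"
      using H_q[OF p] by (simp add: q_def dot_square_norm power2_eq_square)
    ultimately have "(norm p)\<^sup>2 \<le> 2 * (M * C * D)\<^sup>2" by linarith
    then show ?thesis unfolding p_def by (rule real_le_rsqrt)
  qed
  then show ?thesis unfolding bounded_iff by blast
qed

end

section \<open>Geodesic symmetries and Killing orthogonality\<close>

context lorentz_rep
begin

text \<open>The geodesic symmetry at \<open>w\<close>: it fixes \<open>w\<close> and negates the
  orthogonal complement. For odd n its determinant is -1 and no group element induces it, so
  conjugation by it is built on the Lie algebra.\<close>

definition point_refl :: "'v \<Rightarrow> 'v \<Rightarrow> 'v" where
  "point_refl w x = - x - (2 * q x w) *\<^sub>R w"

lemma point_refl_props: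
  assumes "w \<in> H"
  shows "x \<in> V \<Longrightarrow> point_refl w x \<in> V" "point_refl w (point_refl w x) = x"
    "point_refl w (a *\<^sub>R x + b *\<^sub>R y) = a *\<^sub>R point_refl w x + b *\<^sub>R point_refl w y"
    "point_refl w (x - y) = point_refl w x - point_refl w y"
  using assms subspace_V H_V[OF assms] H_q[OF assms]
  by (simp_all add: point_refl_def q_simps subspace_diff subspace_scale subspace_neg algebra_simps)

lemma point_refl_conjugation:
  assumes w: "w \<in> H" and X: "X \<in> \<gg>"
  shows "\<exists>Y\<in>\<gg>. \<forall>x\<in>V. d\<rho> Y x = point_refl w (d\<rho> X (point_refl w x))"
proof -
  note wV = H_V[OF w]
  define u where "u = d\<rho> X w"
  have u: "u \<in> V" "q u w = 0"
    using drho_V[OF X wV] drho_skew[OF X wV wV] q_sym[of w "d\<rho> X w"] by (auto simp: u_def)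
  \<comment> \<open>Conjugation negates the boost part \<open>X1\<close> of \<open>X\<close> at
    \<open>w\<close> and keeps the rest, which gives \<open>X - 2 *\<^sub>R X1\<close>.\<close>
  obtain X1 where X1: "X1 \<in> sst w" "d\<rho> X1 w = u" using sst_exists[OF w u] by blast
  have X1g: "X1 \<in> \<gg>" using X1 by (simp add: sst_def)
  have "d\<rho> (X - 2 *\<^sub>R X1) x = point_refl w (d\<rho> X (point_refl w x))" if x: "x \<in> V" for x
  proof -
    have 1: "d\<rho> X1 x = q u x *\<^sub>R w - q w x *\<^sub>R u" using X1 x by (simp add: sst_def)
    have 2: "q (d\<rho> X x) w = - q u x" using drho_skew[OF X x wV] q_sym[of x u] by (simp add: u_def)
    have "d\<rho> X (point_refl w x) = - d\<rho> X x - (2 * q x w) *\<^sub>R u"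
      by (simp add: point_refl_def drho_simps u_def)
    then have "point_refl w (d\<rho> X (point_refl w x)) = d\<rho> X x + (2 * q x w) *\<^sub>R u - (2 * q u x) *\<^sub>R w"
      using u(2) 2 by (simp add: point_refl_def q_simps)
    then show ?thesis by (simp add: drho_simps 1 q_sym[of x w] algebra_simps)
  qed
  moreover have "X - 2 *\<^sub>R X1 \<in> \<gg>" using X X1g subspace_g by (simp add: subspace_diff subspace_scale)
  ultimately show ?thesis by blast
qed

lemma drho_eqI: "X \<in> \<gg> \<Longrightarrow> Y \<in> \<gg> \<Longrightarrow> (\<And>x. x \<in> V \<Longrightarrow> d\<rho> X x = d\<rho> Y x) \<Longrightarrow> X = Y"
  using drho_inj[of "X - Y"] subspace_g by (simp add: drho_simps subspace_diff)

text \<open>Conjugation by the reflection in \<open>w\<close> is an automorphism that is the identity on \<^term>\<open>kst w\<close>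
  and minus the identity on \<^term>\<open>sst w\<close>.\<close>

lemma killing_kst_sst:
  assumes w: "w \<in> H" and X: "X \<in> kst w" and Y: "Y \<in> sst w"
  shows "killing \<gg> X Y = 0"
proof -
  note wV = H_V[OF w]
  \<comment> \<open>The chosen element is unique by faithfulness of \<open>d\<rho>\<close> on the
    Lie algebra; linearity and compatibility with brackets are therefore checked on
    \<open>V\<close>.\<close>
  define \<sigma> where "\<sigma> X = (SOME Y. Y \<in> \<gg> \<and> (\<forall>x\<in>V. d\<rho> Y x = point_refl w (d\<rho> X (point_refl w x))))" for X
  have \<sigma>: "\<sigma> X \<in> \<gg>" "x \<in> V \<Longrightarrow> d\<rho> (\<sigma> X) x = point_refl w (d\<rho> X (point_refl w x))" if "X \<in> \<gg>" for X x
  proof -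
    have "\<exists>Y. Y \<in> \<gg> \<and> (\<forall>x\<in>V. d\<rho> Y x = point_refl w (d\<rho> X (point_refl w x)))"
      using point_refl_conjugation[OF w that] by blast
    then have "\<sigma> X \<in> \<gg> \<and> (\<forall>x\<in>V. d\<rho> (\<sigma> X) x = point_refl w (d\<rho> X (point_refl w x)))"
      unfolding \<sigma>_def by (rule someI_ex)
    then show "\<sigma> X \<in> \<gg>" "x \<in> V \<Longrightarrow> d\<rho> (\<sigma> X) x = point_refl w (d\<rho> X (point_refl w x))" by auto
  qed
  note rp = point_refl_props[OF w]
  have Xg: "X \<in> \<gg>" "d\<rho> X w = 0" and Yg: "Y \<in> \<gg>" using X Y by (auto simp: kst_def sst_def)
  have lin: "lin_on \<gg> \<sigma>"
    unfolding lin_on_def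
  proof (intro ballI allI)
    fix X Y and a b :: real assume "X \<in> \<gg>" "Y \<in> \<gg>"
    then have g: "a *\<^sub>R X + b *\<^sub>R Y \<in> \<gg>" "a *\<^sub>R \<sigma> X + b *\<^sub>R \<sigma> Y \<in> \<gg>"
      using subspace_g \<sigma>(1) by (auto simp: subspace_add subspace_scale)
    show "\<sigma> (a *\<^sub>R X + b *\<^sub>R Y) = a *\<^sub>R \<sigma> X + b *\<^sub>R \<sigma> Y"
      by (rule drho_eqI[OF \<sigma>(1)[OF g(1)] g(2)])
        (use \<open>X \<in> \<gg>\<close> \<open>Y \<in> \<gg>\<close> g in \<open>simp add: \<sigma>(2) drho_simps rp(3)\<close>)
  qed
  have inv: "\<sigma> (\<sigma> X) = X" if "X \<in> \<gg>" for X
    by (rule drho_eqI[OF \<sigma>(1)[OF \<sigma>(1)[OF that]] that]) (use that in \<open>simp add: \<sigma> rp\<close>)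
  have hom: "\<sigma> (bra X Y) = bra (\<sigma> X) (\<sigma> Y)" if "X \<in> \<gg>" "Y \<in> \<gg>" for X Y
    by (rule drho_eqI[OF \<sigma>(1)[OF bra_closed[OF that]] bra_closed[OF \<sigma>(1)[OF that(1)] \<sigma>(1)[OF that(2)]]])
      (use that in \<open>simp add: \<sigma> rp drho_bra bra_closed drho_V\<close>)
  have "\<sigma> X = X"
  proof (rule drho_eqI[OF \<sigma>(1)[OF Xg(1)] Xg(1)])
    fix x assume x: "x \<in> V"
    have "q (d\<rho> X x) w = 0" using drho_skew[OF Xg(1) x wV] Xg(2) by (simp add: q_simps)
    then show "d\<rho> (\<sigma> X) x = d\<rho> X x"
      unfolding \<sigma>(2)[OF Xg(1) x] by (simp add: point_refl_def drho_simps Xg(2) q_simps)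
  qed
  moreover have "\<sigma> Y = (-1) *\<^sub>R Y + 0 *\<^sub>R Y"
  proof (rule drho_eqI[OF \<sigma>(1)[OF Yg]])
    show "(-1) *\<^sub>R Y + 0 *\<^sub>R Y \<in> \<gg>" using Yg subspace_g by (simp add: subspace_neg)
    fix x assume x: "x \<in> V"
    define u where "u = d\<rho> Y w"
    have uw: "q u w = 0" using drho_skew[OF Yg wV wV] q_sym[of w "d\<rho> Y w"] by (simp add: u_def)
    have A: "d\<rho> Y x = q u x *\<^sub>R w - q w x *\<^sub>R u" using Y x by (simp add: sst_def u_def)
    have "d\<rho> Y (point_refl w x) = - d\<rho> Y x - (2 * q w x) *\<^sub>R u"
      by (simp add: point_refl_def drho_simps u_def q_sym[of x w])
    also have "\<dots> = - (q u x *\<^sub>R w) - q w x *\<^sub>R u"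
      unfolding A by (simp add: scaleR_2 flip: scaleR_scaleR)
    finally have "point_refl w (d\<rho> Y (point_refl w x)) = - (q u x *\<^sub>R w - q w x *\<^sub>R u)"
      using uw H_q[OF w] by (simp add: point_refl_def q_simps scaleR_2 flip: scaleR_scaleR)
    then show "d\<rho> (\<sigma> Y) x = d\<rho> ((-1) *\<^sub>R Y + 0 *\<^sub>R Y) x"
      unfolding \<sigma>(2)[OF Yg x] by (simp add: drho_simps A)
  qed
  moreover have "killing \<gg> (\<sigma> X) (\<sigma> Y) = killing \<gg> X Y"
    by (rule killing_automorphism[OF lin \<sigma>(1) inv hom Xg(1) Yg])
  ultimately have "killing \<gg> X ((-1) *\<^sub>R Y + 0 *\<^sub>R Y) = killing \<gg> X Y" by simp
  then show ?thesis using killing_linear_right[OF Xg(1) Yg Yg, of "-1" 0] by simp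
qed

lemma kst_sst_decomposition:
  assumes w: "w \<in> H" and X: "X \<in> \<gg>"
  obtains Y Z where "Y \<in> kst w" "Z \<in> sst w" "X = Y + Z"
proof -
  note wV = H_V[OF w]
  have u: "d\<rho> X w \<in> V" "q (d\<rho> X w) w = 0"
    using drho_V[OF X wV] drho_skew[OF X wV wV] q_sym[of w "d\<rho> X w"] by auto
  obtain Z where Z: "Z \<in> sst w" "d\<rho> Z w = d\<rho> X w" using sst_exists[OF w u] by blast
  have "X - Z \<in> kst w"
    using Z X subspace_g by (simp add: kst_def sst_def drho_simps subspace_diff)
  then show ?thesis using Z(1) that[of "X - Z" Z] by simp
qed

end

section \<open>Every Cartan decomposition is the one at a point\<close>

context cartan_rep
begin

lemma K_fixed_point:
  obtains w where "w \<in> H" "k \<subseteq> kst w"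
proof -
  let ?R = "\<rho> ` K" and ?O = "(\<lambda>g. \<rho> g b0) ` K"
  have one: "mat 1 \<in> K" unfolding K_def by (rule analytic_subgroup_props)
  obtain w where w: "w \<in> H" "\<forall>r\<in>?R. r w = w"
  proof (rule H_fixed_point[of ?R ?O])
    show "linear r" if "r \<in> ?R" for r using that K_G rho_linear by auto
    show "q (r x) (r x) = q x x" if "r \<in> ?R" "x \<in> V" for r x using that K_G rho_q by auto
    show "?O \<subseteq> H" using K_G rho_H b0_H by auto
    show "?O \<noteq> {}" using one by auto
    show "bounded ?O" by (rule K_orbit_bounded)
    show "r ` ?O \<subseteq> ?O" if r: "r \<in> ?R" for r
    proof -
      obtain g where g: "g \<in> K" "r = \<rho> g" using r by blast
      have "r (\<rho> h b0) \<in> ?O" if h: "h \<in> K" for h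
      proof -
        have "g ** h \<in> K" using g(1) h unfolding K_def by (rule analytic_subgroup_props(3))
        moreover have "r (\<rho> h b0) = \<rho> (g ** h) b0"
          using rho_mult[OF K_G[OF g(1)] K_G[OF h] b0(1)] g(2) by simp
        ultimately show ?thesis by blast
      qed
      then show ?thesis by blast
    qed
  qed
  have "X \<in> kst w" if X: "X \<in> k" for X
  proof -
    have Xg: "X \<in> \<gg>" using X by (simp add: k_iff)
    have "\<rho> (mexp (t *\<^sub>R X)) w = w" for t
      using w(2) k_scale[OF X] analytic_subgroup_props(2) unfolding K_def by blast
    moreover have "((\<lambda>t. \<rho> (mexp (t *\<^sub>R X)) w) has_vector_derivative d\<rho> X (\<rho> (mexp (0 *\<^sub>R X)) w)) (at 0)"
      by (rule drho_deriv[OF Xg H_V[OF w(1)]])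
    ultimately have "((\<lambda>t. w) has_vector_derivative d\<rho> X w) (at (0::real))"
      by (simp add: rho_one[OF H_V[OF w(1)]])
    moreover have "((\<lambda>t. w) has_vector_derivative 0) (at (0::real))" by simp
    ultimately have "d\<rho> X w = 0" by (rule vector_derivative_unique_at)
    then show ?thesis using Xg by (simp add: kst_def)
  qed
  then show ?thesis using that[OF w(1)] by blast
qed

text \<open>For \<open>X\<close> in the intersection, \<open>t \<mapsto> T (Ad (exp tX) Y) (Ad (exp tX) Y)\<close> is convex because \<open>ad X\<close> is
  \<open>T\<close>-symmetric, and bounded because \<open>exp tX\<close> fixes \<open>w\<close>; so it is constant.\<close>

lemma kst_inter_s:
  assumes w: "w \<in> H" and X: "X \<in> kst w" "X \<in> s"
  shows "X = 0"
proof (rule ccontr)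
  assume X0: "X \<noteq> 0"
  have Xg: "X \<in> \<gg>" "\<theta> X = - X" "d\<rho> X w = 0" using X by (auto simp: kst_def s_iff)
  \<comment> \<open>Commuting with the whole algebra will put \<open>X\<close> into the radical of
    the Killing form, against definiteness.\<close>
  have "bra X Y = 0" if Y: "Y \<in> \<gg>" for Y
  proof -
    let ?g = "\<lambda>t. Ad (mexp (t *\<^sub>R X)) Y"
    have g: "?g t \<in> \<gg>" for t by (rule Ad_closed[OF exp_G[OF Xg(1)] Y])
    have bg: "bra X (?g t) \<in> \<gg>" for t by (rule bra_closed[OF Xg(1) g])
    obtain M where M: "\<And>g. g \<in> G0 \<Longrightarrow> \<rho> g w = w \<Longrightarrow> norm (Ad g Y) \<le> M"
      by (rule stabilizer_Ad_bounded[OF w Y]) (rule that)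
    have Mg: "norm (?g t) \<le> M" for t
      by (rule M[OF exp_G[OF Xg(1)] flow_fix[OF Xg(1) H_V[OF w] Xg(3)]])
    obtain C where C: "C > 0" "\<And>x. T x x \<le> C * (norm x)\<^sup>2"
      by (rule bilinear_form_upper_bound[OF T_bilinear]) (rule that)
    have bd: "T (?g t) (?g t) \<le> C * M\<^sup>2" for t
      using C(2)[of "?g t"] power_mono[OF Mg[of t], of 2] C(1)
      by (meson mult_le_cancel_left_pos norm_ge_zero order_trans)
    have sym: "T (bra X Z) Z' = T Z (bra X Z')" if "Z \<in> \<gg>" "Z' \<in> \<gg>" for Z Z'
      using T_bra[OF that Xg(1)] Xg(2) bounded_bilinear.minus_right[OF T_bilinear] by (simp add: bra_simps)
    have d2: "((\<lambda>t. 2 * T (bra X (?g t)) (?g t)) has_real_derivative 4 * T (bra X (?g t)) (bra X (?g t))) (at t)" for t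
    proof -
      have b: "bounded_linear (bra X)"
        using linear_conv_bounded_linear[of "bra X"] by (simp add: linear_iff bra_simps)
      have "((\<lambda>t. T (bra X (?g t)) (?g t)) has_vector_derivative
        (T (bra X (?g t)) (bra X (?g t)) + T (bra X (bra X (?g t))) (?g t))) (at t)"
        by (rule bounded_bilinear.has_vector_derivative[OF T_bilinear
              bounded_linear.has_vector_derivative[OF b Ad_exp_has_vector_derivative] Ad_exp_has_vector_derivative])
      moreover have "T (bra X (bra X (?g t))) (?g t) = T (bra X (?g t)) (bra X (?g t))"
        by (rule sym[OF bg g])
      ultimately have "((\<lambda>t. T (bra X (?g t)) (?g t)) has_real_derivative
        2 * T (bra X (?g t)) (bra X (?g t))) (at t)"
        by (simp add: has_real_derivative_iff_has_vector_derivative)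
      from DERIV_cmult[OF this, of 2] show ?thesis by simp
    qed
    have nn: "T Z Z \<ge> 0" if "Z \<in> \<gg>" for Z
      using T_pos[OF that] bounded_bilinear.zero_left[OF T_bilinear] by (cases "Z = 0") auto
    have z: "2 * T (bra X (?g t)) (?g t) = 0" for t
      by (rule convex_bounded_deriv_0[OF T_Ad_derivative[OF Y Xg(1)] d2 _ bd]) (simp add: nn bg)
    \<comment> \<open>The first derivative vanishes identically, so the second does too; at 0 it is
      a multiple of the squared \<open>T\<close>-length of \<open>bra X Y\<close>.\<close>
    have "4 * T (bra X (?g 0)) (bra X (?g 0)) = 0"
    proof (rule DERIV_unique[OF d2[of 0]])
      show "((\<lambda>t. 2 * T (bra X (?g t)) (?g t)) has_real_derivative 0) (at 0)" unfolding z by simp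
    qed
    then have "T (bra X Y) (bra X Y) = 0" by simp
    then show ?thesis using T_pos[OF bra_closed[OF Xg(1) Y]] by force
  qed
  then have "killing \<gg> X (\<theta> X) = 0" by (rule killing_0) (assumption | rule theta(1)[OF Xg(1)])+
  then show False using theta(5)[OF Xg(1) X0] by simp
qed

text \<open>The component in \<open>s\<close> of an element of \<open>kst w\<close> lies again in
  \<open>kst w\<close>, hence vanishes, and \<open>k = kst w\<close> follows. Both \<open>s\<close>
  and \<open>sst w\<close> complement this subalgebra and are Killing-orthogonal to it; definiteness
  on \<open>k\<close> makes such a complement unique.\<close>

lemma k_s_standard:
  obtains w where "w \<in> H" "k = kst w" "s = sst w"
proof -
  obtain w where w: "w \<in> H" "k \<subseteq> kst w" by (rule K_fixed_point)
  have k: "k = kst w"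
  proof
    show "kst w \<subseteq> k"
    proof
      fix X assume X: "X \<in> kst w"
      then obtain Y Z where YZ: "Y \<in> k" "Z \<in> s" "X = Y + Z" using cartan_decomposition by (auto simp: kst_def)
      then have "Z = X - Y" by simp
      then have "Z \<in> kst w" using X YZ(1) w(2) subspace_kst by (auto intro: subspace_diff)
      then have "Z = 0" using kst_inter_s[OF w(1)] YZ by blast
      then show "X \<in> k" using YZ by simp
    qed
  qed (rule w)
  have null: "Y = 0" if Y: "Y \<in> k" and Z: "Z \<in> \<gg>" and a: "killing \<gg> Y (Y + Z) = 0" "killing \<gg> Y Z = 0" for Y Z
  proof -
    have Yg: "Y \<in> \<gg>" "\<theta> Y = Y" using Y by (auto simp: k_iff)
    have "killing \<gg> Y (1 *\<^sub>R Y + 1 *\<^sub>R Z) = killing \<gg> Y Y + killing \<gg> Y Z"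
      using killing_linear_right[OF Yg(1) Yg(1) Z, of 1 1] by simp
    then have "killing \<gg> Y Y = 0" using a by simp
    then show ?thesis using theta(5)[OF Yg(1)] Yg(2) by force
  qed
  have "s = sst w"
  proof
    show "s \<subseteq> sst w"
    proof
      fix X assume X: "X \<in> s"
      then have Xg: "X \<in> \<gg>" by (simp add: s_iff)
      obtain Y Z where YZ: "Y \<in> kst w" "Z \<in> sst w" "X = Y + Z" by (rule kst_sst_decomposition[OF w(1) Xg])
      have "killing \<gg> Y (Y + Z) = 0" using killing_k_s[of Y X] YZ k X by simp
      then have "Y = 0" using null[of Y Z] YZ k killing_kst_sst[OF w(1) YZ(1,2)] by (simp add: sst_def)
      then show "X \<in> sst w" using YZ by simp
    qed
    show "sst w \<subseteq> s"
    proof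
      fix X assume X: "X \<in> sst w"
      then have Xg: "X \<in> \<gg>" by (simp add: sst_def)
      obtain Y Z where YZ: "Y \<in> k" "Z \<in> s" "X = Y + Z" by (rule cartan_decomposition[OF Xg])
      have "killing \<gg> Y (Y + Z) = 0" using killing_kst_sst[OF w(1) _ X, of Y] YZ k by simp
      then have "Y = 0" using null[of Y Z] YZ k killing_k_s[OF YZ(1,2)] by (simp add: s_iff)
      then show "X \<in> s" using YZ by simp
    qed
  qed
  then show ?thesis using that[OF w(1) k] by blast
qed

end

section \<open>The triple decomposition\<close>

context lorentz_rep
begin

text \<open>The bracket of boosts with velocities \<open>u\<close> and \<open>v\<close> is an
  infinitesimal rotation in their plane; evaluated at \<open>u\<close> it vanishes only if
  \<open>v\<close> is a multiple of \<open>u\<close>.\<close>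

lemma sst_commute:
  assumes w: "w \<in> H" and X: "X \<in> sst w" "X \<noteq> 0" and Y: "Y \<in> sst w" and c: "bra X Y = 0"
  shows "Y \<in> span {X}"
proof -
  note wV = H_V[OF w]
  have g: "X \<in> \<gg>" "Y \<in> \<gg>" using X Y by (auto simp: sst_def)
  define u v where "u = d\<rho> X w" and "v = d\<rho> Y w"
  have uV: "u \<in> V" "q u w = 0" and vV: "v \<in> V" "q v w = 0"
    using drho_V[OF g(1) wV] drho_skew[OF g(1) wV wV] q_sym[of w "d\<rho> X w"]
      drho_V[OF g(2) wV] drho_skew[OF g(2) wV wV] q_sym[of w "d\<rho> Y w"] by (auto simp: u_def v_def)
  have fX: "d\<rho> X x = q u x *\<^sub>R w - q w x *\<^sub>R u" and fY: "d\<rho> Y x = q v x *\<^sub>R w - q w x *\<^sub>R v" if "x \<in> V" for x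
    using X Y that by (auto simp: sst_def u_def v_def)
  have "u \<noteq> 0" using sst_inj[OF X(1)] X(2) by (auto simp: u_def)
  then have uu: "q u u > 0" using q_pos_orthogonal[of w u] H_q[OF w] uV by simp
  have wu: "q w u = 0" using uV q_sym[of w u] by simp
  have "d\<rho> (bra X Y) u = q v u *\<^sub>R u - q u u *\<^sub>R v"
    using drho_bra[OF g uV(1)] fX[OF uV(1)] fY[OF uV(1)] wu
    by (simp add: drho_simps u_def v_def)
  then have "q u u *\<^sub>R v = q v u *\<^sub>R u" using c by (simp add: drho_simps)
  then have v: "v = (q v u / q u u) *\<^sub>R u" 
  proof -
    have "v = (1 / q u u) *\<^sub>R (q u u *\<^sub>R v)" using uu by simp
    also have "\<dots> = (q v u / q u u) *\<^sub>R u" unfolding \<open>q u u *\<^sub>R v = q v u *\<^sub>R u\<close> by simp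
    finally show ?thesis .
  qed
  have "Y - (q v u / q u u) *\<^sub>R X = 0"
  proof (rule sst_inj)
    show "Y - (q v u / q u u) *\<^sub>R X \<in> sst w"
      using X Y subspace_sst by (simp add: subspace_diff subspace_scale)
    show "d\<rho> (Y - (q v u / q u u) *\<^sub>R X) w = 0"
      using v by (simp add: drho_simps flip: u_def v_def)
  qed
  then show ?thesis by (auto simp: span_singleton)
qed

end

section \<open>The factorization as a statement about triples of points\<close>

context cartan_rep
begin

definition unit_dir where
  "unit_dir w X \<longleftrightarrow> X \<in> sst w \<and> q (d\<rho> X w) (d\<rho> X w) = 1"

definition KAH where
  "KAH a1 a2 a3 = {(k1 ** mexp X1 ** h, k2 ** mexp X2 ** h, k3 ** mexp X3 ** h) | k1 k2 k3 X1 X2 X3 h.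
     k1 \<in> K \<and> k2 \<in> K \<and> k3 \<in> K \<and> X1 \<in> a1 \<and> X2 \<in> a2 \<and> X3 \<in> a3 \<and> h \<in> G0}"

text \<open>For a unit direction \<open>X\<close> this describes the orbit of \<open>w\<close> under
  the exponentials of multiples of \<open>X\<close>.\<close>

definition on_line where
  "on_line w X z \<longleftrightarrow> (\<exists>t. z = cosh t *\<^sub>R w + sinh t *\<^sub>R d\<rho> X w)"

context
  fixes w assumes w: "w \<in> H" and kw: "k = kst w" and sw: "s = sst w"
begin

lemma K_eq: "K = {g \<in> G0. \<rho> g w = w}"
  unfolding K_def kw by (rule stabilizer_eq[OF w])

lemma unit_dir_props:
  assumes "unit_dir w X"
  shows "X \<in> \<gg>" "d\<rho> X w \<in> V" "q (d\<rho> X w) w = 0" "X \<noteq> 0"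
    "\<rho> (mexp (t *\<^sub>R X)) w = cosh t *\<^sub>R w + sinh t *\<^sub>R d\<rho> X w"
proof -
  show X: "X \<in> \<gg>" using assms by (simp add: unit_dir_def sst_def)
  show "d\<rho> X w \<in> V" "q (d\<rho> X w) w = 0"
    using drho_V[OF X H_V[OF w]] drho_skew[OF X H_V[OF w] H_V[OF w]] q_sym[of w "d\<rho> X w"] by auto
  show "X \<noteq> 0" using assms by (auto simp: unit_dir_def drho_simps q_simps)
  show "\<rho> (mexp (t *\<^sub>R X)) w = cosh t *\<^sub>R w + sinh t *\<^sub>R d\<rho> X w"
    using assms boost[OF _ w] by (simp add: unit_dir_def)
qed

lemma normalize_dir:
  assumes "X \<in> sst w" "X \<noteq> 0"
  obtains Y where "unit_dir w Y" "span {X} = span {Y}"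
proof -
  have X: "X \<in> \<gg>" using assms by (simp add: sst_def)
  define u where "u = d\<rho> X w"
  have "q u w = 0" using drho_skew[OF X H_V[OF w] H_V[OF w]] q_sym[of w "d\<rho> X w"] by (simp add: u_def)
  moreover have "u \<noteq> 0" using sst_inj assms by (auto simp: u_def)
  ultimately have uu: "q u u > 0" using q_pos_orthogonal[of w u] H_q[OF w] by simp
  show ?thesis
  proof (rule that[of "(1 / sqrt (q u u)) *\<^sub>R X"])
    show "unit_dir w ((1 / sqrt (q u u)) *\<^sub>R X)"
      using assms uu subspace_sst by (simp add: unit_dir_def drho_simps q_simps subspace_scale flip: u_def)
    show "span {X} = span {(1 / sqrt (q u u)) *\<^sub>R X}"
      using span_image_scale[of "{X}" "\<lambda>_. 1 / sqrt (q u u)"] uu by simp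
  qed
qed

lemma unit_dir_exists:
  assumes "u \<in> V" "q u w = 0" "q u u = 1"
  obtains X where "unit_dir w X" "d\<rho> X w = u"
  using sst_exists[OF w assms(1,2)] assms(3) unfolding unit_dir_def by blast

lemma frame_exists:
  obtains e f where "e \<in> V" "f \<in> V" "q e e = 1" "q f f = 1" "q e w = 0" "q f w = 0" "q f e = 0"
proof -
  obtain e where e: "e \<in> V" "q e e = 1" "q e w = 0"
    by (rule exists_q_orthogonal2[of w w]) (use H_V[OF w] H_q[OF w] in auto)
  obtain f where f: "f \<in> V" "q f f = 1" "q f w = 0" "q f e = 0"
    by (rule exists_q_orthogonal2[of w e]) (use H_V[OF w] H_q[OF w] e in auto)
  show ?thesis by (rule that[OF e(1) f(1) e(2) f(2) e(3) f(3,4)])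
qed

text \<open>Commuting boosts at \<open>w\<close> are proportional, so \<open>a\<close> is at most a
  line; it is not zero because nonzero boosts exist and the line through one is abelian.\<close>

lemma maximal_abelian:
  assumes "maximal_abelian_subspace s a"
  obtains X where "unit_dir w X" "a = span {X}"
proof -
  have a: "subspace a" "a \<subseteq> sst w" "\<And>X Y. X \<in> a \<Longrightarrow> Y \<in> a \<Longrightarrow> bra X Y = 0"
    and max: "\<And>b. abelian_subspace s b \<Longrightarrow> a \<subseteq> b \<Longrightarrow> b = a"
    using assms unfolding maximal_abelian_subspace_def abelian_subspace_def sw by auto
  have ab: "abelian_subspace s (span {X})" if "X \<in> sst w" for X
    unfolding abelian_subspace_def sw
  proof (intro conjI ballI)
    show "span {X} \<subseteq> sst w" using that subspace_sst by (intro span_minimal) auto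
    fix Y Z assume "Y \<in> span {X}" "Z \<in> span {X}"
    then obtain c d where "Y = c *\<^sub>R X" "Z = d *\<^sub>R X" by (auto simp: span_singleton)
    then show "bra Y Z = 0" by (simp add: bra_def cmat_mult_simps mult.commute)
  qed (rule subspace_span)
  have "\<exists>X\<in>a. X \<noteq> 0"
  proof (rule ccontr)
    assume "\<not> ?thesis"
    then have a0: "a \<subseteq> {0}" by auto
    obtain e f where e: "e \<in> V" "q e e = 1" "q e w = 0" by (rule frame_exists)
    obtain X where X: "unit_dir w X" by (rule unit_dir_exists[OF e(1,3,2)])
    have "a \<subseteq> span {X}" using a0 span_0[of "{X}"] by auto
    moreover have "abelian_subspace s (span {X})" using X by (intro ab) (simp add: unit_dir_def)
    ultimately have "span {X} = a" by (intro max)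
    then have "X \<in> a" using span_base[of X "{X}"] by simp
    then show False using a0 unit_dir_props(4)[OF X] by auto
  qed
  then obtain X where X: "X \<in> a" "X \<noteq> 0" by blast
  have "a = span {X}"
  proof
    show "a \<subseteq> span {X}" using sst_commute[OF w _ X(2)] a X(1) by blast
    show "span {X} \<subseteq> a" using X a(1) by (simp add: span_minimal)
  qed
  moreover obtain Y where "unit_dir w Y" "span {X} = span {Y}"
    by (rule normalize_dir[of X]) (use X a in auto)
  ultimately show ?thesis using that by simp
qed

text \<open>As \<open>K\<close> is the stabilizer of \<open>w\<close>, a group element is determined
  up to a left factor in \<open>K\<close> by the point to which its inverse moves \<open>w\<close>.
  The factorization says that \<open>h\<close> carries this point to \<open>mexp (- Y)\<close>
  applied to \<open>w\<close>.\<close>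

lemma on_line_iff:
  assumes X: "unit_dir w X" and g: "g \<in> G0" "h \<in> G0"
  shows "(\<exists>k\<in>K. \<exists>Y\<in>span {X}. g = k ** mexp Y ** h) \<longleftrightarrow> on_line w X (\<rho> h (\<rho> (matrix_inv g) w))"
proof
  note wV = H_V[OF w]
  define z where "z = \<rho> (matrix_inv g) w"
  have zV: "z \<in> V" using g wV by (simp add: z_def rho_V G_inv)
  have gz: "\<rho> g z = w" using g wV by (simp add: z_def rho_inv)
  have YG: "mexp (t *\<^sub>R X) \<in> G0" for t by (rule exp_G[OF unit_dir_props(1)[OF X]])
  {
    assume "\<exists>k\<in>K. \<exists>Y\<in>span {X}. g = k ** mexp Y ** h"
    then obtain k t where k: "k \<in> G0" "\<rho> k w = w" "g = k ** mexp (t *\<^sub>R X) ** h"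
      by (auto simp: K_eq span_singleton)
    have "\<rho> k (\<rho> (mexp (t *\<^sub>R X)) (\<rho> h z)) = w"
      using gz k YG g(2) zV by (simp add: rho_mult G_mult rho_V)
    then have "\<rho> (matrix_inv k) w = \<rho> (mexp (t *\<^sub>R X)) (\<rho> h z)"
      using rho_inv(1)[OF k(1) rho_V[OF YG rho_V[OF g(2) zV]], of t] by simp
    moreover have "\<rho> (matrix_inv k) w = w" using rho_inv(1)[OF k(1) wV] k(2) by simp
    ultimately have "\<rho> (matrix_inv (mexp (t *\<^sub>R X))) w = \<rho> h z"
      using rho_inv(1)[OF YG rho_V[OF g(2) zV], of t] by simp
    then have "\<rho> h z = \<rho> (mexp ((-t) *\<^sub>R X)) w" by (simp add: matrix_inv_mexp)
    then show "on_line w X (\<rho> h (\<rho> (matrix_inv g) w))"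
      unfolding on_line_def unit_dir_props(5)[OF X] z_def[symmetric] by blast
  next
    assume "on_line w X (\<rho> h (\<rho> (matrix_inv g) w))"
    then obtain t where t: "\<rho> h z = \<rho> (mexp (t *\<^sub>R X)) w"
      unfolding on_line_def unit_dir_props(5)[OF X] z_def[symmetric] by blast
    define k where "k = g ** matrix_inv h ** mexp (t *\<^sub>R X)"
    have kG: "k \<in> G0" using g YG by (simp add: k_def G_mult G_inv)
    have "\<rho> k w = \<rho> g (\<rho> (matrix_inv h) (\<rho> h z))"
      using g YG wV t by (simp add: k_def rho_mult G_mult G_inv rho_V)
    also have "\<dots> = w" using rho_inv(1)[OF g(2) zV] gz by simp
    finally have "k \<in> K" using kG by (simp add: K_eq)
    moreover have "k ** mexp (- (t *\<^sub>R X)) ** h = g ** (matrix_inv h ** (mexp (t *\<^sub>R X) ** mexp (- (t *\<^sub>R X))) ** h)"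
      by (simp add: k_def matrix_mul_assoc del: mexp_mult_minus)
    then have "g = k ** mexp (- (t *\<^sub>R X)) ** h" using g by (simp add: G_inv_left)
    moreover have "- (t *\<^sub>R X) \<in> span {X}" by (simp add: span_neg span_scale span_base)
    ultimately show "\<exists>k\<in>K. \<exists>Y\<in>span {X}. g = k ** mexp Y ** h" by blast
  }
qed

text \<open>By transitivity the inverses of \<open>g1\<close>, \<open>g2\<close>, \<open>g3\<close>
  move \<open>w\<close> to an arbitrary triple of points.\<close>

lemma KAH_iff:
  assumes X: "unit_dir w X1" "unit_dir w X2" "unit_dir w X3"
  shows "G0 \<times> G0 \<times> G0 = KAH (span {X1}) (span {X2}) (span {X3}) \<longleftrightarrow>
    (\<forall>z1\<in>H. \<forall>z2\<in>H. \<forall>z3\<in>H. \<exists>h\<in>G0. on_line w X1 (\<rho> h z1) \<and> on_line w X2 (\<rho> h z2) \<and> on_line w X3 (\<rho> h z3))"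
proof -
  have mem: "(g1, g2, g3) \<in> KAH (span {X1}) (span {X2}) (span {X3}) \<longleftrightarrow>
     (\<exists>h\<in>G0. on_line w X1 (\<rho> h (\<rho> (matrix_inv g1) w)) \<and> on_line w X2 (\<rho> h (\<rho> (matrix_inv g2) w)) \<and>
        on_line w X3 (\<rho> h (\<rho> (matrix_inv g3) w)))" if g: "g1 \<in> G0" "g2 \<in> G0" "g3 \<in> G0" for g1 g2 g3
  proof -
    have "(g1, g2, g3) \<in> KAH (span {X1}) (span {X2}) (span {X3}) \<longleftrightarrow>
      (\<exists>h\<in>G0. (\<exists>k\<in>K. \<exists>Y\<in>span {X1}. g1 = k ** mexp Y ** h) \<and> (\<exists>k\<in>K. \<exists>Y\<in>span {X2}. g2 = k ** mexp Y ** h) \<and>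
        (\<exists>k\<in>K. \<exists>Y\<in>span {X3}. g3 = k ** mexp Y ** h))"
      unfolding KAH_def by blast
    also have "\<dots> \<longleftrightarrow> (\<exists>h\<in>G0. on_line w X1 (\<rho> h (\<rho> (matrix_inv g1) w)) \<and> on_line w X2 (\<rho> h (\<rho> (matrix_inv g2) w)) \<and>
        on_line w X3 (\<rho> h (\<rho> (matrix_inv g3) w)))"
      by (intro bex_cong refl) (simp only: on_line_iff[OF X(1) g(1)] on_line_iff[OF X(2) g(2)] on_line_iff[OF X(3) g(3)])
    finally show ?thesis .
  qed
  have sub: "KAH (span {X1}) (span {X2}) (span {X3}) \<subseteq> G0 \<times> G0 \<times> G0"
  proof -
    have "mexp Y \<in> G0" if "unit_dir w X" "Y \<in> span {X}" for X Y
      using that exp_G[OF unit_dir_props(1)] by (auto simp: span_singleton)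
    then show ?thesis using X unfolding KAH_def by (auto simp: K_G G_mult)
  qed
  show ?thesis
  proof
    assume eq: "G0 \<times> G0 \<times> G0 = KAH (span {X1}) (span {X2}) (span {X3})"
    show "\<forall>z1\<in>H. \<forall>z2\<in>H. \<forall>z3\<in>H. \<exists>h\<in>G0. on_line w X1 (\<rho> h z1) \<and> on_line w X2 (\<rho> h z2) \<and> on_line w X3 (\<rho> h z3)"
    proof (intro ballI)
      fix z1 z2 z3 assume z: "z1 \<in> H" "z2 \<in> H" "z3 \<in> H"
      have "\<exists>g\<in>G0. \<rho> (matrix_inv g) w = z" if z: "z \<in> H" for z
      proof -
        obtain g where "g \<in> G0" "\<rho> g z = w" using G_transitive[OF z w] by blast
        then show ?thesis using rho_inv(1)[of g z] H_V[OF z] by auto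
      qed
      then obtain g1 g2 g3 where g: "g1 \<in> G0" "\<rho> (matrix_inv g1) w = z1" "g2 \<in> G0" "\<rho> (matrix_inv g2) w = z2"
        "g3 \<in> G0" "\<rho> (matrix_inv g3) w = z3" using z by metis
      then have "(g1, g2, g3) \<in> KAH (span {X1}) (span {X2}) (span {X3})" using eq by blast
      then show "\<exists>h\<in>G0. on_line w X1 (\<rho> h z1) \<and> on_line w X2 (\<rho> h z2) \<and> on_line w X3 (\<rho> h z3)"
        using mem[OF g(1,3,5)] g(2,4,6) by simp
    qed
  next
    assume a: "\<forall>z1\<in>H. \<forall>z2\<in>H. \<forall>z3\<in>H. \<exists>h\<in>G0. on_line w X1 (\<rho> h z1) \<and> on_line w X2 (\<rho> h z2) \<and> on_line w X3 (\<rho> h z3)"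
    have "(g1, g2, g3) \<in> KAH (span {X1}) (span {X2}) (span {X3})" if g: "g1 \<in> G0" "g2 \<in> G0" "g3 \<in> G0" for g1 g2 g3
    proof -
      have "\<rho> (matrix_inv g) w \<in> H" if "g \<in> G0" for g using that rho_H[OF G_inv w] by simp
      then show ?thesis using a g mem[OF g] by blast
    qed
    then show "G0 \<times> G0 \<times> G0 = KAH (span {X1}) (span {X2}) (span {X3})" using sub by auto
  qed
qed

lemma move_core:
  assumes X: "unit_dir w X1" "unit_dir w X2" "unit_dir w X3" and ind: "X2 \<notin> span {X1}" and sp: "X3 \<in> span {X1, X2}"
    and z: "z1 \<in> H" "z2 \<in> H" "z3 \<in> H"
  shows "\<exists>h\<in>G0. on_line w X1 (\<rho> h z1) \<and> on_line w X2 (\<rho> h z2) \<and> on_line w X3 (\<rho> h z3)"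
proof -
  obtain x y where xy: "X3 = x *\<^sub>R X1 + y *\<^sub>R X2"
    using sp by (auto simp: span_insert span_singleton algebra_simps)
  then have u3: "d\<rho> X3 w = x *\<^sub>R d\<rho> X1 w + y *\<^sub>R d\<rho> X2 w" by (simp add: drho_simps)
  have q1: "q (d\<rho> X w) (d\<rho> X w) = 1" if "unit_dir w X" for X using that by (simp add: unit_dir_def)
  have ne: "d\<rho> X2 w \<noteq> c *\<^sub>R d\<rho> X1 w" for c
  proof
    assume "d\<rho> X2 w = c *\<^sub>R d\<rho> X1 w"
    then have "d\<rho> (X2 - c *\<^sub>R X1) w = 0" by (simp add: drho_simps)
    moreover have "X2 - c *\<^sub>R X1 \<in> sst w"
      using X subspace_sst by (simp add: unit_dir_def subspace_diff subspace_scale)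
    ultimately have "X2 - c *\<^sub>R X1 = 0" using sst_inj by blast
    then show False using ind by (auto simp: span_singleton)
  qed
  have "(q (d\<rho> X1 w) (d\<rho> X2 w))\<^sup>2 < 1"
    by (rule q_unit_abs_lt[OF w]) (use X unit_dir_props q1 ne[of 1] ne[of "-1"] in auto)
  from triangle_move[OF z w unit_dir_props(2)[OF X(1)] unit_dir_props(2)[OF X(2)] q1[OF X(1)] q1[OF X(2)] q1[OF X(3)]
      unit_dir_props(3)[OF X(1)] unit_dir_props(3)[OF X(2)] this u3]
  show ?thesis unfolding on_line_def .
qed

lemma KAH_iff_dim:
  assumes X: "unit_dir w X1" "unit_dir w X2" "unit_dir w X3"
  shows "G0 \<times> G0 \<times> G0 = KAH (span {X1}) (span {X2}) (span {X3}) \<longleftrightarrow> dim {X1, X2, X3} = 2"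
  unfolding KAH_iff[OF X]
proof
  note wV = H_V[OF w]
  have dim: "dim {X1, X2, X3} = 1 + (if X2 \<in> span {X1} then 0 else 1) + (if X3 \<in> span {X1, X2} then 0 else 1)"
    by (rule dim_three[OF unit_dir_props(4)[OF X(1)]])
  {
    assume d2: "dim {X1, X2, X3} = 2"
    show "\<forall>z1\<in>H. \<forall>z2\<in>H. \<forall>z3\<in>H. \<exists>h\<in>G0. on_line w X1 (\<rho> h z1) \<and> on_line w X2 (\<rho> h z2) \<and> on_line w X3 (\<rho> h z3)"
    proof (cases "X2 \<in> span {X1}")
      case False
      then have "X3 \<in> span {X1, X2}" by (rule_tac ccontr) (use d2 dim in simp)
      then show ?thesis using move_core[OF X False] by blast
    next
      case True
      \<comment> \<open>The second line coincides with the first, so the first and the third form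
        the independent pair.\<close>
      then have "X3 \<notin> span {X1, X2}" by (rule_tac notI) (use d2 dim in simp)
      then have "X3 \<notin> span {X1}" using span_mono[of "{X1}" "{X1, X2}"] by auto
      moreover have "X2 \<in> span {X1, X3}" using True span_mono[of "{X1}" "{X1, X3}"] by auto
      ultimately show ?thesis using move_core[OF X(1,3,2)] by blast
    qed
  next
    assume a: "\<forall>z1\<in>H. \<forall>z2\<in>H. \<forall>z3\<in>H. \<exists>h\<in>G0. on_line w X1 (\<rho> h z1) \<and> on_line w X2 (\<rho> h z2) \<and> on_line w X3 (\<rho> h z3)"
    obtain e f where ef: "e \<in> V" "f \<in> V" "q e e = 1" "q f f = 1" "q e w = 0" "q f w = 0" "q f e = 0"
      by (rule frame_exists)
    have ray: "cosh t *\<^sub>R w + sinh t *\<^sub>R u \<in> H" if u: "u \<in> V" "q u u = 1" "q u w = 0" for t u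
    proof -
      obtain Y where Y: "unit_dir w Y" "d\<rho> Y w = u" by (rule unit_dir_exists[OF u(1,3,2)])
      then show ?thesis using unit_dir_props(5)[OF Y(1), of t] rho_H[OF exp_G[OF unit_dir_props(1)[OF Y(1)]] w, of t] by simp
    qed
    have sinh1: "sinh (1::real) \<noteq> 0" by simp
    show "dim {X1, X2, X3} = 2"
    proof (rule ccontr)
      assume "dim {X1, X2, X3} \<noteq> 2"
      then consider "X2 \<in> span {X1}" "X3 \<in> span {X1, X2}" | "X2 \<notin> span {X1}" "X3 \<notin> span {X1, X2}"
        using dim by (auto split: if_splits)
      then show False
      proof cases
        case 1
        have "span {X1, X2} = span {X1}" using 1(1) by (metis insert_commute span_redundant)
        then have sp: "X \<in> span {X1}" if "X \<in> {X1, X2, X3}" for X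
          using 1 that span_base[of X1 "{X1}"] by auto
        \<comment> \<open>The three test points span a space of dimension three, while points on a
          single geodesic lie in a two-dimensional subspace.\<close>
        obtain h where h: "h \<in> G0" "on_line w X1 (\<rho> h w)" "on_line w X2 (\<rho> h (cosh 1 *\<^sub>R w + sinh 1 *\<^sub>R e))"
          "on_line w X3 (\<rho> h (cosh 1 *\<^sub>R w + sinh 1 *\<^sub>R f))"
          using a w ray[OF ef(1,3,5)] ray[OF ef(2,4,6)] by blast
        define u where "u = d\<rho> X1 w"
        have uV: "u \<in> V" unfolding u_def by (rule unit_dir_props(2)[OF X(1)])
        have line: "v \<in> span {w, u}" if ol: "on_line w X' v" "X' \<in> {X1, X2, X3}" for X' v
        proof -
          obtain c where "X' = c *\<^sub>R X1" using sp[OF ol(2)] by (auto simp: span_singleton)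
          then have "d\<rho> X' w = c *\<^sub>R u" by (simp add: drho_simps u_def)
          then obtain t where "v = cosh t *\<^sub>R w + sinh t *\<^sub>R (c *\<^sub>R u)" using ol(1) unfolding on_line_def by auto
          moreover have "w \<in> span {w, u}" "u \<in> span {w, u}" by (simp_all add: span_base)
          ultimately show ?thesis by (simp add: span_add span_scale)
        qed
        define r where "r = \<rho> (matrix_inv h)"
        have lr: "linear r" unfolding r_def using h by (simp add: rho_linear G_inv)
        define S where "S = span {r w, r u}"
        have pull: "v \<in> S" if "v \<in> V" "\<rho> h v \<in> span {w, u}" for v
        proof -
          have "r (\<rho> h v) \<in> r ` span {w, u}" using that by blast
          also have "r ` span {w, u} = S" unfolding S_def using linear_span_image[OF lr, of "{w, u}"] by simp
          finally show ?thesis using rho_inv(1)[OF h(1) that(1)] by (simp add: r_def)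
        qed
        have z: "w \<in> S" "cosh 1 *\<^sub>R w + sinh 1 *\<^sub>R e \<in> S" "cosh 1 *\<^sub>R w + sinh 1 *\<^sub>R f \<in> S"
          using pull line[OF h(2)] line[OF h(3)] line[OF h(4)] ef wV subspace_V
          by (simp_all add: subspace_add subspace_scale)
        have *: "v \<in> S" if "cosh 1 *\<^sub>R w + sinh 1 *\<^sub>R v \<in> S" for v
        proof -
          have "(1 / sinh 1) *\<^sub>R ((cosh 1 *\<^sub>R w + sinh 1 *\<^sub>R v) - cosh 1 *\<^sub>R w) \<in> S"
            using that z(1) unfolding S_def by (intro span_scale span_diff) auto
          then show ?thesis by simp
        qed
        have "{w, e, f} \<subseteq> S" using z * by auto
        then have "dim {w, e, f} \<le> dim S" by (rule dim_subset)
        also have "\<dots> \<le> card {r w, r u}" unfolding S_def by (simp add: dim_le_card')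
        also have "\<dots> \<le> 2" by (simp add: card_insert_if)
        finally show False using dim_frame[OF w ef(3,4,5,6,7)] by simp
      next
        case 2
        have e': "- e \<in> V" "q (- e) (- e) = 1" "q (- e) w = 0" using ef subspace_V by (auto simp: q_simps subspace_neg)
        \<comment> \<open>Test points on one geodesic with \<open>w\<close> as midpoint: the outer
          two add up to \<open>2 * cosh 1\<close> times the middle one. Independence of the
          directions turns this relation into the vanishing of all displacements, which would send
          distinct points to \<open>w\<close>.\<close>
        obtain h where h: "h \<in> G0" "on_line w X1 (\<rho> h w)" "on_line w X2 (\<rho> h (cosh 1 *\<^sub>R w + sinh 1 *\<^sub>R e))"
          "on_line w X3 (\<rho> h (cosh 1 *\<^sub>R w + sinh 1 *\<^sub>R (- e)))"
          using a w ray[OF ef(1,3,5)] ray[OF e'] by blast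
        define u1 u2 u3 where "u1 = d\<rho> X1 w" and "u2 = d\<rho> X2 w" and "u3 = d\<rho> X3 w"
        have uw: "q u1 w = 0" "q u2 w = 0" "q u3 w = 0"
          using unit_dir_props(3) X by (auto simp: u1_def u2_def u3_def)
        obtain t1 t2 t3 where t: "\<rho> h w = cosh t1 *\<^sub>R w + sinh t1 *\<^sub>R u1"
          "\<rho> h (cosh 1 *\<^sub>R w + sinh 1 *\<^sub>R e) = cosh t2 *\<^sub>R w + sinh t2 *\<^sub>R u2"
          "\<rho> h (cosh 1 *\<^sub>R w + sinh 1 *\<^sub>R (- e)) = cosh t3 *\<^sub>R w + sinh t3 *\<^sub>R u3"
          using h(2-4) unfolding on_line_def u1_def u2_def u3_def by blast
        define C where "C = 2 * cosh (1::real)"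
        have rel: "(cosh t2 *\<^sub>R w + sinh t2 *\<^sub>R u2) + (cosh t3 *\<^sub>R w + sinh t3 *\<^sub>R u3) = C *\<^sub>R (cosh t1 *\<^sub>R w + sinh t1 *\<^sub>R u1)"
        proof -
          have "\<rho> h (cosh 1 *\<^sub>R w + sinh 1 *\<^sub>R e) + \<rho> h (cosh 1 *\<^sub>R w + sinh 1 *\<^sub>R (- e)) = C *\<^sub>R \<rho> h w"
            using rho_linear[OF h(1)] by (simp add: linear_add linear_diff linear_scale C_def scaleR_2[symmetric])
          then show ?thesis unfolding t .
        qed
        define D where "D = cosh t2 + cosh t3 - C * cosh t1"
        have rel': "D *\<^sub>R w + (sinh t2 *\<^sub>R u2 + sinh t3 *\<^sub>R u3 - (C * sinh t1) *\<^sub>R u1) = 0"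
          using rel by (simp add: D_def algebra_simps)
        have "q (D *\<^sub>R w + (sinh t2 *\<^sub>R u2 + sinh t3 *\<^sub>R u3 - (C * sinh t1) *\<^sub>R u1)) w = - D"
          using uw H_q[OF w] by (simp add: q_simps)
        then have "D = 0" unfolding rel' by (simp add: q_simps)
        then have relu: "sinh t2 *\<^sub>R u2 + sinh t3 *\<^sub>R u3 - (C * sinh t1) *\<^sub>R u1 = 0" using rel' by simp
        have "sinh t2 *\<^sub>R X2 + sinh t3 *\<^sub>R X3 - (C * sinh t1) *\<^sub>R X1 = 0"
        proof (rule sst_inj)
          show "sinh t2 *\<^sub>R X2 + sinh t3 *\<^sub>R X3 - (C * sinh t1) *\<^sub>R X1 \<in> sst w"
            using X subspace_sst by (simp add: unit_dir_def subspace_add subspace_diff subspace_scale)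
          show "d\<rho> (sinh t2 *\<^sub>R X2 + sinh t3 *\<^sub>R X3 - (C * sinh t1) *\<^sub>R X1) w = 0"
            using relu by (simp add: drho_simps u1_def u2_def u3_def)
        qed
        then have r3: "sinh t3 *\<^sub>R X3 = (C * sinh t1) *\<^sub>R X1 - sinh t2 *\<^sub>R X2" by (simp add: algebra_simps)
        have s3: "sinh t3 = 0"
        proof (rule ccontr)
          assume n: "sinh t3 \<noteq> 0"
          have "(C * sinh t1) *\<^sub>R X1 - sinh t2 *\<^sub>R X2 \<in> span {X1, X2}"
            by (intro span_diff span_scale span_base) auto
          then have "sinh t3 *\<^sub>R X3 \<in> span {X1, X2}" using r3 by simp
          then have "X3 \<in> span {X1, X2}" using span_scale[of "sinh t3 *\<^sub>R X3" "{X1, X2}" "1 / sinh t3"] n by simp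
          then show False using 2 by simp
        qed
        have r2: "sinh t2 *\<^sub>R X2 = (C * sinh t1) *\<^sub>R X1" using r3 s3 by simp
        have s2: "sinh t2 = 0"
        proof (rule ccontr)
          assume n: "sinh t2 \<noteq> 0"
          have "sinh t2 *\<^sub>R X2 \<in> span {X1}" unfolding r2 by (intro span_scale span_base) auto
          then have "X2 \<in> span {X1}" using span_scale[of "sinh t2 *\<^sub>R X2" "{X1}" "1 / sinh t2"] n by simp
          then show False using 2 by simp
        qed
        have "C * sinh t1 = 0" using r2 s2 unit_dir_props(4)[OF X(1)] by simp
        then have "sinh t1 = 0" by (simp add: C_def)
        then have "\<rho> h w = w" "\<rho> h (cosh 1 *\<^sub>R w + sinh 1 *\<^sub>R e) = w" using t s2 by simp_all
        then have "q w w = q (cosh 1 *\<^sub>R w + sinh 1 *\<^sub>R e) w"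
          using rho_q[OF h(1), of "cosh 1 *\<^sub>R w + sinh 1 *\<^sub>R e" w] ef wV subspace_V
          by (simp add: subspace_add subspace_scale)
        then have "cosh 1 = (1::real)" using H_q[OF w] ef by (simp add: q_simps)
        then show False by simp
      qed
    qed
  }
qed

end

end

lemma sum_of_lines: "{Y1 + Y2 + Y3 | Y1 Y2 Y3. Y1 \<in> span {X1} \<and> Y2 \<in> span {X2} \<and> Y3 \<in> span {X3}} = span {X1, X2, X3}"
proof -
  have "span {X1, X2, X3} = span ({X1} \<union> {X2} \<union> {X3})" by (simp add: insert_commute)
  then show ?thesis unfolding span_Un by fastforce
qed

lemma (in cartan_rep) triple_decomposition:
  "(\<forall>a1 a2 a3.
            maximal_abelian_subspace (cartan_s (lie_algebra G0) \<theta>) a1 \<and>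
            maximal_abelian_subspace (cartan_s (lie_algebra G0) \<theta>) a2 \<and>
            maximal_abelian_subspace (cartan_s (lie_algebra G0) \<theta>) a3 \<longrightarrow>
            (G0 \<times> G0 \<times> G0 =
               {(k1 ** mexp X1 ** h, k2 ** mexp X2 ** h, k3 ** mexp X3 ** h) | k1 k2 k3 X1 X2 X3 h.
                  k1 \<in> analytic_subgroup (cartan_k (lie_algebra G0) \<theta>) \<and>
                  k2 \<in> analytic_subgroup (cartan_k (lie_algebra G0) \<theta>) \<and>
                  k3 \<in> analytic_subgroup (cartan_k (lie_algebra G0) \<theta>) \<and>
                  X1 \<in> a1 \<and> X2 \<in> a2 \<and> X3 \<in> a3 \<and> h \<in> G0})
            \<longleftrightarrow> dim {X1 + X2 + X3 | X1 X2 X3. X1 \<in> a1 \<and> X2 \<in> a2 \<and> X3 \<in> a3} = 2)" (is ?maximal)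
  "\<exists>a :: ('b cmat \<times> 'b cmat \<times> 'b cmat) set.
            subspace a \<and>
            (\<forall>(X1, X2, X3)\<in>a. X1 \<in> cartan_s (lie_algebra G0) \<theta> \<and>
                X2 \<in> cartan_s (lie_algebra G0) \<theta> \<and> X3 \<in> cartan_s (lie_algebra G0) \<theta>) \<and>
            (\<forall>(X1, X2, X3)\<in>a. \<forall>(Y1, Y2, Y3)\<in>a. bra X1 Y1 = 0 \<and> bra X2 Y2 = 0 \<and> bra X3 Y3 = 0) \<and>
            G0 \<times> G0 \<times> G0 =
               {(k1 ** mexp X1 ** h, k2 ** mexp X2 ** h, k3 ** mexp X3 ** h) | k1 k2 k3 X1 X2 X3 h.
                  k1 \<in> analytic_subgroup (cartan_k (lie_algebra G0) \<theta>) \<and>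
                  k2 \<in> analytic_subgroup (cartan_k (lie_algebra G0) \<theta>) \<and>
                  k3 \<in> analytic_subgroup (cartan_k (lie_algebra G0) \<theta>) \<and>
                  (X1, X2, X3) \<in> a \<and> h \<in> G0}" (is ?exists)
proof -
  obtain w where w: "w \<in> H" "k = kst w" "s = sst w" by (rule k_s_standard)
  show ?maximal
    unfolding s_def[symmetric] k_def[symmetric] K_def[symmetric] KAH_def[symmetric]
  proof (intro allI impI, elim conjE)
    fix a1 a2 a3
    assume "maximal_abelian_subspace s a1" "maximal_abelian_subspace s a2" "maximal_abelian_subspace s a3"
    then obtain X1 X2 X3 where X: "unit_dir w X1" "a1 = span {X1}" "unit_dir w X2" "a2 = span {X2}"
      "unit_dir w X3" "a3 = span {X3}" using maximal_abelian[OF w] by metis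
    show "(G0 \<times> G0 \<times> G0 = KAH a1 a2 a3) \<longleftrightarrow> dim {X1 + X2 + X3 | X1 X2 X3. X1 \<in> a1 \<and> X2 \<in> a2 \<and> X3 \<in> a3} = 2"
      unfolding X(2,4,6) sum_of_lines dim_span by (rule KAH_iff_dim[OF w X(1,3,5)])
  qed
  \<comment> \<open>The existence claim is witnessed by the directions \<open>e\<close>,
    \<open>f\<close>, \<open>f\<close>, whose span is a plane.\<close>
  obtain e f where ef: "e \<in> V" "f \<in> V" "q e e = 1" "q f f = 1" "q e w = 0" "q f w = 0" "q f e = 0"
    by (rule frame_exists[OF w])
  obtain X where X: "unit_dir w X" "d\<rho> X w = e" by (rule unit_dir_exists[OF w ef(1,5,3)])
  obtain Y where Y: "unit_dir w Y" "d\<rho> Y w = f" by (rule unit_dir_exists[OF w ef(2,6,4)])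
  have "Y \<notin> span {X}"
  proof
    assume "Y \<in> span {X}"
    then obtain c where "Y = c *\<^sub>R X" by (auto simp: span_singleton)
    then have "f = c *\<^sub>R e" using X(2) Y(2) by (simp add: drho_simps)
    then have "q f f = c * q f e" by (simp add: q_simps)
    then show False using ef by simp
  qed
  then have "dim {X, Y, Y} = 2"
    using dim_three[OF unit_dir_props(4)[OF w X(1)], of Y Y] by (simp add: span_base)
  then have eq: "G0 \<times> G0 \<times> G0 = KAH (span {X}) (span {Y}) (span {Y})"
    using KAH_iff_dim[OF w X(1) Y(1) Y(1)] by blast
  define a where "a = span {X} \<times> span {Y} \<times> span {Y}"
  have line: "Z \<in> s" if "Z \<in> span {W}" "unit_dir w W" for Z W
    using that span_minimal[of "{W}" "sst w"] subspace_sst w(3) by (auto simp: unit_dir_def)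
  have comm: "bra Z Z' = 0" if "Z \<in> span {W}" "Z' \<in> span {W}" for Z Z' W :: "'b cmat"
    using that by (auto simp: span_singleton bra_def cmat_mult_simps mult.commute)
  show ?exists
    unfolding s_def[symmetric] k_def[symmetric] K_def[symmetric]
  proof (intro exI[of _ a] conjI)
    show "subspace a" unfolding a_def by (intro subspace_Times subspace_span)
    show "\<forall>(X1, X2, X3)\<in>a. X1 \<in> s \<and> X2 \<in> s \<and> X3 \<in> s"
      using line X(1) Y(1) by (auto simp: a_def)
    show "\<forall>(X1, X2, X3)\<in>a. \<forall>(Y1, Y2, Y3)\<in>a. bra X1 Y1 = 0 \<and> bra X2 Y2 = 0 \<and> bra X3 Y3 = 0"
      using comm by (auto simp: a_def)
    show "G0 \<times> G0 \<times> G0 = {(k1 ** mexp X1 ** h, k2 ** mexp X2 ** h, k3 ** mexp X3 ** h) | k1 k2 k3 X1 X2 X3 h.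
                  k1 \<in> K \<and> k2 \<in> K \<and> k3 \<in> K \<and> (X1, X2, X3) \<in> a \<and> h \<in> G0}"
      unfolding eq KAH_def a_def by auto
  qed
qed

section \<open>The groups SL(2,R) and SL(2,C)\<close>

text \<open>Differentiation at 0. With the imaginary part of an entry as \<open>f\<close> it shows
  that a one-parameter group of real matrices has a real generator.\<close>

lemma bounded_linear_curve_const:
  fixes X :: "'n::finite cmat"
  assumes f: "bounded_linear f" and c: "\<And>t. f (mexp (t *\<^sub>R X)) = c"
  shows "f X = 0"
proof -
  have "((\<lambda>t. f (mexp (t *\<^sub>R X))) has_vector_derivative f (X ** mexp (0 *\<^sub>R X))) (at 0)"
    by (rule bounded_linear.has_vector_derivative[OF f mexp_has_vector_derivative])
  then have "((\<lambda>t. c) has_vector_derivative f X) (at (0::real))" unfolding c by simp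
  moreover have "((\<lambda>t. c) has_vector_derivative 0) (at (0::real))" by simp
  ultimately show ?thesis by (rule vector_derivative_unique_at)
qed

lemma bounded_linear_Im_entry: "bounded_linear (\<lambda>A::'n::finite cmat. Im (A $ a $ b))"
  by (rule bounded_linear_compose[OF bounded_linear_Im bounded_linear_entry])

lemma real_mat_mult: "real_mat A \<Longrightarrow> real_mat B \<Longrightarrow> real_mat (A ** B)"
  by (auto simp: real_mat_def matrix_matrix_mult_def)

lemma real_mat_one: "real_mat (mat 1)"
  by (auto simp: real_mat_def mat_def)

lemma real_mat_matpow: "real_mat X \<Longrightarrow> real_mat (matpow X k)"
  by (induction k) (auto simp: real_mat_mult real_mat_one)

lemma real_mat_mexp: "real_mat X \<Longrightarrow> real_mat (mexp X)"
proof -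
  assume X: "real_mat X"
  have "Im (mexp X $ a $ b) = 0" for a b
  proof -
    have "Im (matpow X k $ a $ b) = 0" for k
      using real_mat_matpow[OF X, of k] by (auto simp: real_mat_def complex_is_Real_iff)
    then show ?thesis
      by (subst bounded_linear_suminf_mexp(1)[OF bounded_linear_Im_entry]) simp
  qed
  then show ?thesis by (simp add: real_mat_def complex_is_Real_iff)
qed

lemma real_mat_scaleR: "real_mat X \<Longrightarrow> real_mat (c *\<^sub>R X)"
  by (auto simp: real_mat_def complex_is_Real_iff)

lemma real_mat_if_exp:
  assumes "\<And>t. real_mat (mexp (t *\<^sub>R X))" shows "real_mat X"
proof -
  have "Im (X $ a $ b) = 0" for a b
    by (rule bounded_linear_curve_const[OF bounded_linear_Im_entry, where c = 0])
      (use assms in \<open>auto simp: real_mat_def complex_is_Real_iff\<close>)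
  then show ?thesis by (simp add: real_mat_def complex_is_Real_iff)
qed

definition ct :: "'n::finite cmat \<Rightarrow> 'n cmat" where
  "ct A = (\<chi> a b. cnj (A $ b $ a))"

lemma ct_nth [simp]: "ct A $ a $ b = cnj (A $ b $ a)"
  by (simp add: ct_def)

lemma ct_mult: "ct (A ** B) = ct B ** ct A"
  by (simp add: vec_eq_iff matrix_matrix_mult_def mult.commute)

lemma ct_linear: "ct (A + B) = ct A + ct B" "ct (c *\<^sub>R A) = c *\<^sub>R ct A" "ct (A - B) = ct A - ct B"
  by (simp_all add: vec_eq_iff)

lemma ct_one [simp]: "ct (mat 1) = mat 1"
  by (auto simp: vec_eq_iff mat_def)

lemma bounded_linear_ct: "bounded_linear (ct :: 'n::finite cmat \<Rightarrow> 'n cmat)"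
  using linear_conv_bounded_linear[of "ct :: 'n cmat \<Rightarrow> 'n cmat"] by (simp add: linear_iff ct_linear)

lemma congruence_flow:
  fixes X x :: "'n::finite cmat"
  shows "((\<lambda>t. mexp (t *\<^sub>R X) ** x ** ct (mexp (t *\<^sub>R X))) has_vector_derivative
     X ** (mexp (t *\<^sub>R X) ** x ** ct (mexp (t *\<^sub>R X))) + (mexp (t *\<^sub>R X) ** x ** ct (mexp (t *\<^sub>R X))) ** ct X) (at t)"
proof -
  have 1: "((\<lambda>t. mexp (t *\<^sub>R X) ** x) has_vector_derivative (X ** mexp (t *\<^sub>R X)) ** x) (at t)"
    by (rule bounded_linear.has_vector_derivative[OF
          bounded_bilinear.bounded_linear_left[OF bounded_bilinear_matrix_mult] mexp_has_vector_derivative])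
  have 2: "((\<lambda>t. ct (mexp (t *\<^sub>R X))) has_vector_derivative ct (X ** mexp (t *\<^sub>R X))) (at t)"
    by (rule bounded_linear.has_vector_derivative[OF bounded_linear_ct mexp_has_vector_derivative])
  from bounded_bilinear.has_vector_derivative[OF bounded_bilinear_matrix_mult 1 2]
  show ?thesis by (simp add: ct_mult matrix_mul_assoc add.commute)
qed

text \<open>The set \<open>R\<close> of admissible entries treats the real and the complex group
  together; \<open>i\<close> and \<open>j\<close> name the two elements of an abstract index
  type.\<close>

locale sl2 =
  fixes i j :: "'n::finite" and R :: "complex set"
  assumes ij: "i \<noteq> j" "UNIV = {i, j}" and R: "R = \<real> \<or> R = UNIV"
begin

lemma sum2: "(\<Sum>k\<in>UNIV. f k) = f i + f j" for f :: "'n \<Rightarrow> 'a::comm_monoid_add"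
  unfolding ij(2) using ij(1) by simp

lemma prod2: "(\<Prod>k\<in>UNIV. f k) = f i * f j" for f :: "'n \<Rightarrow> 'a::comm_monoid_mult"
  unfolding ij(2) using ij(1) by simp

lemma all2: "(\<forall>k. P k) \<longleftrightarrow> P i \<and> P j" for P :: "'n \<Rightarrow> bool"
  using ij(2) by (metis (full_types) UNIV_I insert_iff singletonD)

lemma mat_eq: "A = B \<longleftrightarrow> A$i$i = B$i$i \<and> A$i$j = B$i$j \<and> A$j$i = B$j$i \<and> A$j$j = B$j$j" for A B :: "'n cmat"
  by (simp add: vec_eq_iff all2)

lemma mult_nth: "(A ** B) $ a $ b = A$a$i * B$i$b + A$a$j * B$j$b" for A B :: "'n cmat"
  by (simp add: matrix_matrix_mult_def sum2)

lemma mat_one_nth [simp]: "(mat 1 :: 'n cmat)$i$i = 1" "(mat 1 :: 'n cmat)$i$j = 0"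
  "(mat 1 :: 'n cmat)$j$i = 0" "(mat 1 :: 'n cmat)$j$j = 1"
  using ij by (auto simp: mat_def)

lemma det_eq: "det A = A$i$i * A$j$j - A$i$j * A$j$i" for A :: "'n cmat"
proof -
  have "{p. p permutes (UNIV :: 'n set)} = {id, Transposition.transpose i j}"
    unfolding ij(2) by (auto simp: permutes_doubleton_iff)
  moreover have "id \<noteq> Transposition.transpose i j"
    using ij(1) by (metis id_apply transpose_apply_first)
  ultimately show ?thesis
    unfolding det_def using ij(1) by (simp add: sign_swap_id sign_id prod2)
qed

definition mk :: "complex \<Rightarrow> complex \<Rightarrow> complex \<Rightarrow> complex \<Rightarrow> 'n cmat" where
  "mk a b c d = (\<chi> k l. if k = i then (if l = i then a else b) else (if l = i then c else d))"

lemma mk_nth [simp]: "mk a b c d $i$i = a" "mk a b c d $i$j = b" "mk a b c d $j$i = c" "mk a b c d $j$j = d"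
  using ij(1) by (auto simp: mk_def)

definition RM :: "'n cmat \<Rightarrow> bool" where
  "RM A \<longleftrightarrow> A$i$i \<in> R \<and> A$i$j \<in> R \<and> A$j$i \<in> R \<and> A$j$j \<in> R"

lemma R_closed: "0 \<in> R" "1 \<in> R" "x \<in> R \<Longrightarrow> y \<in> R \<Longrightarrow> x + y \<in> R" "x \<in> R \<Longrightarrow> y \<in> R \<Longrightarrow> x - y \<in> R"
  "x \<in> R \<Longrightarrow> y \<in> R \<Longrightarrow> x * y \<in> R" "x \<in> R \<Longrightarrow> - x \<in> R" "x \<in> R \<Longrightarrow> cnj x \<in> R" "x \<in> R \<Longrightarrow> c *\<^sub>R x \<in> R"
  "of_real r \<in> R" "x \<in> R \<Longrightarrow> of_real r * x \<in> R"
  using R by (auto simp: scaleR_conv_of_real) (auto simp: Reals_cnj_iff)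

lemma RM_closed: "RM A \<Longrightarrow> RM B \<Longrightarrow> RM (A ** B)" "RM A \<Longrightarrow> RM (ct A)" "RM (mat 1)"
  "RM A \<Longrightarrow> RM B \<Longrightarrow> RM (A + B)" "RM A \<Longrightarrow> RM B \<Longrightarrow> RM (A - B)" "RM A \<Longrightarrow> RM (c *\<^sub>R A)" "RM 0"
  by (simp_all add: RM_def mult_nth R_closed)

lemma RM_real: "R = \<real> \<Longrightarrow> RM A \<longleftrightarrow> real_mat A" "R = UNIV \<Longrightarrow> RM A"
  unfolding RM_def real_mat_def all2 by auto

definition G :: "'n cmat set" where "G = {g. RM g \<and> det g = 1}"
definition \<ll> :: "'n cmat set" where "\<ll> = {X. RM X \<and> X$i$i + X$j$j = 0}"
definition V :: "'n cmat set" where "V = {x. RM x \<and> ct x = x}"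
text \<open>The identity scaled to Euclidean norm 1; this scale makes \<open>q x x\<close> equal to
  minus twice the determinant.\<close>

definition b0 :: "'n cmat" where "b0 = (1 / sqrt 2) *\<^sub>R mat 1"

lemma det_mexp_derivative:
  "((\<lambda>t. det (mexp (t *\<^sub>R X))) has_vector_derivative (X$i$i + X$j$j) * det (mexp (t *\<^sub>R X))) (at t)"
  for X :: "'n cmat"
proof -
  have d: "((\<lambda>t. mexp (t *\<^sub>R X) $ a $ b) has_vector_derivative (X ** mexp (t *\<^sub>R X)) $ a $ b) (at t)" for a b
    by (rule bounded_linear.has_vector_derivative[OF bounded_linear_entry mexp_has_vector_derivative])
  have "((\<lambda>t. mexp (t *\<^sub>R X)$i$i * mexp (t *\<^sub>R X)$j$j - mexp (t *\<^sub>R X)$i$j * mexp (t *\<^sub>R X)$j$i) has_vector_derivative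
    (mexp (t *\<^sub>R X)$i$i * (X ** mexp (t *\<^sub>R X))$j$j + (X ** mexp (t *\<^sub>R X))$i$i * mexp (t *\<^sub>R X)$j$j) -
    (mexp (t *\<^sub>R X)$i$j * (X ** mexp (t *\<^sub>R X))$j$i + (X ** mexp (t *\<^sub>R X))$i$j * mexp (t *\<^sub>R X)$j$i)) (at t)"
    by (intro has_vector_derivative_diff has_vector_derivative_mult d)
  then show ?thesis unfolding det_eq by (simp add: mult_nth algebra_simps)
qed

lemma RM_mexp: "RM X \<Longrightarrow> RM (mexp X)"
  using R RM_real real_mat_mexp by metis

lemma lie_algebra_G: "lie_algebra G = \<ll>"
proof
  show "lie_algebra G \<subseteq> \<ll>"
  proof
    fix X assume "X \<in> lie_algebra G"
    then have X: "RM (mexp (t *\<^sub>R X))" "det (mexp (t *\<^sub>R X)) = 1" for t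
      by (auto simp: lie_algebra_def G_def)
    have "RM X" using R RM_real real_mat_if_exp X(1) by metis
    moreover have "X$i$i + X$j$j = 0"
    proof -
      have "((\<lambda>t. 1) has_vector_derivative X$i$i + X$j$j) (at (0::real))"
        using det_mexp_derivative[of X 0] unfolding X(2) by simp
      moreover have "((\<lambda>t. 1::complex) has_vector_derivative 0) (at (0::real))" by simp
      ultimately show ?thesis by (rule vector_derivative_unique_at)
    qed
    ultimately show "X \<in> \<ll>" by (simp add: \<ll>_def)
  qed
  show "\<ll> \<subseteq> lie_algebra G"
  proof
    fix X assume X: "X \<in> \<ll>"
    have "((\<lambda>t. det (mexp (t *\<^sub>R X))) has_vector_derivative 0) (at t)" for t
      using det_mexp_derivative[of X t] X by (simp add: \<ll>_def)
    from const_if_vector_derivative_0[OF this] have "det (mexp (t *\<^sub>R X)) = 1" for t by (simp add: det_eq)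
    then show "X \<in> lie_algebra G"
      using X by (simp add: lie_algebra_def G_def RM_mexp \<ll>_def RM_closed)
  qed
qed

lemma G_inverse:
  assumes "g \<in> G"
  shows "g ** mk (g$j$j) (- g$i$j) (- g$j$i) (g$i$i) = mat 1"
    "mk (g$j$j) (- g$i$j) (- g$j$i) (g$i$i) \<in> G"
  using assms by (simp_all add: G_def mat_eq mult_nth det_eq RM_def R_closed algebra_simps)

lemma G_inv: "g \<in> G \<Longrightarrow> matrix_inv g = mk (g$j$j) (- g$i$j) (- g$j$i) (g$i$i)"
  by (rule matrix_inv_eqI) (rule G_inverse)

lemma V_herm:
  assumes "x \<in> V"
  shows "cnj (x$i$i) = x$i$i" "cnj (x$j$j) = x$j$j" "cnj (x$i$j) = x$j$i" "cnj (x$j$i) = x$i$j"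
    "Im (x$i$i) = 0" "Im (x$j$j) = 0"
proof -
  have "ct x = x" using assms by (simp add: V_def)
  then show "cnj (x$i$i) = x$i$i" "cnj (x$j$j) = x$j$j" "cnj (x$i$j) = x$j$i" "cnj (x$j$i) = x$i$j"
    by (metis ct_nth)+
  then show "Im (x$i$i) = 0" "Im (x$j$j) = 0" by (metis complex_cnj_cancel_iff Reals_cnj_iff complex_is_Real_iff)+
qed

lemma subspace_V: "subspace V"
  unfolding subspace_def V_def by (auto simp: RM_closed ct_linear vec_eq_iff)

lemma inner_eq: "x \<bullet> y = x$i$i \<bullet> y$i$i + x$i$j \<bullet> y$i$j + x$j$i \<bullet> y$j$i + x$j$j \<bullet> y$j$j" for x y :: "'n cmat"
  by (simp add: inner_vec_def sum2)

lemma V_mk: "x \<in> V \<longleftrightarrow> RM x \<and> x$i$i \<in> \<real> \<and> x$j$j \<in> \<real> \<and> x$j$i = cnj (x$i$j)"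
  by (auto simp: V_def mat_eq Reals_cnj_iff)

lemma pauli_orthogonal:
  "pairwise orthogonal {mat 1, mk 0 1 1 0, mk 1 0 0 (-1), mk 0 \<i> (-\<i>) 0}"
  "pairwise orthogonal {mat 1, mk 0 1 1 0, mk 1 0 0 (-1)}"
  by (auto simp: pairwise_def orthogonal_def inner_eq inner_complex_def)

lemma pauli_card:
  "card {mat 1, mk 0 1 1 0, mk 1 0 0 (-1), mk 0 \<i> (-\<i>) 0} = 4"
  "card {mat 1, mk 0 1 1 0, mk 1 0 0 (-1)} = 3"
  by (auto simp: card_insert_if mat_eq)

lemma dim_V: "dim V \<ge> 3"
proof -
  have "independent {mat 1, mk 0 1 1 0, mk 1 0 0 (-1)}"
    by (rule pairwise_orthogonal_independent[OF pauli_orthogonal(2)]) (auto simp: mat_eq)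
  moreover have "{mat 1, mk 0 1 1 0, mk 1 0 0 (-1)} \<subseteq> V" by (auto simp: V_mk RM_def R_closed)
  ultimately show ?thesis using independent_card_le_dim pauli_card(2) by metis
qed

lemma dim_V_complex: "R = UNIV \<Longrightarrow> dim V \<ge> 4"
proof -
  assume "R = UNIV"
  have "independent {mat 1, mk 0 1 1 0, mk 1 0 0 (-1), mk 0 \<i> (-\<i>) 0}"
    by (rule pairwise_orthogonal_independent[OF pauli_orthogonal(1)]) (auto simp: mat_eq)
  moreover have "{mat 1, mk 0 1 1 0, mk 1 0 0 (-1), mk 0 \<i> (-\<i>) 0} \<subseteq> V"
    using RM_real(2)[OF \<open>R = UNIV\<close>] by (auto simp: V_mk)
  ultimately show ?thesis using independent_card_le_dim pauli_card(1) by metis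
qed

sublocale lorentz_space V b0
proof
  show "subspace V" by (rule subspace_V)
  show "b0 \<in> V" by (simp add: V_mk b0_def RM_closed complex_is_Real_iff)
  have "b0 \<bullet> b0 = 1" unfolding inner_eq b0_def by (simp add: inner_complex_def)
  then show "norm b0 = 1" using norm_eq_1 by blast
  show "3 \<le> dim V" by (rule dim_V)
qed

text \<open>The polarization of minus twice the determinant. It is complex bilinear, so
  multiplicativity can be applied to products such as \<open>g ** x\<close> that are not
  Hermitian.\<close>

definition polar :: "'n cmat \<Rightarrow> 'n cmat \<Rightarrow> complex" where
  "polar x y = x$i$j * y$j$i + x$j$i * y$i$j - x$i$i * y$j$j - x$j$j * y$i$i"

lemma inner_b0: "x \<bullet> b0 = (Re (x$i$i) + Re (x$j$j)) / sqrt 2"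
  by (simp add: b0_def inner_eq inner_complex_def add_divide_distrib)

lemma q_polar:
  assumes "x \<in> V" "y \<in> V"
  shows "of_real (q x y) = polar x y"
proof -
  have j: "x$j$i = cnj (x$i$j)" "y$j$i = cnj (y$i$j)" using assms V_herm by metis+
  have "q x y = x \<bullet> y - (Re (x$i$i) + Re (x$j$j)) * (Re (y$i$i) + Re (y$j$j))"
    by (simp add: q_def inner_b0)
  then show ?thesis
    using V_herm(5,6)[OF assms(1)] V_herm(5,6)[OF assms(2)]
    by (simp add: complex_eq_iff polar_def inner_eq inner_complex_def j algebra_simps)
qed

end

section \<open>The action on Hermitian matrices\<close>

context sl2
begin

definition \<rho> :: "'n cmat \<Rightarrow> 'n cmat \<Rightarrow> 'n cmat" where "\<rho> g x = g ** x ** ct g"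
definition d\<rho> :: "'n cmat \<Rightarrow> 'n cmat \<Rightarrow> 'n cmat" where "d\<rho> X x = X ** x + x ** ct X"

lemma polar_mult: "polar (g ** x) (g ** y) = det g * polar x y" "polar (x ** g) (y ** g) = det g * polar x y"
  by (simp_all add: polar_def mult_nth det_eq algebra_simps)

lemma det_ct: "det (ct g) = cnj (det g)" for g :: "'n cmat"
  by (simp add: det_eq)

lemma ct_ct [simp]: "ct (ct A) = A"
  by (simp add: vec_eq_iff)

lemma rho_V: "g \<in> G \<Longrightarrow> x \<in> V \<Longrightarrow> \<rho> g x \<in> V"
  by (simp add: V_def G_def \<rho>_def ct_mult RM_closed matrix_mul_assoc)

lemma rho_q:
  assumes "g \<in> G" "x \<in> V" "y \<in> V" shows "q (\<rho> g x) (\<rho> g y) = q x y"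
proof -
  have "complex_of_real (q (\<rho> g x) (\<rho> g y)) = polar (\<rho> g x) (\<rho> g y)"
    using assms by (intro q_polar rho_V)
  also have "\<dots> = polar x y"
    using assms(1) by (simp add: \<rho>_def polar_mult det_ct G_def)
  also have "\<dots> = of_real (q x y)" using assms by (simp add: q_polar)
  finally show ?thesis by simp
qed

lemma H_entries:
  assumes "x \<in> H"
  shows "Re (x$i$i) > 0" "Re (x$j$j) > 0" "Re (x$i$i) * Re (x$j$j) - (cmod (x$i$j))\<^sup>2 = 1/2"
proof -
  have xV: "x \<in> V" and qx: "q x x = -1" and pos: "x \<bullet> b0 > 0" using assms by (auto simp: H_def)
  note h = V_herm[OF xV]
  have "polar x x = - 1" using q_polar[OF xV xV] qx by simp
  then have "Re (polar x x) = -1" by simp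
  have "x$j$i = cnj (x$i$j)" using h by simp
  show 1: "Re (x$i$i) * Re (x$j$j) - (cmod (x$i$j))\<^sup>2 = 1/2"
  proof -
    have cm: "(cmod c)\<^sup>2 = Re c * Re c + Im c * Im c" for c unfolding cmod_power2 by (simp add: power2_eq_square)
    show ?thesis
      using h(5,6) \<open>Re (polar x x) = -1\<close> \<open>x$j$i = cnj (x$i$j)\<close> unfolding cm by (simp add: polar_def algebra_simps)
  qed
  have sum: "Re (x$i$i) + Re (x$j$j) > 0" using pos by (simp add: inner_b0 zero_less_divide_iff)
  have "Re (x$i$i) * Re (x$j$j) > 0" using 1 zero_le_power2[of "cmod (x$i$j)"] by linarith
  then show "Re (x$i$i) > 0" "Re (x$j$j) > 0" using sum by (auto simp: zero_less_mult_iff)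
qed

lemma rho_H:
  assumes g: "g \<in> G" and x: "x \<in> H" shows "\<rho> g x \<in> H"
proof -
  have xV: "x \<in> V" and qx: "q x x = -1" using x by (auto simp: H_def)
  have yV: "\<rho> g x \<in> V" by (rule rho_V[OF g xV])
  have qy: "q (\<rho> g x) (\<rho> g x) = -1" using rho_q[OF g xV xV] qx by simp
  note h = V_herm[OF xV] and e = H_entries[OF x]
  define p r where "p = Re (x$i$i)" and "r = Re (x$j$j)"
  have pr: "x$i$i = of_real p" "x$j$j = of_real r" using h(5,6) by (auto simp: p_def r_def complex_eq_iff)
  have nn: "Re (\<rho> g x $ a $ a) \<ge> 0" for a
  proof -
    define v1 v2 c where "v1 = g$a$i" and "v2 = g$a$j" and "c = x$i$j"
    have cc: "x$j$i = cnj c" using h by (simp add: c_def)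
    \<comment> \<open>Completing the square in the Hermitian form of \<open>x\<close> at row
      \<open>a\<close> of \<open>g\<close>; the positive determinant of \<open>x\<close> makes the
      remainder nonnegative.\<close>
    have "of_real p * (\<rho> g x $ a $ a) = (v1 * of_real p + v2 * cnj c) * cnj (v1 * of_real p + v2 * cnj c)
        + (of_real p * of_real r - c * cnj c) * (v2 * cnj v2)"
      by (simp add: \<rho>_def mult_nth pr cc flip: v1_def v2_def c_def) (simp add: algebra_simps)
    also have "\<dots> = of_real ((cmod (v1 * of_real p + v2 * cnj c))\<^sup>2 + (p * r - (cmod c)\<^sup>2) * (cmod v2)\<^sup>2)"
      by (simp add: complex_norm_square[symmetric] del: complex_cnj_mult complex_cnj_add)
    finally have "Re (of_real p * (\<rho> g x $ a $ a)) = (cmod (v1 * of_real p + v2 * cnj c))\<^sup>2 + (p * r - (cmod c)\<^sup>2) * (cmod v2)\<^sup>2"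
      by simp
    then have "p * Re (\<rho> g x $ a $ a) \<ge> 0" using e(3) by (simp add: p_def r_def c_def)
    then show ?thesis using e(1) by (simp add: p_def zero_le_mult_iff)
  qed
  have "\<rho> g x \<bullet> b0 \<ge> 0" using nn[of i] nn[of j] by (simp add: inner_b0)
  moreover have "\<rho> g x \<bullet> b0 \<noteq> 0"
  proof
    assume "\<rho> g x \<bullet> b0 = 0"
    then show False using qy inner_ge_zero[of "\<rho> g x"] by (simp add: q_def)
  qed
  ultimately show ?thesis using yV qy by (simp add: H_def)
qed

text \<open>When \<open>Y\<close> squares to -1, \<open>cos t\<close> times the identity plus
  \<open>sin t\<close> times \<open>Y\<close> solves the differential equation of the
  exponential.\<close>

lemma mexp_rotation:
  fixes Y :: "'n cmat"
  assumes Y: "Y ** Y = - mat 1"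
  shows "mexp (pi *\<^sub>R Y) = - mat 1"
proof -
  define \<gamma> where "\<gamma> t = cos t *\<^sub>R (mat 1 :: 'n cmat) + sin t *\<^sub>R Y" for t :: real
  have "(\<gamma> has_vector_derivative Y ** \<gamma> t) (at t)" for t
  proof -
    have "Y ** \<gamma> t = (- sin t) *\<^sub>R mat 1 + cos t *\<^sub>R Y" by (simp add: \<gamma>_def cmat_mult_simps Y)
    moreover have "(\<gamma> has_vector_derivative (- sin t) *\<^sub>R mat 1 + cos t *\<^sub>R Y) (at t)"
      unfolding \<gamma>_def has_vector_derivative_def by (auto intro!: derivative_eq_intros simp: algebra_simps)
    ultimately show ?thesis by simp
  qed
  from mexp_ode_unique'[OF this, of pi] show ?thesis by (simp add: \<gamma>_def)
qed

text \<open>Only 1 and -1 act trivially. The substance is -1, which is written as the exponential of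
  \<open>pi\<close> times an element \<open>Y\<close> of square -1 that annihilates
  \<open>z\<close>.\<close>

lemma rho_kernel:
  assumes g: "g \<in> G" and id: "\<And>x. x \<in> V \<Longrightarrow> \<rho> g x = x" and z: "z \<in> H"
  shows "\<exists>X\<in>\<ll>. d\<rho> X z = 0 \<and> g = mexp X"
proof -
  have "\<rho> g (mk 1 0 0 0) = mk 1 0 0 0" "\<rho> g (mk 0 0 0 1) = mk 0 0 0 1" "\<rho> g (mk 0 1 1 0) = mk 0 1 1 0"
    by (rule id, simp add: V_mk RM_def R_closed)+
  then have e: "g$j$i = 0" "g$i$j = 0" "g$j$j * cnj (g$j$j) = 1" "g$i$i * cnj (g$j$j) = 1"
    by (auto simp: \<rho>_def mat_eq mult_nth)
  then have "g$i$i * cnj (g$j$j) = g$j$j * cnj (g$j$j)" "cnj (g$j$j) \<noteq> 0" by auto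
  then have e2: "g$i$i = g$j$j" by simp
  have "g$i$i * g$j$j = 1" using g e by (simp add: G_def det_eq)
  then have "(g$i$i)\<^sup>2 = 1" using e2 by (simp add: power2_eq_square)
  then have "g$i$i = 1 \<or> g$i$i = -1" by (simp add: power2_eq_1_iff)
  then have "g = mat 1 \<or> g = - mat 1" using e e2 by (auto simp: mat_eq)
  then show ?thesis
  proof
    assume "g = mat 1"
    moreover have "0 \<in> \<ll>" by (simp add: \<ll>_def RM_closed)
    ultimately show ?thesis by (intro bexI[of _ 0]) (auto simp: d\<rho>_def cmat_mult_simps mat_eq mult_nth)
  next
    assume g1: "g = - mat 1"
    have zV: "z \<in> V" using z by (simp add: H_def)
    note h = V_herm[OF zV] and e = H_entries[OF z]
    define c where "c = z$i$j"
    have zji: "z$j$i = cnj c" using h by (simp add: c_def)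
    \<comment> \<open>\<open>b\<close> is \<open>sqrt 2\<close> times the phase of \<open>c\<close>,
      with phase 1 for \<open>c = 0\<close>. The modulus gives \<open>Y\<close> determinant 1
      because \<open>z\<close> has determinant 1/2, and the phase gives it trace 0.\<close>
    obtain b where b: "b \<in> R" "b * cnj b = 2" "cnj c * b = c * cnj b"
    proof (cases "c = 0")
      case True
      show ?thesis by (rule that[of "of_real (sqrt 2)"]) (auto simp: R_closed True simp flip: of_real_mult)
    next
      case False
      define m where "m = cmod c"
      have m: "m > 0" "c * cnj c = of_real (m\<^sup>2)" using False by (auto simp: m_def complex_norm_square[symmetric])
      have cR: "c \<in> R" using zV by (simp add: V_mk RM_def c_def)
      show ?thesis
      proof (rule that[of "of_real (sqrt 2 / m) * c"])
        show "of_real (sqrt 2 / m) * c \<in> R" using cR by (simp only: R_closed)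
        have "of_real (sqrt 2 / m) * c * cnj (of_real (sqrt 2 / m) * c) = of_real ((sqrt 2 / m)\<^sup>2) * (c * cnj c)"
          by (simp only: complex_cnj_mult complex_cnj_complex_of_real power2_eq_square of_real_mult mult_ac)
        also have "\<dots> = 2" unfolding m(2) using m(1) by (simp add: power_divide flip: of_real_mult)
        finally show "of_real (sqrt 2 / m) * c * cnj (of_real (sqrt 2 / m) * c) = 2" .
        show "cnj c * (of_real (sqrt 2 / m) * c) = c * cnj (of_real (sqrt 2 / m) * c)" by simp
      qed
    qed
    have dz: "z$i$i * z$j$j - c * cnj c = 1/2"
    proof -
      have "z$i$i = of_real (Re (z$i$i))" "z$j$j = of_real (Re (z$j$j))" using h(5,6) by (auto simp: complex_eq_iff)
      moreover have "c * cnj c = of_real ((cmod c)\<^sup>2)" by (metis complex_norm_square of_real_power)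
      ultimately have "z$i$i * z$j$j - c * cnj c = of_real (Re (z$i$i) * Re (z$j$j) - (cmod c)\<^sup>2)" by (metis of_real_diff of_real_mult)
      then show ?thesis using e(3) by (simp add: c_def)
    qed
    \<comment> \<open>\<open>Y\<close> is \<open>z\<close> times the skew-Hermitian matrix with
      off-diagonal entries \<open>b\<close> and \<open>- cnj b\<close>, hence
      \<open>Y ** z + z ** ct Y = 0\<close>. Trace 0 and determinant 1 force its square to be
      -1.\<close>
    define Y where "Y = mk (- c * cnj b) (z$i$i * b) (- z$j$j * cnj b) (cnj c * b)"
    have YV: "Y \<in> \<ll>" using zV b(1,3) by (auto simp: \<ll>_def Y_def RM_def R_closed V_mk c_def)
    have YY: "Y ** Y = - mat 1"
    proof -
      have d: "c * cnj b * (c * cnj b) - z$i$i * b * (z$j$j * cnj b) = - 1"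
      proof -
        have "c * cnj b * (c * cnj b) = c * cnj c * (b * cnj b)" by (subst (2) b(3)[symmetric]) (simp add: mult_ac)
        then have "c * cnj b * (c * cnj b) - z$i$i * b * (z$j$j * cnj b) = - (z$i$i * z$j$j - c * cnj c) * (b * cnj b)"
          by (simp add: algebra_simps)
        then show ?thesis using dz b(2) by simp
      qed
      show ?thesis unfolding mat_eq using d b(3) by (simp add: Y_def mult_nth algebra_simps)
    qed
    have "d\<rho> Y z = 0"
      using h b(3) by (simp add: d\<rho>_def mat_eq mult_nth Y_def zji algebra_simps flip: c_def)
    then have "d\<rho> (pi *\<^sub>R Y) z = 0" by (simp add: d\<rho>_def cmat_mult_simps ct_linear flip: scaleR_add_right)
    moreover have "pi *\<^sub>R Y \<in> \<ll>" using YV by (simp add: \<ll>_def RM_closed flip: scaleR_add_right)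
    ultimately show ?thesis using mexp_rotation[OF YY] g1 by (intro bexI[of _ "pi *\<^sub>R Y"]) auto
  qed
qed

definition adj :: "'n cmat \<Rightarrow> 'n cmat" where
  "adj x = mk (x$j$j) (- x$i$j) (- x$j$i) (x$i$i)"

lemma wedge_exists:
  assumes u: "u \<in> V" and v: "v \<in> V"
  shows "\<exists>X\<in>\<ll>. \<forall>x\<in>V. d\<rho> X x = q v x *\<^sub>R u - q u x *\<^sub>R v"
proof -
  \<comment> \<open>Adjugates satisfy a Clifford relation: \<open>x ** adj y + y ** adj x\<close> is
    \<open>- polar x y\<close> times the identity. As in spin groups, the antisymmetrized product
    then generates the motion in the plane of \<open>u\<close> and \<open>v\<close>, with
    normalization \<open>-1/2\<close>.\<close>
  define X where "X = (-1/2) *\<^sub>R (u ** adj v - v ** adj u)"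
  have ru: "RM u" "RM v" using u v by (auto simp: V_mk)
  have "RM X" unfolding X_def using ru
    by (intro RM_closed) (auto simp: adj_def RM_def R_closed)
  moreover have "X$i$i + X$j$j = 0" by (simp add: X_def adj_def mult_nth algebra_simps flip: scaleR_add_right)
  ultimately have "X \<in> \<ll>" by (simp add: \<ll>_def)
  moreover have "d\<rho> X x = q v x *\<^sub>R u - q u x *\<^sub>R v" if x: "x \<in> V" for x
  proof -
    have s: "r *\<^sub>R (A :: complex) = of_real r * A" for r A by (simp add: scaleR_conv_of_real)
    note hu = V_herm(1-4)[OF u] and hv = V_herm(1-4)[OF v]
    show ?thesis
      unfolding mat_eq
      by (simp add: s q_polar[OF v x] q_polar[OF u x])
         (simp add: d\<rho>_def mult_nth X_def adj_def polar_def hu hv s algebra_simps)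
  qed
  ultimately show ?thesis by blast
qed

text \<open>The reflection in the diagonal Pauli matrix swaps the two diagonal units and fixes the
  real off-diagonal one, so \<open>g\<close> is off-diagonal with two equal entries of square -1.
  The reals contain no such entry; over the complex numbers this \<open>g\<close> negates the
  remaining Pauli matrix, which the reflection fixes.\<close>

lemma no_reflection: "\<exists>a\<in>V. q a a = 1 \<and> \<not> (\<exists>g\<in>G. \<forall>x\<in>V. \<rho> g x = x - (2 * q a x) *\<^sub>R a)"
proof (intro bexI[of _ "(1 / sqrt 2) *\<^sub>R mk 1 0 0 (-1)"] conjI notI)
  let ?a = "(1 / sqrt 2) *\<^sub>R mk 1 0 0 (-1)"
  show aV: "?a \<in> V" by (simp add: V_mk RM_closed RM_def R_closed complex_is_Real_iff)
  have s: "r *\<^sub>R (A :: complex) = of_real r * A" for r A by (simp add: scaleR_conv_of_real)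
  have s2: "complex_of_real (sqrt 2) * of_real (sqrt 2) = 2" by (simp flip: of_real_mult)
  have "complex_of_real (q ?a ?a) = 1"
    unfolding q_polar[OF aV aV] by (simp add: polar_def s s2)
  then show "q ?a ?a = 1" by simp
  assume "\<exists>g\<in>G. \<forall>x\<in>V. \<rho> g x = x - (2 * q ?a x) *\<^sub>R ?a"
  then obtain g where g: "g \<in> G" "\<And>x. x \<in> V \<Longrightarrow> \<rho> g x = x - (2 * q ?a x) *\<^sub>R ?a" by blast
  have V1: "mk 1 0 0 0 \<in> V" "mk 0 0 0 1 \<in> V" "mk 0 1 1 0 \<in> V" by (simp_all add: V_mk RM_def R_closed)
  have "complex_of_real (q ?a (mk 1 0 0 0)) = of_real (1 / sqrt 2)"
    "complex_of_real (q ?a (mk 0 0 0 1)) = of_real (- 1 / sqrt 2)"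
    "complex_of_real (q ?a (mk 0 1 1 0)) = of_real 0"
    using V1 by (simp_all add: q_polar[OF aV] polar_def s)
  then have qa: "q ?a (mk 1 0 0 0) = 1 / sqrt 2" "q ?a (mk 0 0 0 1) = - 1 / sqrt 2" "q ?a (mk 0 1 1 0) = 0"
    by (simp_all only: of_real_eq_iff)
  have "\<rho> g (mk 1 0 0 0) = mk 0 0 0 1" "\<rho> g (mk 0 0 0 1) = mk 1 0 0 0" "\<rho> g (mk 0 1 1 0) = mk 0 1 1 0"
    unfolding g(2)[OF V1(1)] g(2)[OF V1(2)] g(2)[OF V1(3)] qa by (simp_all add: mat_eq)
  then have e: "g$i$i = 0" "g$j$j = 0" "g$i$j * cnj (g$i$j) = 1" "g$i$j * cnj (g$j$i) = 1"
    by (auto simp: \<rho>_def mat_eq mult_nth)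
  then have "g$i$j * cnj (g$i$j) = g$i$j * cnj (g$j$i)" "g$i$j \<noteq> 0" by auto
  then have t: "g$j$i = g$i$j" by simp
  have dt: "- (g$i$j * g$i$j) = 1" using g(1) e t by (simp add: G_def det_eq)
  show False
  proof (cases "R = UNIV")
    case True
    have V2: "mk 0 \<i> (-\<i>) 0 \<in> V" using RM_real(2)[OF True] by (simp add: V_mk)
    have "complex_of_real (q ?a (mk 0 \<i> (-\<i>) 0)) = of_real 0"
      using V2 by (simp add: q_polar[OF aV] polar_def s)
    then have "q ?a (mk 0 \<i> (-\<i>) 0) = 0" by (simp only: of_real_eq_iff)
    then have "\<rho> g (mk 0 \<i> (-\<i>) 0) = mk 0 \<i> (-\<i>) 0" using g(2)[OF V2] by simp
    then have "- (\<i> * (g$i$j * cnj (g$i$j))) = \<i>" using e t by (auto simp: \<rho>_def mat_eq mult_nth mult_ac)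
    then show False using e(3) by simp
  next
    case False
    moreover have "g$i$j \<in> R" using g(1) by (simp add: G_def RM_def)
    ultimately have "g$i$j \<in> \<real>" using R by auto
    then obtain r where "g$i$j = of_real r" by (auto elim: Reals_cases)
    then have "complex_of_real (- (r * r)) = of_real 1" using dt by simp
    then have "- (r * r) = 1" by (simp only: of_real_eq_iff)
    then show False using zero_le_square[of r] by linarith
  qed
qed

text \<open>The determinant of the coordinates \<open>x$i$i\<close>, \<open>x$i$j\<close>,
  \<open>x$j$j\<close> of three real symmetric matrices.\<close>

definition vol :: "'n cmat \<Rightarrow> 'n cmat \<Rightarrow> 'n cmat \<Rightarrow> real" where
  "vol x y z = Re (x$i$i) * (Re (y$i$j) * Re (z$j$j) - Re (y$j$j) * Re (z$i$j))
    - Re (x$i$j) * (Re (y$i$i) * Re (z$j$j) - Re (y$j$j) * Re (z$i$i))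
    + Re (x$j$j) * (Re (y$i$i) * Re (z$i$j) - Re (y$i$j) * Re (z$i$i))"

lemma alt3_vol: "alt3 vol"
  unfolding alt3_def linear_iff vol_def by (simp add: algebra_simps)

text \<open>On symmetric matrices the group acts by the symmetric square of \<open>g\<close>, whose
  determinant is the cube of that of \<open>g\<close>.\<close>

lemma vol_invariant:
  assumes R: "R = \<real>" and g: "g \<in> G" and V: "x \<in> V" "y \<in> V" "z \<in> V"
  shows "vol (\<rho> g x) (\<rho> g y) (\<rho> g z) = vol x y z"
proof -
  define a b c d where "a = Re (g$i$i)" and "b = Re (g$i$j)" and "c = Re (g$j$i)" and "d = Re (g$j$j)"
  have gr: "g$i$i = of_real a" "g$i$j = of_real b" "g$j$i = of_real c" "g$j$j = of_real d"
  proof -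
    have "RM g" using g by (simp add: G_def)
    then have "g$i$i \<in> R" "g$i$j \<in> R" "g$j$i \<in> R" "g$j$j \<in> R" unfolding RM_def by auto
    then have "g$i$i \<in> \<real>" "g$i$j \<in> \<real>" "g$j$i \<in> \<real>" "g$j$j \<in> \<real>" using R by simp_all
    then show "g$i$i = of_real a" "g$i$j = of_real b" "g$j$i = of_real c" "g$j$j = of_real d"
      by (auto simp: a_def b_def c_def d_def)
  qed
  have "complex_of_real (a * d - b * c) = of_real 1" using g by (simp add: G_def det_eq gr)
  then have D: "a * d - b * c = 1" by (simp only: of_real_eq_iff)
  have e: "Re (\<rho> g x $i$i) = a * a * Re (x$i$i) + 2 * (a * b) * Re (x$i$j) + b * b * Re (x$j$j)"
    "Re (\<rho> g x $i$j) = a * c * Re (x$i$i) + (a * d + b * c) * Re (x$i$j) + b * d * Re (x$j$j)"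
    "Re (\<rho> g x $j$j) = c * c * Re (x$i$i) + 2 * (c * d) * Re (x$i$j) + d * d * Re (x$j$j)" if "x \<in> V" for x
  proof -
    have "Re (x$j$i) = Re (x$i$j)" using arg_cong[OF V_herm(3)[OF that], of Re] by simp
    then show "Re (\<rho> g x $i$i) = a * a * Re (x$i$i) + 2 * (a * b) * Re (x$i$j) + b * b * Re (x$j$j)"
      "Re (\<rho> g x $i$j) = a * c * Re (x$i$i) + (a * d + b * c) * Re (x$i$j) + b * d * Re (x$j$j)"
      "Re (\<rho> g x $j$j) = c * c * Re (x$i$i) + 2 * (c * d) * Re (x$i$j) + d * d * Re (x$j$j)"
      by (simp_all add: \<rho>_def mult_nth gr algebra_simps)
  qed
  have "vol (\<rho> g x) (\<rho> g y) (\<rho> g z) = (a * d - b * c) ^ 3 * vol x y z"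
    unfolding vol_def e[OF V(1)] e[OF V(2)] e[OF V(3)] by algebra
  then show ?thesis using D by simp
qed

lemma lorentz_rep_sl2: "lorentz_rep V b0 G \<rho> d\<rho>"
proof (intro lorentz_rep.intro matrix_lie_algebra.intro lorentz_rep_axioms.intro)
  show "lorentz_space V b0" by unfold_locales
  show "subspace (lie_algebra G)"
    unfolding lie_algebra_G subspace_def \<ll>_def
    by (auto simp: RM_closed algebra_simps simp flip: scaleR_add_right)
  show "bra X Y \<in> lie_algebra G" if "X \<in> lie_algebra G" "Y \<in> lie_algebra G" for X Y
    using that unfolding lie_algebra_G \<ll>_def by (simp add: bra_def RM_closed mult_nth algebra_simps)
  show "mat 1 \<in> G" by (simp add: G_def RM_closed)
  show "g ** h \<in> G" if "g \<in> G" "h \<in> G" for g h using that by (simp add: G_def RM_closed det_mul)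
  show inv: "matrix_inv g \<in> G" if "g \<in> G" for g using G_inv[OF that] G_inverse[OF that] by simp
  show inv1: "g ** matrix_inv g = mat 1" if "g \<in> G" for g using G_inv[OF that] G_inverse[OF that] by simp
  show "linear (\<rho> g)" for g by (simp add: linear_iff \<rho>_def cmat_mult_simps)
  show "\<rho> g x \<in> V" if "g \<in> G" "x \<in> V" for g x using rho_V[OF that] .
  show "q (\<rho> g x) (\<rho> g y) = q x y" if "g \<in> G" "x \<in> V" "y \<in> V" for g x y using rho_q[OF that] .
  show "\<rho> g x \<in> H" if "g \<in> G" "x \<in> H" for g x using rho_H[OF that] .
  show "\<rho> (g ** h) x = \<rho> g (\<rho> h x)" for g h x by (simp add: \<rho>_def ct_mult matrix_mul_assoc)
  show "\<rho> (mat 1) x = x" for x by (simp add: \<rho>_def)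
  have "bilinear d\<rho>" unfolding bilinear_def linear_iff d\<rho>_def by (simp add: cmat_mult_simps ct_linear algebra_simps)
  then show "bounded_bilinear d\<rho>" by (simp add: bilinear_conv_bounded_bilinear)
  show "((\<lambda>t. \<rho> (mexp (t *\<^sub>R X)) x) has_vector_derivative d\<rho> X (\<rho> (mexp (t *\<^sub>R X)) x)) (at t)" for X x t
    unfolding \<rho>_def d\<rho>_def by (rule congruence_flow)
  show "g ** X ** matrix_inv g \<in> lie_algebra G" if "g \<in> G" "X \<in> lie_algebra G" for g X
  proof -
    have "RM (g ** X ** matrix_inv g)" using that inv[OF that(1)] unfolding lie_algebra_G
      by (intro RM_closed) (auto simp: G_def \<ll>_def)
    moreover have "(g ** X ** matrix_inv g)$i$i + (g ** X ** matrix_inv g)$j$j = det g * (X$i$i + X$j$j)"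
      unfolding G_inv[OF that(1)] by (simp add: mult_nth det_eq algebra_simps)
    ultimately show ?thesis using that unfolding lie_algebra_G by (simp add: \<ll>_def)
  qed
  show "d\<rho> (g ** X ** matrix_inv g) x = \<rho> g (d\<rho> X (\<rho> (matrix_inv g) x))" if "g \<in> G" for g X x
  proof -
    have "ct (matrix_inv g) ** ct g = mat 1" using inv1[OF that] by (simp add: flip: ct_mult)
    moreover have "\<rho> g (d\<rho> X (\<rho> (matrix_inv g) x)) =
      g ** X ** matrix_inv g ** x ** (ct (matrix_inv g) ** ct g) + (g ** matrix_inv g) ** x ** ct (matrix_inv g) ** ct X ** ct g"
      by (simp add: \<rho>_def d\<rho>_def cmat_mult_simps matrix_mul_assoc)
    ultimately show ?thesis using inv1[OF that] by (simp add: d\<rho>_def ct_mult matrix_mul_assoc)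
  qed
  show "d\<rho> (bra X Y) x = d\<rho> X (d\<rho> Y x) - d\<rho> Y (d\<rho> X x)" for X Y x
    by (simp add: d\<rho>_def bra_def cmat_mult_simps ct_linear ct_mult matrix_mul_assoc)
  show "X = 0" if X: "X \<in> lie_algebra G" and z: "\<And>x. x \<in> V \<Longrightarrow> d\<rho> X x = 0" for X
  proof -
    have "d\<rho> X (mk 1 0 0 0) = 0" "d\<rho> X (mk 0 0 0 1) = 0" "d\<rho> X (mk 0 1 1 0) = 0"
      by (rule z, simp add: V_mk RM_def R_closed)+
    then have "X$j$i = 0" "X$i$j = 0" "X$i$i + cnj (X$i$i) = 0" "X$j$j + cnj (X$i$i) = 0"
      by (auto simp: d\<rho>_def mat_eq mult_nth)
    moreover have "X$i$i + X$j$j = 0" using X unfolding lie_algebra_G by (simp add: \<ll>_def)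
    ultimately show "X = 0" by (auto simp: mat_eq complex_eq_iff)
  qed
  show "\<exists>X\<in>lie_algebra G. \<forall>x\<in>V. d\<rho> X x = q v x *\<^sub>R u - q u x *\<^sub>R v" if "u \<in> V" "v \<in> V" for u v
    using wedge_exists[OF that] unfolding lie_algebra_G .
  show "\<exists>X\<in>lie_algebra G. d\<rho> X z = 0 \<and> g = mexp X" if "g \<in> G" "\<And>x. x \<in> V \<Longrightarrow> \<rho> g x = x" "z \<in> H" for g z
    using rho_kernel[OF that] unfolding lie_algebra_G .
  show "\<exists>a\<in>V. q a a = 1 \<and> \<not> (\<exists>g\<in>G. \<forall>x\<in>V. \<rho> g x = x - (2 * q a x) *\<^sub>R a)" by (rule no_reflection)
  show "\<exists>\<omega>. alt3 \<omega> \<and> (\<forall>g\<in>G. \<forall>x\<in>V. \<forall>y\<in>V. \<forall>z\<in>V. \<omega> (\<rho> g x) (\<rho> g y) (\<rho> g z) = \<omega> x y z) \<and>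
      (\<exists>x\<in>V. \<exists>y\<in>V. \<exists>z\<in>V. \<omega> x y z \<noteq> 0)" if "dim V = 3"
  proof -
    \<comment> \<open>In the complex case the dimension is at least 4, so dimension 3 leaves the
      real group.\<close>
    have Rr: "R = \<real>" using dim_V_complex that R by auto
    have V1: "mk 1 0 0 0 \<in> V" "mk 0 1 1 0 \<in> V" "mk 0 0 0 1 \<in> V" by (simp_all add: V_mk RM_def R_closed)
    have "vol (mk 1 0 0 0) (mk 0 1 1 0) (mk 0 0 0 1) \<noteq> 0" by (simp add: vol_def)
    then show ?thesis using alt3_vol vol_invariant[OF Rr] V1 by (intro exI[of _ vol] conjI) blast+
  qed
qed

end

section \<open>The groups SO(n,1)\<close>

lemma mexp_add: "mexp ((s + t) *\<^sub>R X) = mexp (t *\<^sub>R X) ** mexp (s *\<^sub>R X)" for X :: "'n::finite cmat"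
proof -
  have "((\<lambda>t. mexp ((s + t) *\<^sub>R X)) has_vector_derivative X ** mexp ((s + t) *\<^sub>R X)) (at t)" for t
  proof -
    have "((\<lambda>t. s + t) has_real_derivative 1) (at t)" by (auto intro!: derivative_eq_intros)
    from vector_diff_chain_at[OF this[unfolded has_real_derivative_iff_has_vector_derivative] mexp_has_vector_derivative]
    show ?thesis by (simp add: o_def)
  qed
  from mexp_ode_unique'[OF this, of t] show ?thesis by simp
qed

text \<open>Gives closure of the Lie algebra under the adjoint action directly from its definition
  by one-parameter groups.\<close>

lemma mexp_conjugate:
  fixes g h X :: "'n::finite cmat"
  assumes "g ** h = mat 1"
  shows "mexp (t *\<^sub>R (g ** X ** h)) = g ** mexp (t *\<^sub>R X) ** h"
proof -
  have hg: "h ** g = mat 1" using assms matrix_left_right_inverse[of g h] by simp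
  have "bounded_linear (\<lambda>A. g ** A ** h)"
    using linear_conv_bounded_linear[of "\<lambda>A. g ** A ** h"] by (simp add: linear_iff cmat_mult_simps)
  then have "((\<lambda>t. g ** mexp (t *\<^sub>R X) ** h) has_vector_derivative g ** (X ** mexp (t *\<^sub>R X)) ** h) (at t)" for t
    by (rule bounded_linear.has_vector_derivative) (rule mexp_has_vector_derivative)
  moreover have "g ** (X ** mexp (t *\<^sub>R X)) ** h = (g ** X ** h) ** (g ** mexp (t *\<^sub>R X) ** h)" for t
  proof -
    have "(g ** X ** h) ** (g ** mexp (t *\<^sub>R X) ** h) = g ** X ** (h ** g) ** mexp (t *\<^sub>R X) ** h"
      by (simp add: matrix_mul_assoc)
    then show ?thesis by (simp add: hg matrix_mul_assoc)
  qed
  ultimately have "((\<lambda>t. g ** mexp (t *\<^sub>R X) ** h) has_vector_derivative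
      (g ** X ** h) ** (g ** mexp (t *\<^sub>R X) ** h)) (at t)" for t by simp
  from mexp_ode_unique'[OF this, of t] show ?thesis using assms by simp
qed

lemma bounded_linear_transpose: "bounded_linear (transpose :: 'n::finite cmat \<Rightarrow> 'n cmat)"
  using linear_conv_bounded_linear[of "transpose :: 'n cmat \<Rightarrow> 'n cmat"]
  by (simp add: linear_iff transpose_def vec_eq_iff)

text \<open>Group elements are complex matrices with real entries; this passes to the real matrices
  that act on Minkowski space.\<close>

definition rmat :: "'n::finite cmat \<Rightarrow> real^'n^'n" where
  "rmat A = (\<chi> a b. Re (A $ a $ b))"

lemma rmat_nth [simp]: "rmat A $ a $ b = Re (A $ a $ b)"
  by (simp add: rmat_def)

lemma rmat_linear: "rmat (A + B) = rmat A + rmat B" "rmat (c *\<^sub>R A) = c *\<^sub>R rmat A" "rmat (A - B) = rmat A - rmat B"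
  by (simp_all add: vec_eq_iff)

lemma rmat_one [simp]: "rmat (mat 1) = mat 1"
  by (simp add: vec_eq_iff mat_def)

lemma real_mat_eqI: "real_mat A \<Longrightarrow> real_mat B \<Longrightarrow> rmat A = rmat B \<Longrightarrow> A = B"
  by (simp add: vec_eq_iff real_mat_def complex_eq_iff complex_is_Real_iff)

lemma real_mat_Im: "real_mat A \<Longrightarrow> Im (A $ a $ b) = 0"
  by (simp add: real_mat_def complex_is_Real_iff)

lemma rmat_mult: "real_mat A \<Longrightarrow> real_mat B \<Longrightarrow> rmat (A ** B) = rmat A ** rmat B"
  by (simp add: vec_eq_iff matrix_matrix_mult_def real_mat_Im)

lemma det_of_real: "real_mat A \<Longrightarrow> det A = of_real (det (rmat A))"
proof -
  assume A: "real_mat A"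
  have "A $ a $ b = of_real (rmat A $ a $ b)" for a b using real_mat_Im[OF A] by (simp add: complex_eq_iff)
  then show ?thesis unfolding det_def by simp
qed

locale so_n1 =
  fixes i0 :: "'n::finite"
  assumes card: "CARD('n) \<ge> 3"
begin

abbreviation J :: "'n cmat" where "J \<equiv> lorentz_form i0"
abbreviation S :: "'n cmat set" where "S \<equiv> SO_n1 i0"
abbreviation G :: "'n cmat set" where "G \<equiv> SOe_n1 i0"
definition b0 :: "real^'n" where "b0 = axis i0 1"

definition \<epsilon> :: "'n \<Rightarrow> real" where "\<epsilon> a = (if a = i0 then -1 else 1)"

lemma \<epsilon>_square [simp]: "\<epsilon> a * \<epsilon> a = 1"
  by (simp add: \<epsilon>_def)

lemma J_nth: "J $ a $ b = (if a = b then of_real (\<epsilon> a) else 0)"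
  by (simp add: lorentz_form_def \<epsilon>_def)

lemma real_J: "real_mat J" by (auto simp: real_mat_def J_nth)

lemma J_left: "(J ** A) $ a $ b = of_real (\<epsilon> a) * A $ a $ b"
  by (simp add: matrix_matrix_mult_def J_nth if_distrib[of "\<lambda>x. x * _"] cong: if_cong)

lemma J_right: "(A ** J) $ a $ b = A $ a $ b * of_real (\<epsilon> b)"
  by (simp add: matrix_matrix_mult_def J_nth if_distrib[of "\<lambda>x. _ * x"] cong: if_cong)

lemma JJ: "J ** J = mat 1"
  by (auto simp: vec_eq_iff J_left J_nth mat_def simp flip: of_real_mult)

lemma transpose_J: "transpose J = J"
  by (auto simp: vec_eq_iff transpose_def J_nth)

sublocale lorentz_space UNIV b0
  by unfold_locales (use card in \<open>auto simp: b0_def norm_axis_1\<close>)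

lemma inner_b0 [simp]: "x \<bullet> b0 = x $ i0"
  by (simp add: b0_def inner_axis)

lemma q_eq: "q x y = (\<Sum>a\<in>UNIV. \<epsilon> a * x $ a * y $ a)"
proof -
  have "(\<Sum>a\<in>UNIV. \<epsilon> a * x $ a * y $ a) = (\<Sum>a\<in>UNIV. x $ a * y $ a - (if a = i0 then 2 * (x $ a * y $ a) else 0))"
    by (intro sum.cong) (auto simp: \<epsilon>_def)
  also have "\<dots> = (\<Sum>a\<in>UNIV. x $ a * y $ a) - 2 * (x $ i0 * y $ i0)"
    by (simp add: sum_subtractf)
  finally have "(\<Sum>a\<in>UNIV. \<epsilon> a * x $ a * y $ a) = x \<bullet> y - 2 * (x $ i0 * y $ i0)" by (simp add: inner_vec_def)
  then show ?thesis by (simp add: q_def)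
qed

text \<open>The inverse of a Lorentz matrix in closed form. Being linear in \<open>g\<close> it is
  continuous, so it maps the identity component into itself.\<close>

definition gi :: "'n cmat \<Rightarrow> 'n cmat" where "gi g = J ** transpose g ** J"

lemma real_transpose: "real_mat A \<Longrightarrow> real_mat (transpose A)"
  by (simp add: real_mat_def transpose_def)

lemma S_inv:
  assumes "g \<in> S"
  shows "g ** gi g = mat 1" "gi g ** g = mat 1" "gi g \<in> S"
proof -
  have g: "real_mat g" "transpose g ** J ** g = J" "det g = 1" using assms by (auto simp: SO_n1_def)
  show 1: "gi g ** g = mat 1"
    unfolding gi_def by (simp add: matrix_mul_assoc[symmetric]) (simp add: matrix_mul_assoc g(2) JJ)
  then show 2: "g ** gi g = mat 1" using matrix_left_right_inverse[of g "gi g"] by simp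
  have "(g ** J ** transpose g) ** J = mat 1" using 2 by (simp add: gi_def matrix_mul_assoc)
  then have "(g ** J ** transpose g) ** J ** J = J" by simp
  then have 3: "g ** J ** transpose g = J" by (simp add: matrix_mul_assoc[symmetric] JJ)
  have "transpose (gi g) = J ** g ** J"
    by (simp add: gi_def matrix_transpose_mul transpose_J matrix_mul_assoc)
  then have "transpose (gi g) ** J ** gi g = J ** g ** (J ** J) ** J ** transpose g ** J"
    by (simp add: gi_def matrix_mul_assoc)
  also have "\<dots> = J ** (g ** J ** transpose g) ** J" by (simp add: JJ matrix_mul_assoc)
  also have "\<dots> = J" by (simp add: 3 JJ)
  finally have "transpose (gi g) ** J ** gi g = J" .
  moreover have "det (gi g) = 1"
  proof -
    have "det (gi g) * det g = 1" using 1 by (metis det_I det_mul)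
    then show ?thesis using g(3) by simp
  qed
  moreover have "real_mat (gi g)" unfolding gi_def by (intro real_mat_mult real_J real_transpose g)
  ultimately show "gi g \<in> S" by (simp add: SO_n1_def)
qed

lemma S_mult: "g \<in> S \<Longrightarrow> h \<in> S \<Longrightarrow> g ** h \<in> S"
proof -
  assume g: "g \<in> S" and h: "h \<in> S"
  have "transpose (g ** h) ** J ** (g ** h) = transpose h ** (transpose g ** J ** g) ** h"
    by (simp add: matrix_transpose_mul matrix_mul_assoc)
  then show ?thesis using g h by (simp add: SO_n1_def real_mat_mult det_mul)
qed

lemma S_one: "mat 1 \<in> S"
  by (simp add: SO_n1_def real_mat_one)

lemma G_S: "g \<in> G \<Longrightarrow> g \<in> S"
  unfolding SOe_n1_def using connected_component_in by blast

lemma G_component: "g \<in> G \<longleftrightarrow> connected_component S (mat 1) g"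
  by (simp add: SOe_n1_def)

lemma component_image:
  assumes "connected_component S x y" "continuous_on UNIV f" "f ` S \<subseteq> S"
  shows "connected_component S (f x) (f y)"
proof -
  obtain T where T: "connected T" "T \<subseteq> S" "x \<in> T" "y \<in> T"
    using assms(1) unfolding connected_component_def by blast
  have "connected (f ` T)" using T(1) assms(2) continuous_on_subset by (intro connected_continuous_image) auto
  then show ?thesis unfolding connected_component_def using T assms(3) by (intro exI[of _ "f ` T"]) auto
qed

lemma G_one: "mat 1 \<in> G"
  by (simp add: G_component S_one)

lemma G_mult:
  assumes "g \<in> G" "h \<in> G" shows "g ** h \<in> G"
proof -
  have "connected_component S (g ** mat 1) (g ** h)"
  proof (rule component_image[where f = "(**) g"])
    show "connected_component S (mat 1) h" using assms by (simp add: G_component)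
    show "continuous_on UNIV ((**) g :: 'n cmat \<Rightarrow> 'n cmat)"
      by (rule linear_continuous_on[OF bounded_bilinear.bounded_linear_right[OF bounded_bilinear_matrix_mult]])
    show "(**) g ` S \<subseteq> S" using S_mult[OF G_S[OF assms(1)]] by blast
  qed
  then show ?thesis using assms(1) unfolding G_component by (metis connected_component_trans matrix_mul_rid)
qed

lemma gi_one: "gi (mat 1) = mat 1"
  by (simp add: gi_def JJ)

lemma G_gi: "g \<in> G \<Longrightarrow> gi g \<in> G"
proof -
  assume g: "g \<in> G"
  have "linear gi"
    using bounded_linear.linear[OF bounded_linear_transpose[where 'n = 'n]]
    by (simp add: linear_iff gi_def cmat_mult_simps)
  then have "continuous_on UNIV gi"
    by (intro linear_continuous_on) (simp add: linear_conv_bounded_linear)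
  moreover have "gi ` S \<subseteq> S" using S_inv(3) by blast
  moreover have "connected_component S (mat 1) g" using g by (simp only: G_component)
  ultimately have "connected_component S (gi (mat 1)) (gi g)" by (rule component_image[rotated])
  then show ?thesis by (simp add: gi_one G_component)
qed

lemma G_inv: "g \<in> G \<Longrightarrow> matrix_inv g = gi g"
  by (rule matrix_inv_eqI) (simp add: S_inv G_S)

definition \<rho> :: "'n cmat \<Rightarrow> real^'n \<Rightarrow> real^'n" where "\<rho> g x = rmat g *v x"

lemma rho_q_S:
  assumes "g \<in> S" shows "q (\<rho> g x) (\<rho> g y) = q x y"
proof -
  have g: "real_mat g" "transpose g ** J ** g = J" using assms by (auto simp: SO_n1_def)
  have gJ: "(\<Sum>a\<in>UNIV. Re (g$a$b) * \<epsilon> a * Re (g$a$c)) = (if b = c then \<epsilon> b else 0)" for b c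
  proof -
    have "(transpose g ** J ** g) $ b $ c = (\<Sum>a\<in>UNIV. g$a$b * of_real (\<epsilon> a) * g$a$c)"
      by (simp add: matrix_matrix_mult_def[of "transpose g ** J"] J_right) (simp add: transpose_def)
    then have "(\<Sum>a\<in>UNIV. g$a$b * of_real (\<epsilon> a) * g$a$c) = (if b = c then of_real (\<epsilon> b) else 0)"
      unfolding g(2) by (simp add: J_nth)
    then have "Re (\<Sum>a\<in>UNIV. g$a$b * of_real (\<epsilon> a) * g$a$c) = Re (if b = c then of_real (\<epsilon> b) else 0)" by simp
    then show ?thesis using real_mat_Im[OF g(1)] by (simp split: if_splits)
  qed
  have "q (\<rho> g x) (\<rho> g y) = (\<Sum>a\<in>UNIV. \<epsilon> a * (\<Sum>b\<in>UNIV. Re (g$a$b) * x$b) * (\<Sum>c\<in>UNIV. Re (g$a$c) * y$c))"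
    by (simp add: q_eq \<rho>_def matrix_vector_mult_def)
  also have "\<dots> = (\<Sum>a\<in>UNIV. \<Sum>b\<in>UNIV. \<Sum>c\<in>UNIV. x$b * y$c * (Re (g$a$b) * \<epsilon> a * Re (g$a$c)))"
    by (simp add: sum_distrib_left sum_distrib_right sum_product mult_ac)
  also have "\<dots> = (\<Sum>b\<in>UNIV. \<Sum>c\<in>UNIV. \<Sum>a\<in>UNIV. x$b * y$c * (Re (g$a$b) * \<epsilon> a * Re (g$a$c)))"
    by (subst sum.swap) (intro sum.cong refl sum.swap)
  also have "\<dots> = (\<Sum>b\<in>UNIV. \<Sum>c\<in>UNIV. x$b * y$c * (if b = c then \<epsilon> b else 0))"
    by (simp add: gJ flip: sum_distrib_left)
  also have "\<dots> = q x y" by (simp add: q_eq if_distrib[of "\<lambda>x. _ * x"] mult_ac cong: if_cong)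
  finally show ?thesis .
qed

text \<open>The image of \<open>b0\<close> is timelike, so its time coordinate cannot
  vanish.\<close>

lemma S_entry: "g \<in> S \<Longrightarrow> Re (g $ i0 $ i0) \<noteq> 0"
proof
  assume g: "g \<in> S" "Re (g $ i0 $ i0) = 0"
  have e: "\<rho> g b0 $ i0 = 0" using g(2) by (simp add: \<rho>_def b0_def matrix_vector_mult_basis column_def)
  have "q (\<rho> g b0) (\<rho> g b0) = -1" using rho_q_S[OF g(1), of b0 b0] b0_H by (simp add: H_def)
  moreover have "q (\<rho> g b0) (\<rho> g b0) = \<rho> g b0 \<bullet> \<rho> g b0" by (simp add: q_def e)
  ultimately show False using inner_ge_zero[of "\<rho> g b0"] by linarith
qed

text \<open>The entry never vanishes on \<open>S\<close>, so on a connected set through the identity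
  it keeps the sign it has there.\<close>

lemma G_entry:
  assumes "g \<in> G" shows "Re (g $ i0 $ i0) > 0"
proof (rule ccontr)
  assume n: "\<not> Re (g $ i0 $ i0) > 0"
  obtain T where T: "connected T" "T \<subseteq> S" "mat 1 \<in> T" "g \<in> T"
    using assms unfolding G_component connected_component_def by blast
  let ?f = "\<lambda>A :: 'n cmat. Re (A $ i0 $ i0)"
  have "continuous_on T ?f"
    by (intro linear_continuous_on bounded_linear_compose[OF bounded_linear_Re bounded_linear_entry])
  then have "connected (?f ` T)" using T(1) by (rule connected_continuous_image)
  moreover have "?f g \<in> ?f ` T" "?f (mat 1) \<in> ?f ` T" using T by blast+
  moreover have "?f g \<le> 0" "0 \<le> ?f (mat 1)" using n by (auto simp: mat_def)
  ultimately have "0 \<in> ?f ` T" unfolding connected_iff_interval by blast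
  then show False using S_entry T(2) by auto
qed

lemma rho_b0_H: "g \<in> G \<Longrightarrow> \<rho> g b0 \<in> H"
proof -
  assume g: "g \<in> G"
  have "q (\<rho> g b0) (\<rho> g b0) = -1" using rho_q_S[OF G_S[OF g], of b0 b0] b0_H by (simp add: H_def)
  moreover have "\<rho> g b0 $ i0 > 0" using G_entry[OF g] by (simp add: \<rho>_def b0_def matrix_vector_mult_basis column_def)
  ultimately show ?thesis by (simp add: H_def)
qed

lemma rho_H:
  assumes g: "g \<in> G" and x: "x \<in> H" shows "\<rho> g x \<in> H"
proof -
  have qq: "q (\<rho> g x) (\<rho> g x) = -1" using rho_q_S[OF G_S[OF g]] x by (simp add: H_def)
  \<comment> \<open>The image of \<open>b0\<close> is already known to be forward, and it decides
    the sheet of the image of \<open>x\<close>.\<close>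
  have "q (\<rho> g x) (\<rho> g b0) < 0" using rho_q_S[OF G_S[OF g]] q_H_neg[OF x b0_H] by simp
  then have "(1 / sqrt (- q (\<rho> g x) (\<rho> g x))) *\<^sub>R \<rho> g x \<in> H"
    using qq rho_b0_H[OF g] by (intro H_normalize[of _ "\<rho> g b0"]) auto
  then show ?thesis by (simp add: qq)
qed

definition \<ll> :: "'n cmat set" where "\<ll> = {X. real_mat X \<and> transpose X ** J + J ** X = 0}"

lemma form_derivative:
  fixes X :: "'n cmat"
  shows "((\<lambda>t. transpose (mexp (t *\<^sub>R X)) ** J ** mexp (t *\<^sub>R X)) has_vector_derivative
    transpose (mexp (t *\<^sub>R X)) ** (transpose X ** J + J ** X) ** mexp (t *\<^sub>R X)) (at t)"
proof -
  have 1: "((\<lambda>t. transpose (mexp (t *\<^sub>R X)) ** J) has_vector_derivative transpose (X ** mexp (t *\<^sub>R X)) ** J) (at t)"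
    by (rule bounded_linear.has_vector_derivative[OF bounded_bilinear.bounded_linear_left[OF bounded_bilinear_matrix_mult]
          bounded_linear.has_vector_derivative[OF bounded_linear_transpose mexp_has_vector_derivative]])
  from bounded_bilinear.has_vector_derivative[OF bounded_bilinear_matrix_mult 1 mexp_has_vector_derivative]
  show ?thesis by (simp add: matrix_transpose_mul matrix_mul_assoc cmat_mult_simps add.commute)
qed

lemma lie_algebra_G: "lie_algebra G = \<ll>"
proof
  show "lie_algebra G \<subseteq> \<ll>"
  proof
    fix X assume "X \<in> lie_algebra G"
    then have "mexp (t *\<^sub>R X) \<in> S" for t by (auto simp: lie_algebra_def intro: G_S)
    then have X: "real_mat (mexp (t *\<^sub>R X))" "transpose (mexp (t *\<^sub>R X)) ** J ** mexp (t *\<^sub>R X) = J" for t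
      by (auto simp: SO_n1_def)
    have "((\<lambda>t. J) has_vector_derivative transpose X ** J + J ** X) (at (0::real))"
      using form_derivative[of X 0] unfolding X(2) by simp
    moreover have "((\<lambda>t. J) has_vector_derivative 0) (at (0::real))" by simp
    ultimately have "transpose X ** J + J ** X = 0" by (rule vector_derivative_unique_at)
    then show "X \<in> \<ll>" using real_mat_if_exp[OF X(1)] by (simp add: \<ll>_def)
  qed
  show "\<ll> \<subseteq> lie_algebra G"
  proof
    fix X assume "X \<in> \<ll>"
    then have X: "real_mat X" "transpose X ** J + J ** X = 0" by (auto simp: \<ll>_def)
    have "((\<lambda>t. transpose (mexp (t *\<^sub>R X)) ** J ** mexp (t *\<^sub>R X)) has_vector_derivative 0) (at t)" for t
      using form_derivative[of X t] unfolding X(2) by (simp add: cmat_mult_simps)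
    from const_if_vector_derivative_0[OF this]
    have f: "transpose (mexp (t *\<^sub>R X)) ** J ** mexp (t *\<^sub>R X) = J" for t by simp
    \<comment> \<open>Preserving the form leaves determinant 1 or -1; the exponential at
      \<open>t\<close> is the square of the one at \<open>t / 2\<close>, which selects 1.\<close>
    have "det J * det J = 1" using JJ by (metis det_I det_mul)
    then have dJ: "det J \<noteq> 0" by auto
    have d: "det (mexp (t *\<^sub>R X)) * det (mexp (t *\<^sub>R X)) = 1" for t
      using arg_cong[OF f[of t], of det] dJ by (simp add: det_mul)
    have "det (mexp (t *\<^sub>R X)) = 1" for t
      using d[of "t / 2"] mexp_add[of "t / 2" "t / 2" X] by (simp add: det_mul)
    then have inS: "mexp (t *\<^sub>R X) \<in> S" for t
      using f X(1) by (simp add: SO_n1_def real_mat_mexp real_mat_scaleR)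
    \<comment> \<open>The one-parameter group is a connected set through the identity, hence
      contained in the identity component.\<close>
    have "continuous_on UNIV (\<lambda>t. mexp (t *\<^sub>R X))"
      by (rule continuous_at_imp_continuous_on) (use mexp_has_vector_derivative has_vector_derivative_continuous in blast)
    then have "connected (range (\<lambda>t. mexp (t *\<^sub>R X)))" by (rule connected_continuous_image) simp
    moreover have "mat 1 \<in> range (\<lambda>t. mexp (t *\<^sub>R X))" by (rule range_eqI[of _ _ 0]) simp
    ultimately have "mexp (t *\<^sub>R X) \<in> G" for t
      unfolding G_component connected_component_def using inS
      by (intro exI[of _ "range (\<lambda>t. mexp (t *\<^sub>R X))"]) auto
    then show "X \<in> lie_algebra G" by (simp add: lie_algebra_def)
  qed
qed

end

section \<open>Minkowski space as an instance of the interface\<close>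

context so_n1
begin

definition d\<rho> :: "'n cmat \<Rightarrow> real^'n \<Rightarrow> real^'n" where "d\<rho> X x = rmat X *v x"

lemma G_real: "g \<in> G \<Longrightarrow> real_mat g"
  using G_S by (auto simp: SO_n1_def)

lemma wedge_exists: "\<exists>X\<in>\<ll>. \<forall>x\<in>UNIV. d\<rho> X x = q v x *\<^sub>R u - q u x *\<^sub>R v"
proof -
  \<comment> \<open>The matrix of the required map in the standard basis;
    \<open>\<epsilon> b\<close> comes from writing \<open>q\<close> in coordinates.\<close>
  define X :: "'n cmat" where "X = (\<chi> a b. of_real (\<epsilon> b * (v $ b * u $ a - u $ b * v $ a)))"
  have "real_mat X" by (simp add: real_mat_def X_def)
  moreover have "transpose X ** J + J ** X = 0"
  proof -
    have "(transpose X ** J + J ** X) $ a $ b = 0" for a b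
    proof -
      have "(transpose X ** J + J ** X) $ a $ b =
        of_real (\<epsilon> a * (v $ a * u $ b - u $ a * v $ b) * \<epsilon> b + \<epsilon> a * (\<epsilon> b * (v $ b * u $ a - u $ b * v $ a)))"
        by (simp add: J_left J_right) (simp add: transpose_def X_def)
      also have "\<epsilon> a * (v $ a * u $ b - u $ a * v $ b) * \<epsilon> b + \<epsilon> a * (\<epsilon> b * (v $ b * u $ a - u $ b * v $ a)) = 0"
        by (simp add: algebra_simps)
      finally show ?thesis by simp
    qed
    then show ?thesis by (simp add: vec_eq_iff)
  qed
  moreover have "d\<rho> X x = q v x *\<^sub>R u - q u x *\<^sub>R v" for x
  proof -
    have "d\<rho> X x $ a = (q v x *\<^sub>R u - q u x *\<^sub>R v) $ a" for a
    proof -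
      have "d\<rho> X x $ a = (\<Sum>b\<in>UNIV. (\<epsilon> b * v $ b * x $ b) * u $ a - (\<epsilon> b * u $ b * x $ b) * v $ a)"
        by (simp add: d\<rho>_def matrix_vector_mult_def X_def algebra_simps)
      then show ?thesis by (simp add: sum_subtractf q_eq sum_distrib_right)
    qed
    then show ?thesis by (simp add: vec_eq_iff)
  qed
  ultimately show ?thesis by (intro bexI[of _ X]) (auto simp: \<ll>_def)
qed

text \<open>A reflection along a spatial coordinate axis has determinant -1.\<close>

lemma no_reflection: "\<exists>a\<in>UNIV. q a a = 1 \<and> \<not> (\<exists>g\<in>G. \<forall>x\<in>UNIV. \<rho> g x = x - (2 * q a x) *\<^sub>R a)"
proof -
  have "UNIV \<noteq> {i0}"
  proof
    assume "UNIV = {i0}"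
    then have "CARD('n) = card {i0}" by (rule arg_cong)
    then show False using card by simp
  qed
  then obtain j where j: "j \<noteq> i0" by blast
  let ?a = "axis j 1 :: real^'n"
  have qa: "q ?a x = x $ j" for x
    using j by (simp add: q_def inner_axis inner_commute[of "axis j 1" x]) (simp add: axis_def)
  have "q ?a ?a = 1" by (simp add: qa)
  moreover have False if g: "g \<in> G" "\<forall>x\<in>UNIV. \<rho> g x = x - (2 * q ?a x) *\<^sub>R ?a" for g
  proof -
    have e: "g $ a $ b = (if a = b then (if a = j then -1 else 1) else 0)" for a b
    proof -
      have "\<rho> g (axis b 1) $ a = (axis b 1 - (2 * q ?a (axis b 1)) *\<^sub>R ?a) $ a" using g(2) by simp
      then have "Re (g $ a $ b) = (if a = b then (if a = j then -1 else 1) else 0)"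
        by (simp add: \<rho>_def matrix_vector_mult_basis column_def qa) (auto simp: axis_def split: if_splits)
      then show ?thesis using real_mat_Im[OF G_real[OF g(1)], of a b] by (simp add: complex_eq_iff)
    qed
    have "det g = (\<Prod>a\<in>UNIV. g $ a $ a)" by (rule det_diagonal) (simp add: e)
    also have "\<dots> = (\<Prod>a\<in>UNIV. if a = j then -1 else 1)" by (simp add: e)
    also have "\<dots> = -1" by simp
    finally show False using G_S[OF g(1)] by (simp add: SO_n1_def)
  qed
  ultimately show ?thesis by blast
qed

text \<open>The form is the determinant with the three vectors as rows; a group element multiplies
  this matrix from the right by a transpose of determinant 1.\<close>

lemma orientation:
  assumes "dim (UNIV :: (real^'n) set) = 3"
  shows "\<exists>\<omega>. alt3 \<omega> \<and> (\<forall>g\<in>G. \<forall>x\<in>UNIV. \<forall>y\<in>UNIV. \<forall>z\<in>UNIV. \<omega> (\<rho> g x) (\<rho> g y) (\<rho> g z) = \<omega> x y z) \<and>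
      (\<exists>x\<in>UNIV. \<exists>y\<in>UNIV. \<exists>z\<in>UNIV. \<omega> x y z \<noteq> 0)"
proof -
  have "CARD('n) = 3" using assms by simp
  then obtain i1 i2 i3 :: 'n where i: "UNIV = {i1, i2, i3}" "i1 \<noteq> i2" "i2 \<noteq> i3" "i1 \<noteq> i3"
    by (auto simp: card_3_iff)
  define M where "M x y z = (\<chi> a. if a = i1 then x else if a = i2 then y else z)" for x y z :: "real^'n"
  define \<omega> where "\<omega> x y z = det (M x y z)" for x y z
  \<comment> \<open>Each row is isolated in turn, in the shape in which linearity of the determinant
    in one row applies.\<close>
  have M1: "M x y z = (\<chi> a. if a = i1 then x else M 0 y z $ a)" for x y z
    by (simp add: M_def vec_eq_iff)
  have M2: "M x y z = (\<chi> a. if a = i2 then y else M x 0 z $ a)" for x y z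
    using i(2) by (auto simp: M_def vec_eq_iff)
  have M3: "M x y z = (\<chi> a. if a = i3 then z else M x y 0 $ a)" for x y z
  proof -
    have "a = i3" if "a \<noteq> i1" "a \<noteq> i2" for a using that i(1) by blast
    then show ?thesis using i(2-4) by (auto simp: M_def vec_eq_iff)
  qed
  have lin: "linear (\<lambda>x. det (\<chi> a. if a = l then x else F a))" for l and F :: "'n \<Rightarrow> real^'n"
    using det_row_add[of l "\<lambda>_. _" "\<lambda>_. _" F] det_row_mul[of l _ "\<lambda>_. _" F]
    unfolding scalar_mult_eq_scaleR by (simp add: linear_iff)
  have "linear (\<lambda>x. \<omega> x y z)" for y z
  proof -
    have "(\<lambda>x. \<omega> x y z) = (\<lambda>x. det (\<chi> a. if a = i1 then x else M 0 y z $ a))" unfolding \<omega>_def by (subst M1) (rule refl)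
    then show ?thesis using lin by simp
  qed
  moreover have "linear (\<lambda>y. \<omega> x y z)" for x z
  proof -
    have "(\<lambda>y. \<omega> x y z) = (\<lambda>y. det (\<chi> a. if a = i2 then y else M x 0 z $ a))" unfolding \<omega>_def by (subst M2) (rule refl)
    then show ?thesis using lin by simp
  qed
  moreover have "linear (\<omega> x y)" for x y
  proof -
    have "\<omega> x y = (\<lambda>z. det (\<chi> a. if a = i3 then z else M x y 0 $ a))" unfolding \<omega>_def by (subst M3) (rule refl)
    then show ?thesis using lin by simp
  qed
  moreover have "\<omega> x x y = 0" "\<omega> x y x = 0" "\<omega> y x x = 0" for x y
    unfolding \<omega>_def using i(2-4)
    by (auto intro: det_identical_rows[of i1 i2] det_identical_rows[of i1 i3] det_identical_rows[of i2 i3] simp: M_def row_def)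
  ultimately have "alt3 \<omega>" by (simp add: alt3_def)
  moreover have "\<omega> (\<rho> g x) (\<rho> g y) (\<rho> g z) = \<omega> x y z" if g: "g \<in> G" for g x y z
  proof -
    have "M (\<rho> g x) (\<rho> g y) (\<rho> g z) = M x y z ** transpose (rmat g)"
      by (auto simp: M_def vec_eq_iff matrix_matrix_mult_def \<rho>_def matrix_vector_mult_def transpose_def mult.commute)
    moreover have "complex_of_real (det (rmat g)) = of_real 1"
      using det_of_real[OF G_real[OF g]] G_S[OF g] by (simp add: SO_n1_def)
    then have "det (rmat g) = 1" by (simp only: of_real_eq_iff)
    ultimately show ?thesis by (simp add: \<omega>_def det_mul det_transpose)
  qed
  moreover have "\<omega> (axis i1 1) (axis i2 1) (axis i3 1) \<noteq> 0"
  proof -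
    have "M (axis i1 1) (axis i2 1) (axis i3 1) $ a $ b = (mat 1 :: real^'n^'n) $ a $ b" for a b
    proof -
      have "a \<in> {i1, i2, i3}" using i(1) by blast
      then show ?thesis using i(2-4) by (auto simp: M_def mat_def axis_def)
    qed
    then have "M (axis i1 1) (axis i2 1) (axis i3 1) = mat 1" by (simp add: vec_eq_iff)
    then show ?thesis by (simp add: \<omega>_def)
  qed
  ultimately show ?thesis by blast
qed

lemma lorentz_rep_so: "lorentz_rep UNIV b0 G \<rho> d\<rho>"
proof (intro lorentz_rep.intro matrix_lie_algebra.intro lorentz_rep_axioms.intro)
  show "lorentz_space UNIV b0" by unfold_locales
  have tl: "transpose (A + B) = transpose A + transpose B" "transpose (c *\<^sub>R A) = c *\<^sub>R transpose A"
    "transpose (A - B) = transpose A - transpose B" "transpose 0 = (0 :: 'n cmat)" for A B :: "'n cmat" and c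
    by (simp_all add: transpose_def vec_eq_iff)
  show "subspace (lie_algebra G)"
    unfolding lie_algebra_G
  proof (rule subspaceI)
    show "0 \<in> \<ll>" by (simp add: \<ll>_def real_mat_def tl cmat_mult_simps)
    show "X + Y \<in> \<ll>" if "X \<in> \<ll>" "Y \<in> \<ll>" for X Y
    proof -
      have "transpose (X + Y) ** J + J ** (X + Y) = (transpose X ** J + J ** X) + (transpose Y ** J + J ** Y)"
        by (simp add: tl cmat_mult_simps)
      then show ?thesis using that by (simp add: \<ll>_def real_mat_def)
    qed
    show "c *\<^sub>R X \<in> \<ll>" if "X \<in> \<ll>" for c X
    proof -
      have "transpose (c *\<^sub>R X) ** J + J ** (c *\<^sub>R X) = c *\<^sub>R (transpose X ** J + J ** X)"
        by (simp add: tl cmat_mult_simps scaleR_add_right)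
      then show ?thesis using that by (simp add: \<ll>_def real_mat_scaleR)
    qed
  qed
  show "bra X Y \<in> lie_algebra G" if "X \<in> lie_algebra G" "Y \<in> lie_algebra G" for X Y
  proof -
    have X: "real_mat X" "transpose X ** J = - (J ** X)" and Y: "real_mat Y" "transpose Y ** J = - (J ** Y)"
      using that unfolding lie_algebra_G \<ll>_def by (auto simp: eq_neg_iff_add_eq_0)
    have *: "transpose (A ** B) ** J = J ** B ** A"
      if "transpose A ** J = - (J ** A)" "transpose B ** J = - (J ** B)" for A B :: "'n cmat"
    proof -
      have "transpose (A ** B) ** J = transpose B ** (transpose A ** J)"
        by (simp add: matrix_transpose_mul matrix_mul_assoc)
      also have "\<dots> = - ((transpose B ** J) ** A)" by (simp add: that(1) cmat_mult_simps matrix_mul_assoc)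
      finally show ?thesis by (simp add: that(2) cmat_mult_simps)
    qed
    have "transpose (bra X Y) ** J + J ** bra X Y = 0"
      by (simp add: bra_def tl cmat_mult_simps *[OF X(2) Y(2)] *[OF Y(2) X(2)] matrix_mul_assoc)
    moreover have "real_mat (bra X Y)"
      using real_mat_mult[OF X(1) Y(1)] real_mat_mult[OF Y(1) X(1)] by (simp add: bra_def real_mat_def)
    ultimately show ?thesis unfolding lie_algebra_G by (simp add: \<ll>_def)
  qed
  show "mat 1 \<in> G" by (rule G_one)
  show "g ** h \<in> G" if "g \<in> G" "h \<in> G" for g h using G_mult[OF that] .
  show inv: "matrix_inv g \<in> G" if "g \<in> G" for g using G_inv[OF that] G_gi[OF that] by simp
  show inv1: "g ** matrix_inv g = mat 1" if "g \<in> G" for g using G_inv[OF that] S_inv(1)[OF G_S[OF that]] by simp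
  show "linear (\<rho> g)" for g unfolding \<rho>_def by (rule matrix_vector_mul_linear)
  show "q (\<rho> g x) (\<rho> g y) = q x y" if "g \<in> G" for g x y using rho_q_S[OF G_S[OF that]] .
  show "\<rho> g x \<in> H" if "g \<in> G" "x \<in> H" for g x using rho_H[OF that] .
  show "\<rho> (g ** h) x = \<rho> g (\<rho> h x)" if "g \<in> G" "h \<in> G" for g h x
    using that by (simp add: \<rho>_def rmat_mult G_real matrix_vector_mul_assoc)
  show "\<rho> (mat 1) x = x" for x by (simp add: \<rho>_def)
  have "linear (d\<rho> X)" for X unfolding d\<rho>_def by (rule matrix_vector_mul_linear)
  moreover have "linear (\<lambda>X. d\<rho> X x)" for x
    by (simp add: linear_iff d\<rho>_def rmat_linear matrix_vector_mult_add_rdistrib scaleR_matrix_vector_assoc)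
  ultimately have "bilinear d\<rho>" by (simp add: bilinear_def)
  then show bb: "bounded_bilinear d\<rho>" by (simp add: bilinear_conv_bounded_bilinear)
  show "((\<lambda>t. \<rho> (mexp (t *\<^sub>R X)) x) has_vector_derivative d\<rho> X (\<rho> (mexp (t *\<^sub>R X)) x)) (at t)"
    if "X \<in> lie_algebra G" for X x t
  proof -
    have X: "real_mat X" "real_mat (mexp (t *\<^sub>R X))"
      using that unfolding lie_algebra_G by (auto simp: \<ll>_def real_mat_mexp real_mat_scaleR)
    have "((\<lambda>t. d\<rho> (mexp (t *\<^sub>R X)) x) has_vector_derivative d\<rho> (X ** mexp (t *\<^sub>R X)) x) (at t)"
      by (rule bounded_linear.has_vector_derivative[OF bounded_bilinear.bounded_linear_left[OF bb] mexp_has_vector_derivative])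
    then show ?thesis by (simp add: d\<rho>_def \<rho>_def rmat_mult X matrix_vector_mul_assoc)
  qed
  show "g ** X ** matrix_inv g \<in> lie_algebra G" if "g \<in> G" "X \<in> lie_algebra G" for g X
    using that mexp_conjugate[OF inv1[OF that(1)]] inv[OF that(1)] by (simp add: lie_algebra_def G_mult)
  show "d\<rho> (g ** X ** matrix_inv g) x = \<rho> g (d\<rho> X (\<rho> (matrix_inv g) x))" if "g \<in> G" "X \<in> lie_algebra G" for g X x
  proof -
    have "real_mat X" using that unfolding lie_algebra_G by (simp add: \<ll>_def)
    then show ?thesis using G_real[OF that(1)] G_real[OF inv[OF that(1)]]
      by (simp add: d\<rho>_def \<rho>_def rmat_mult real_mat_mult matrix_vector_mul_assoc matrix_mul_assoc)
  qed
  show "d\<rho> (bra X Y) x = d\<rho> X (d\<rho> Y x) - d\<rho> Y (d\<rho> X x)" if "X \<in> lie_algebra G" "Y \<in> lie_algebra G" for X Y x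
    using that unfolding lie_algebra_G
    by (simp add: \<ll>_def d\<rho>_def bra_def rmat_linear rmat_mult matrix_vector_mult_diff_rdistrib matrix_vector_mul_assoc)
  show "X = 0" if X: "X \<in> lie_algebra G" and z: "\<And>x. x \<in> UNIV \<Longrightarrow> d\<rho> X x = 0" for X
  proof -
    have "real_mat X" using X unfolding lie_algebra_G by (simp add: \<ll>_def)
    moreover have "rmat X = rmat 0"
      using z by (simp add: matrix_eq d\<rho>_def rmat_def vec_eq_iff matrix_vector_mult_def)
    ultimately show ?thesis by (intro real_mat_eqI) (simp_all add: real_mat_def)
  qed
  show "\<exists>X\<in>lie_algebra G. \<forall>x\<in>UNIV. d\<rho> X x = q v x *\<^sub>R u - q u x *\<^sub>R v" for u v
    using wedge_exists unfolding lie_algebra_G .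
  show "\<exists>X\<in>lie_algebra G. d\<rho> X z = 0 \<and> g = mexp X" if "g \<in> G" "\<And>x. x \<in> UNIV \<Longrightarrow> \<rho> g x = x" for g z
  proof -
    have "rmat g = rmat (mat 1)" using that(2) by (simp add: matrix_eq \<rho>_def)
    then have "g = mat 1" using G_real[OF that(1)] real_mat_one by (intro real_mat_eqI)
    moreover have "0 \<in> lie_algebra G" unfolding lie_algebra_G by (simp add: \<ll>_def real_mat_def tl cmat_mult_simps)
    ultimately show ?thesis
      using bounded_bilinear.zero_left[OF bb] by (intro bexI[of _ 0]) auto
  qed
  show "\<exists>a\<in>UNIV. q a a = 1 \<and> \<not> (\<exists>g\<in>G. \<forall>x\<in>UNIV. \<rho> g x = x - (2 * q a x) *\<^sub>R a)" by (rule no_reflection)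
  show "\<exists>\<omega>. alt3 \<omega> \<and> (\<forall>g\<in>G. \<forall>x\<in>UNIV. \<forall>y\<in>UNIV. \<forall>z\<in>UNIV. \<omega> (\<rho> g x) (\<rho> g y) (\<rho> g z) = \<omega> x y z) \<and>
      (\<exists>x\<in>UNIV. \<exists>y\<in>UNIV. \<exists>z\<in>UNIV. \<omega> x y z \<noteq> 0)" if "dim (UNIV :: (real^'n) set) = 3"
    by (rule orientation[OF that])
qed simp_all

end

theorem theorem3p2:
  fixes G0 :: "('n::finite) cmat set" and \<theta> :: "'n cmat \<Rightarrow> 'n cmat"
  assumes grp: "(CARD('n) = 2 \<and> G0 = SL_R) \<or> (CARD('n) = 2 \<and> G0 = SL_C) \<or>
                (CARD('n) \<ge> 3 \<and> (\<exists>i0. G0 = SOe_n1 i0))"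
    and cartan: "cartan_involution (lie_algebra G0) \<theta>"
  shows "(\<forall>a1 a2 a3.
            maximal_abelian_subspace (cartan_s (lie_algebra G0) \<theta>) a1 \<and>
            maximal_abelian_subspace (cartan_s (lie_algebra G0) \<theta>) a2 \<and>
            maximal_abelian_subspace (cartan_s (lie_algebra G0) \<theta>) a3 \<longrightarrow>
            (G0 \<times> G0 \<times> G0 =
               {(k1 ** mexp X1 ** h, k2 ** mexp X2 ** h, k3 ** mexp X3 ** h) | k1 k2 k3 X1 X2 X3 h.
                  k1 \<in> analytic_subgroup (cartan_k (lie_algebra G0) \<theta>) \<and>
                  k2 \<in> analytic_subgroup (cartan_k (lie_algebra G0) \<theta>) \<and>
                  k3 \<in> analytic_subgroup (cartan_k (lie_algebra G0) \<theta>) \<and>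
                  X1 \<in> a1 \<and> X2 \<in> a2 \<and> X3 \<in> a3 \<and> h \<in> G0})
            \<longleftrightarrow> dim {X1 + X2 + X3 | X1 X2 X3. X1 \<in> a1 \<and> X2 \<in> a2 \<and> X3 \<in> a3} = 2)
       \<and> (\<exists>a :: ('n cmat \<times> 'n cmat \<times> 'n cmat) set.
            subspace a \<and>
            (\<forall>(X1, X2, X3)\<in>a. X1 \<in> cartan_s (lie_algebra G0) \<theta> \<and>
                X2 \<in> cartan_s (lie_algebra G0) \<theta> \<and> X3 \<in> cartan_s (lie_algebra G0) \<theta>) \<and>
            (\<forall>(X1, X2, X3)\<in>a. \<forall>(Y1, Y2, Y3)\<in>a. bra X1 Y1 = 0 \<and> bra X2 Y2 = 0 \<and> bra X3 Y3 = 0) \<and>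
            G0 \<times> G0 \<times> G0 =
               {(k1 ** mexp X1 ** h, k2 ** mexp X2 ** h, k3 ** mexp X3 ** h) | k1 k2 k3 X1 X2 X3 h.
                  k1 \<in> analytic_subgroup (cartan_k (lie_algebra G0) \<theta>) \<and>
                  k2 \<in> analytic_subgroup (cartan_k (lie_algebra G0) \<theta>) \<and>
                  k3 \<in> analytic_subgroup (cartan_k (lie_algebra G0) \<theta>) \<and>
                  (X1, X2, X3) \<in> a \<and> h \<in> G0})"
proof -
  \<comment> \<open>The type of the vector space stays open here: it becomes the matrix type for the
    special linear groups and \<open>real^'n\<close> for the Lorentz groups.\<close>
  have fin: ?thesis if "lorentz_rep V b0 G0 \<rho> d\<rho>" for V :: "'v::euclidean_space set" and b0 \<rho> d\<rho>
  proof -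
    interpret cartan_rep V b0 G0 \<rho> d\<rho> \<theta>
      using that cartan by (intro cartan_rep.intro cartan_rep_axioms.intro)
    show ?thesis using triple_decomposition by (rule conjI)
  qed
  from grp consider "CARD('n) = 2" "G0 = SL_R" | "CARD('n) = 2" "G0 = SL_C" | i0 where "CARD('n) \<ge> 3" "G0 = SOe_n1 i0"
    by blast
  then show ?thesis
  proof cases
    case 1
    then obtain i j :: 'n where ij: "UNIV = {i, j}" "i \<noteq> j" by (auto simp: card_2_iff)
    interpret sl2 i j \<real> by unfold_locales (use ij in auto)
    have "G0 = G" using 1(2) by (simp add: SL_R_def G_def RM_real)
    then show ?thesis using fin lorentz_rep_sl2 by simp
  next
    case 2
    then obtain i j :: 'n where ij: "UNIV = {i, j}" "i \<noteq> j" by (auto simp: card_2_iff)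
    interpret sl2 i j UNIV by unfold_locales (use ij in auto)
    have "G0 = G" using 2(2) by (simp add: SL_C_def G_def RM_real)
    then show ?thesis using fin lorentz_rep_sl2 by simp
  next
    case 3
    interpret so_n1 i0 by unfold_locales (rule 3)
    show ?thesis using fin lorentz_rep_so 3(2) by simp
  qed
qed

end
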